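(* Let $X$ be a complex Hilbert space, $Y$ a Hilbert space, $A_0:\mathcal{D}(A_0)\to X$ a strictly positive self-adjoint operator and $C\in\mathcal{L}(X,Y)$ such that $C^*C\in\mathcal{L}(\mathcal{D}(A_0^2))\cap\mathcal{L}(\mathcal{D}(A_0))$. Assume that the pair $(iA_0,C)$ is exactly observable in time $\tau>0$ and set $\eta:=\|\mathbb{L}_\tau\|_{\mathcal{L}(X)}<1$. Let $(X_h)_{h>0}$ be a family of finite-dimensional subspaces of $\mathcal{D}(A_0^{1/2})$ satisfying the approximation property stated in the context with exponent $\theta>0$, let $\Delta t>0$ be a time step with $\tau=K\Delta t$, $K$ a positive integer, and $t_k=k\Delta t$ for $0\le k\le K$. Let $z_0\in\mathcal{D}(A_0^2)$ be the initial value of the system $\dot z(t)=iA_0z(t)$ for $t\ge0$, $z(0)=z_0$, with output $y(t)=Cz(t)$ for $t\in[0,\tau]$, let $y_h^k\in Y$, $0\le k\le K$, be approximations of $y(t_k)$, set $$N_{h,\Delta t}=\frac{\ln(h^\theta+\Delta t)}{\ln\eta},$$ and let $z_{0,h,\Delta t}=\sum_{0\le n\le N_{h,\Delta t}}\mathbb{L}_{h,\Delta t,K}^{n}\,(z_h^-)^0$ (sum over integers $n$). Then there exist $M_\tau>0$ (which may depend on $\tau$ but not on $z_0$, $h$ or $\Delta t$), $h^*>0$ and $\Delta t^*>0$ such that for all $h\in(0,h^* )$ and all $\Delta t\in(0,\Delta t^* )$ $$\|z_0-z_{0,h,\Delta t}\|\le M_\tau\left[(h^\theta+\Delta t)\ln^2(h^\theta+\Delta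 t)\,\|z_0\|_2+|\ln(h^\theta+\Delta t)|\,\Delta t\sum_{\ell=0}^{K}\|C^*(y(t_\ell)-y_h^\ell)\|\right].$$
   Context: Notation. $\langle\cdot,\cdot\rangle$ and $\|\cdot\|$ are the inner product and norm of $X$; $\|\varphi\|_\alpha=\|A_0^\alpha\varphi\|$ is the norm of $\mathcal{D}(A_0^\alpha)$, and $\langle\varphi,\psi\rangle_{1/2}=\langle A_0^{1/2}\varphi,A_0^{1/2}\psi\rangle$. Exact observability of $(iA_0,C)$ in time $\tau$: there is $k_\tau>0$ such that $\int_0^\tau\|y(t)\|^2dt\ge k_\tau^2\|z_0\|^2$ for all $z_0\in\mathcal{D}(A_0)$, where $y(t)=Cz(t)$, $\dot z=iA_0z$, $z(0)=z_0$. Semigroups. $\mathbb{T}^+$ and $\mathbb{T}^-$ are the $C_0$-semigroups on $X$ generated by $iA_0-C^*C$ and $-iA_0-C^*C$ respectively, and $\mathbb{L}_\tau=\mathbb{T}^-_\tau\mathbb{T}^+_\tau$. Under exact observability in time $\tau$ it is known that $\|\mathbb{L}_\tau\|_{\mathcal{L}(X)}<1$. Galerkin spaces. $X_h\subset\mathcal{D}(A_0^{1/2})$ is endowed with the norm of $X$. $\pi_h$ is the orthogonal projection from $\mathcal{D}(A_0^{1/2})$ (with inner product $\langle\cdot,\cdot\rangle_{1/2}$) onto $X_h$. Approximation property: there exist $M>0$, $\theta>0$, $h^*>0$ such that $\|\pi_h\varphi-\varphi\|\le Mh^\theta\|\varphi\|_{1/2}$ for all $\varphi\in\mathcal{D}(A_0^{1/2})$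 and all $h\in(0,h^* )$. Fully discrete scheme. Put $D_tq^k=(q^k-q^{k-1})/\Delta t$. Given $q_{0,h}\in X_h$ and $F_h^k\in X$, let $(q_h^k)_{0\le k\le K}\subset X_h$ solve, for $1\le k\le K$ and all $\varphi_h\in X_h$, $$(S^\pm)\qquad\langle D_tq_h^k,\varphi_h\rangle=\pm i\langle q_h^k,\varphi_h\rangle_{1/2}-\langle C^*Cq_h^k,\varphi_h\rangle+\langle F_h^k,\varphi_h\rangle,\qquad q_h^0=q_{0,h}.$$ Discrete semigroups. For $q_0\in\mathcal{D}(A_0^{1/2})$, $\mathbb{T}^\pm_{h,\Delta t,k}q_0:=q_h^k$, where $(q_h^k)$ solves $(S^\pm)$ with $F_h^k=0$ for all $k$ and $q_{0,h}=\pi_hq_0$; and $\mathbb{L}_{h,\Delta t,K}=\mathbb{T}^-_{h,\Delta t,K}\mathbb{T}^+_{h,\Delta t,K}$. Discrete observers. $(z_h^+)^k:=q_h^k$, where $(q_h^k)$ solves $(S^+)$ with $F_h^k=C^*y_h^k$ and $q_h^0=0$. $(z_h^-)^k:=q_h^{K-k}$, where $(q_h^k)$ solves $(S^-)$ with $F_h^k=C^*y_h^{K-k}$ and $q_h^0=(z_h^+)^K$. *)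

theory Defs
  imports "HOL-Analysis.Analysis"
begin

section \<open>Complex Hilbert spaces\<close>

text \<open>
  The inner product \<open>cinner\<close> is linear in its \<^emph>\<open>first\<close> argument, as the sign of the term
  \<open>\<plusminus>\<i>\<langle>q,\<phi>\<rangle>\<^sub>1\<^sub>/\<^sub>2\<close> in the numerical scheme requires. Its real part is the real inner product
  of the class \<^class>\<open>real_inner\<close>, which supplies positivity, norm and topology.
\<close>

class complex_inner = real_inner +
  fixes scaleC :: "complex \<Rightarrow> 'a \<Rightarrow> 'a" (infixr "*\<^sub>C" 75)
    and cinner :: "'a \<Rightarrow> 'a \<Rightarrow> complex"
  assumes scaleC_add_right: "c *\<^sub>C (x + y) = c *\<^sub>C x + c *\<^sub>C y"
    and scaleC_add_left: "(c + d) *\<^sub>C x = c *\<^sub>C x + d *\<^sub>C x"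
    and scaleC_scaleC: "c *\<^sub>C (d *\<^sub>C x) = (c * d) *\<^sub>C x"
    and scaleC_of_real: "complex_of_real r *\<^sub>C x = r *\<^sub>R x"
    and cinner_commute: "cinner x y = cnj (cinner y x)"
    and cinner_add_left: "cinner (x + y) z = cinner x z + cinner y z"
    and cinner_scaleC_left: "cinner (c *\<^sub>C x) y = c * cinner x y"
    and Re_cinner: "Re (cinner x y) = inner x y"

class complex_hilbert = complex_inner + complete_space

instantiation complex :: complex_hilbert
begin

definition scaleC_complex :: "complex \<Rightarrow> complex \<Rightarrow> complex"
  where "scaleC_complex c x = c * x"

definition cinner_complex :: "complex \<Rightarrow> complex \<Rightarrow> complex"
  where "cinner_complex x y = x * cnj y"

instance
  by standard
    (auto simp: scaleC_complex_def cinner_complex_def algebra_simps inner_complex_def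
      scaleR_conv_of_real)

end

global_interpretation complex_vector: vector_space "scaleC :: complex \<Rightarrow> 'a \<Rightarrow> 'a::complex_inner"
proof
  show "1 *\<^sub>C x = x" for x :: 'a
    using scaleC_of_real[of 1 x] by simp
qed (simp_all add: scaleC_add_right scaleC_add_left scaleC_scaleC)

definition finite_dim_csubspace :: "'a::complex_inner set \<Rightarrow> bool"
  where "finite_dim_csubspace S \<longleftrightarrow>
    complex_vector.subspace S \<and> (\<exists>B. finite B \<and> complex_vector.span B = S)"

definition bounded_clinear :: "('a::complex_inner \<Rightarrow> 'b::complex_inner) \<Rightarrow> bool"
  where "bounded_clinear T \<longleftrightarrow> bounded_linear T \<and> (\<forall>c x. T (c *\<^sub>C x) = c *\<^sub>C T x)"

definition cadj :: "('a::complex_inner \<Rightarrow> 'b::complex_inner) \<Rightarrow> 'b \<Rightarrow> 'a"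
  where "cadj T = (THE S. \<forall>x y. cinner (T x) y = cinner x (S y))"


section \<open>Unbounded operators\<close>

text \<open>
  An unbounded operator is a partial function \<open>A\<close> with domain \<^term>\<open>dom A\<close>. Equality of partial
  functions is equality of operators including their domains, and \<^term>\<open>B \<circ>\<^sub>m B\<close> is the
  square of \<open>B\<close> with its natural domain.
\<close>

definition linear_op :: "('a::complex_inner \<rightharpoonup> 'b::complex_inner) \<Rightarrow> bool"
  where "linear_op A \<longleftrightarrow> complex_vector.subspace (dom A) \<and>
    (\<forall>x\<in>dom A. \<forall>y\<in>dom A. the (A (x + y)) = the (A x) + the (A y)) \<and>
    (\<forall>c. \<forall>x\<in>dom A. the (A (c *\<^sub>C x)) = c *\<^sub>C the (A x))"

definition adj_op :: "('a::complex_inner \<rightharpoonup> 'b::complex_inner) \<Rightarrow> 'b \<rightharpoonup> 'a"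
  where "adj_op A y =
    (if \<exists>w. \<forall>x\<in>dom A. cinner (the (A x)) y = cinner x w
     then Some (THE w. \<forall>x\<in>dom A. cinner (the (A x)) y = cinner x w)
     else None)"

definition selfadjoint_op :: "('a::complex_inner \<rightharpoonup> 'a) \<Rightarrow> bool"
  where "selfadjoint_op A \<longleftrightarrow> linear_op A \<and> closure (dom A) = UNIV \<and> adj_op A = A"

definition positive_op :: "('a::complex_inner \<rightharpoonup> 'a) \<Rightarrow> bool"
  where "positive_op A \<longleftrightarrow> (\<forall>x\<in>dom A. 0 \<le> Re (cinner (the (A x)) x))"

definition strictly_positive_op :: "('a::complex_inner \<rightharpoonup> 'a) \<Rightarrow> bool"
  where "strictly_positive_op A \<longleftrightarrow>
    (\<exists>m>0. \<forall>x\<in>dom A. m * (norm x)\<^sup>2 \<le> Re (cinner (the (A x)) x))"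

text \<open>A positive self-adjoint operator has exactly one positive self-adjoint square root.\<close>

definition sqrt_op :: "('a::complex_inner \<rightharpoonup> 'a) \<Rightarrow> 'a \<rightharpoonup> 'a"
  where "sqrt_op A = (SOME B. selfadjoint_op B \<and> positive_op B \<and> B \<circ>\<^sub>m B = A)"

text \<open>
  For \<open>A = A\<^sub>0\<^sup>\<alpha>\<close> with \<open>A\<^sub>0\<close> strictly positive, \<open>\<D>(A)\<close> carries the norm
  \<open>\<parallel>\<phi>\<parallel>\<^sub>\<alpha> = \<parallel>A\<phi>\<parallel>\<close>, here \<open>dom_norm A \<phi>\<close>.
\<close>

definition dom_norm :: "('a::complex_inner \<rightharpoonup> 'b::complex_inner) \<Rightarrow> 'a \<Rightarrow> real"
  where "dom_norm A x = norm (the (A x))"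

definition bounded_on_dom :: "('a::complex_inner \<rightharpoonup> 'a) \<Rightarrow> ('a \<Rightarrow> 'a) \<Rightarrow> bool"
  where "bounded_on_dom A T \<longleftrightarrow>
    (\<forall>x\<in>dom A. T x \<in> dom A) \<and> (\<exists>c. \<forall>x\<in>dom A. dom_norm A (T x) \<le> c * dom_norm A x)"

definition half_inner :: "('a::complex_inner \<rightharpoonup> 'a) \<Rightarrow> 'a \<Rightarrow> 'a \<Rightarrow> complex"
  where "half_inner A x y = cinner (the (sqrt_op A x)) (the (sqrt_op A y))"


section \<open>Semigroups and observability\<close>

definition C0_semigroup :: "(real \<Rightarrow> 'a::complex_inner \<Rightarrow> 'a) \<Rightarrow> bool"
  where "C0_semigroup T \<longleftrightarrow>
    (\<forall>t\<ge>0. bounded_clinear (T t)) \<and> T 0 = id \<and>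
    (\<forall>s\<ge>0. \<forall>t\<ge>0. T (s + t) = T s \<circ> T t) \<and>
    (\<forall>x. ((\<lambda>t. T t x) \<longlongrightarrow> x) (at_right 0))"

definition generator :: "(real \<Rightarrow> 'a::complex_inner \<Rightarrow> 'a) \<Rightarrow> 'a \<rightharpoonup> 'a"
  where "generator T x =
    (if \<exists>l. ((\<lambda>t. (T t x - x) /\<^sub>R t) \<longlongrightarrow> l) (at_right 0)
     then Some (Lim (at_right 0) (\<lambda>t. (T t x - x) /\<^sub>R t))
     else None)"

text \<open>A semigroup is determined by its generator for times \<open>t \<ge> 0\<close>, the only ones used.\<close>

definition generated_semigroup :: "('a::complex_inner \<rightharpoonup> 'a) \<Rightarrow> real \<Rightarrow> 'a \<Rightarrow> 'a"
  where "generated_semigroup G = (SOME T. C0_semigroup T \<and> generator T = G)"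

text \<open>
  Below, \<open>s\<close> is \<open>\<i>\<close> or \<open>-\<i>\<close> and selects the sign in \<open>sA\<^sub>0 - C\<^sup>*C\<close>, whose domain is
  that of \<open>A\<^sub>0\<close>.
\<close>

definition observer_generator ::
    "('x::complex_inner \<rightharpoonup> 'x) \<Rightarrow> ('x \<Rightarrow> 'y::complex_inner) \<Rightarrow> complex \<Rightarrow> 'x \<rightharpoonup> 'x"
  where "observer_generator A C s x = map_option (\<lambda>w. s *\<^sub>C w - cadj C (C x)) (A x)"

definition observer_semigroup ::
    "('x::complex_inner \<rightharpoonup> 'x) \<Rightarrow> ('x \<Rightarrow> 'y::complex_inner) \<Rightarrow> complex \<Rightarrow> real \<Rightarrow> 'x \<Rightarrow> 'x"
  where "observer_semigroup A C s = generated_semigroup (observer_generator A C s)"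

definition back_and_forth ::
    "('x::complex_inner \<rightharpoonup> 'x) \<Rightarrow> ('x \<Rightarrow> 'y::complex_inner) \<Rightarrow> real \<Rightarrow> 'x \<Rightarrow> 'x"
  where "back_and_forth A C \<tau> = observer_semigroup A C (- \<i>) \<tau> \<circ> observer_semigroup A C \<i> \<tau>"

definition is_solution :: "('x::complex_inner \<rightharpoonup> 'x) \<Rightarrow> 'x \<Rightarrow> (real \<Rightarrow> 'x) \<Rightarrow> bool"
  where "is_solution A z0 z \<longleftrightarrow> z 0 = z0 \<and>
    (\<forall>t\<ge>0. z t \<in> dom A \<and> (z has_vector_derivative \<i> *\<^sub>C the (A (z t))) (at t within {0..}))"

definition exactly_observable ::
    "('x::complex_inner \<rightharpoonup> 'x) \<Rightarrow> ('x \<Rightarrow> 'y::complex_inner) \<Rightarrow> real \<Rightarrow> bool"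
  where "exactly_observable A C \<tau> \<longleftrightarrow>
    (\<exists>k>0. \<forall>z0\<in>dom A. \<forall>z. is_solution A z0 z \<longrightarrow>
      k\<^sup>2 * (norm z0)\<^sup>2 \<le> integral {0..\<tau>} (\<lambda>t. (norm (C (z t)))\<^sup>2))"


section \<open>Galerkin discretization\<close>

text \<open>In this section \<open>V\<close> stands for the finite-dimensional space \<open>X\<^sub>h\<close>.\<close>

definition galerkin_proj :: "('x::complex_inner \<rightharpoonup> 'x) \<Rightarrow> 'x set \<Rightarrow> 'x \<Rightarrow> 'x"
  where "galerkin_proj A V \<phi> = (THE p. p \<in> V \<and> (\<forall>\<psi>\<in>V. half_inner A (\<phi> - p) \<psi> = 0))"

definition approximation_property ::
    "('x::complex_inner \<rightharpoonup> 'x) \<Rightarrow> (real \<Rightarrow> 'x set) \<Rightarrow> real \<Rightarrow> bool"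
  where "approximation_property A Xh \<theta> \<longleftrightarrow>
    (\<exists>M>0. \<exists>hs>0. \<forall>\<phi>\<in>dom (sqrt_op A). \<forall>h\<in>{0<..<hs}.
      norm (galerkin_proj A (Xh h) \<phi> - \<phi>) \<le> M * h powr \<theta> * dom_norm (sqrt_op A) \<phi>)"

definition scheme_solution ::
    "('x::complex_inner \<rightharpoonup> 'x) \<Rightarrow> ('x \<Rightarrow> 'y::complex_inner) \<Rightarrow> 'x set \<Rightarrow> complex \<Rightarrow> real \<Rightarrow>
     'x \<Rightarrow> (nat \<Rightarrow> 'x) \<Rightarrow> nat \<Rightarrow> (nat \<Rightarrow> 'x) \<Rightarrow> bool"
  where "scheme_solution A C V s dt q0 F K q \<longleftrightarrow> q 0 = q0 \<and> (\<forall>k\<le>K. q k \<in> V) \<and>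
    (\<forall>k\<in>{1..K}. \<forall>\<phi>\<in>V.
      cinner ((q k - q (k - 1)) /\<^sub>R dt) \<phi> =
        s * half_inner A (q k) \<phi> - cinner (cadj C (C (q k))) \<phi> + cinner (F k) \<phi>)"

text \<open>
  The value at index \<open>k\<close> depends on the data up to \<open>k\<close> only, so the scheme need only be run
  for \<open>k\<close> steps.
\<close>

definition scheme_value ::
    "('x::complex_inner \<rightharpoonup> 'x) \<Rightarrow> ('x \<Rightarrow> 'y::complex_inner) \<Rightarrow> 'x set \<Rightarrow> complex \<Rightarrow> real \<Rightarrow>
     'x \<Rightarrow> (nat \<Rightarrow> 'x) \<Rightarrow> nat \<Rightarrow> 'x"
  where "scheme_value A C V s dt q0 F k =
    (THE p. \<exists>q. scheme_solution A C V s dt q0 F k q \<and> p = q k)"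

definition discrete_semigroup ::
    "('x::complex_inner \<rightharpoonup> 'x) \<Rightarrow> ('x \<Rightarrow> 'y::complex_inner) \<Rightarrow> 'x set \<Rightarrow> complex \<Rightarrow> real \<Rightarrow>
     nat \<Rightarrow> 'x \<Rightarrow> 'x"
  where "discrete_semigroup A C V s dt k q0 =
    scheme_value A C V s dt (galerkin_proj A V q0) (\<lambda>_. 0) k"

definition discrete_back_and_forth ::
    "('x::complex_inner \<rightharpoonup> 'x) \<Rightarrow> ('x \<Rightarrow> 'y::complex_inner) \<Rightarrow> 'x set \<Rightarrow> real \<Rightarrow> nat \<Rightarrow> 'x \<Rightarrow> 'x"
  where "discrete_back_and_forth A C V dt K =
    discrete_semigroup A C V (- \<i>) dt K \<circ> discrete_semigroup A C V \<i> dt K"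

definition forward_observer ::
    "('x::complex_inner \<rightharpoonup> 'x) \<Rightarrow> ('x \<Rightarrow> 'y::complex_inner) \<Rightarrow> 'x set \<Rightarrow> real \<Rightarrow> (nat \<Rightarrow> 'y) \<Rightarrow>
     nat \<Rightarrow> 'x"
  where "forward_observer A C V dt yh k = scheme_value A C V \<i> dt 0 (\<lambda>j. cadj C (yh j)) k"

definition backward_observer ::
    "('x::complex_inner \<rightharpoonup> 'x) \<Rightarrow> ('x \<Rightarrow> 'y::complex_inner) \<Rightarrow> 'x set \<Rightarrow> real \<Rightarrow> nat \<Rightarrow>
     (nat \<Rightarrow> 'y) \<Rightarrow> nat \<Rightarrow> 'x"
  where "backward_observer A C V dt K yh k =
    scheme_value A C V (- \<i>) dt (forward_observer A C V dt yh K)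
      (\<lambda>j. cadj C (yh (K - j))) (K - k)"

definition reconstruction ::
    "('x::complex_inner \<rightharpoonup> 'x) \<Rightarrow> ('x \<Rightarrow> 'y::complex_inner) \<Rightarrow> 'x set \<Rightarrow> real \<Rightarrow> nat \<Rightarrow>
     (nat \<Rightarrow> 'y) \<Rightarrow> real \<Rightarrow> 'x"
  where "reconstruction A C V dt K yh N =
    (\<Sum>n | real n \<le> N. (discrete_back_and_forth A C V dt K ^^ n) (backward_observer A C V dt K yh 0))"

end

theory Submission
  imports Defs
begin

text \<open>
  Write \<open>B = C\<^sup>*C\<close>, \<open>L = \<T>\<^sup>-\<^sub>\<tau> \<T>\<^sup>+\<^sub>\<tau>\<close>, \<open>\<delta> = h\<^sup>\<theta> + \<Delta>t\<close>, and \<open>L\<^sub>h\<close>, \<open>\<pi>\<^sub>h\<close> for the discrete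
  back-and-forth operator and the Galerkin projection.

  For the continuous observers started from \<open>0\<close>, the differences \<open>z - z\<^sup>+\<close> and \<open>z\<^sup>- - z\<close> solve the
  damped equations without source, so that \<open>z\<^sup>-(0) = z\<^sub>0 - L z\<^sub>0\<close>. The sum of \<open>L\<^sup>n z\<^sup>-(0)\<close> over \<open>n < p\<close>
  telescopes to \<open>z\<^sub>0 - L\<^sup>p z\<^sub>0\<close>, and the remainder is at most \<open>\<eta>\<^sup>p \<parallel>z\<^sub>0\<parallel>\<close>, where the number \<open>p\<close> of
  terms is chosen such that \<open>\<eta>\<^sup>p \<le> \<delta>\<close>. What is left is the sum over \<open>n < p\<close> of the differences of
  \<open>w\<^sub>n = L\<^sup>n z\<^sup>-(0)\<close> and \<open>v\<^sub>n = L\<^sub>h\<^sup>n (z\<^sub>h\<^sup>-)\<^sup>0\<close>. The projection \<open>\<pi>\<^sub>h\<close> is not bounded uniformly in \<open>h\<close> for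
  the norm of \<open>X\<close>, so one compares \<open>\<pi>\<^sub>h w\<^sub>n\<close> with \<open>v\<^sub>n\<close>: both lie in \<open>X\<^sub>h\<close>, where the scheme is
  stable in the norm of \<open>X\<close>. Every sweep therefore only adds its own consistency error,
  \<open>\<parallel>\<pi>\<^sub>h w\<^sub>n\<^sub>+\<^sub>1 - v\<^sub>n\<^sub>+\<^sub>1\<parallel> \<le> \<parallel>\<pi>\<^sub>h w\<^sub>n - v\<^sub>n\<parallel> + c \<delta> \<parallel>w\<^sub>n\<parallel>\<^sub>2\<close> (\<open>back_and_forth_error\<close>), while the first term
  carries the error of the observers (\<open>observer_error\<close>), which contains the data errors. Up to \<open>p\<close>
  accumulated errors in each of \<open>p\<close> terms, with \<open>p\<close> of order \<open>\<bar>ln \<delta>\<bar>\<close>, give the factor \<open>ln\<^sup>2 \<delta>\<close>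
  (\<open>reconstruction_error\<close>).

  This needs a bound of \<open>\<parallel>L\<^sup>n x\<parallel>\<^sub>2\<close> by \<open>\<parallel>x\<parallel>\<^sub>2\<close> that is uniform in \<open>n\<close>. Each of \<open>\<T>\<^sup>+\<close> and \<open>\<T>\<^sup>-\<close> is
  contractive for the graph norm of its own generator only, and estimating one factor after the
  other would cost a constant to the power \<open>n\<close>. The way out is a commutator identity: \<open>\<T>\<^sup>\<plusminus>\<close>
  commutes with its generator \<open>G = sA\<^sub>0 - B\<close>, so that \<open>A\<^sub>0 \<T>\<^sup>\<plusminus> - \<T>\<^sup>\<plusminus> A\<^sub>0 = s\<^sup>-\<^sup>1 (B \<T>\<^sup>\<plusminus> - \<T>\<^sup>\<plusminus> B)\<close>
  is a bounded operator, on \<open>X\<close> and on \<open>\<D>(A\<^sub>0)\<close>. Hence \<open>A\<^sub>0 L = L A\<^sub>0 + K\<close> with such a \<open>K\<close>, and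
  \<open>\<eta> < 1\<close> absorbs the perturbation in \<open>\<D>(A\<^sub>0)\<close> and then in \<open>\<D>(A\<^sub>0\<^sup>2)\<close> (\<open>powers_bounded_dom2\<close>).

  The consistency error is computed on \<open>\<pi>\<^sub>h q(t\<^sub>k)\<close> for a smooth trajectory \<open>q\<close>. Since \<open>\<pi>\<^sub>h\<close> is
  orthogonal for the inner product of \<open>\<D>(A\<^sub>0\<^sup>1\<^sup>/\<^sup>2)\<close>, the unbounded term of the scheme produces no
  error; what remains is
  \<open>(\<pi>\<^sub>h - I) D\<^sub>t q + (D\<^sub>t q - q') + B (\<pi>\<^sub>h - I) q\<close>, which is of order \<open>\<delta>\<close> when \<open>q'\<close> and \<open>A\<^sub>0 q\<close> are
  Lipschitz, thus for data in \<open>\<D>(A\<^sub>0\<^sup>2)\<close>.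

  The square root of \<open>A\<^sub>0\<close> and the semigroups are given by descriptions, so their existence has to
  be established first: \<open>sqrt_op\<close> by the binomial series of a contraction, \<open>generation\<close> by the
  implicit Euler scheme with dyadic steps. That \<open>\<eta> < 1\<close> follows from exact observability by
  comparing the damped with the undamped trajectory (\<open>damped_energy_decay\<close>).
\<close>

section \<open>Complex Hilbert spaces and unbounded operators\<close>

instance complex_hilbert \<subseteq> banach ..

lemma cinner_add_right: "cinner x (y + z) = cinner x y + cinner x z"
  for x :: "'a::complex_inner"
  using cinner_commute[of x "y + z"] cinner_commute[of x y] cinner_commute[of x z]
  by (simp add: cinner_add_left)

lemma cinner_scaleC_right: "cinner x (c *\<^sub>C y) = cnj c * cinner x y"
  for x :: "'a::complex_inner"
  using cinner_commute[of x "c *\<^sub>C y"] cinner_commute[of x y]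
  by (simp add: cinner_scaleC_left)

lemma cinner_minus_left: "cinner (- x) y = - cinner x y" for x :: "'a::complex_inner"
  using cinner_scaleC_left[of "- 1" x y] by simp

lemma cinner_minus_right: "cinner x (- y) = - cinner x y" for x :: "'a::complex_inner"
  using cinner_scaleC_right[of x "- 1" y] by simp

lemma cinner_zero_left [simp]: "cinner 0 y = 0" for y :: "'a::complex_inner"
  using cinner_scaleC_left[of 0 y y] by simp

lemma cinner_zero_right [simp]: "cinner y 0 = 0" for y :: "'a::complex_inner"
  using cinner_scaleC_right[of y 0 y] by simp

lemma cinner_diff_left: "cinner (x - y) z = cinner x z - cinner y z" for x :: "'a::complex_inner"
  using cinner_add_left[of x "- y" z] by (simp add: cinner_minus_left)

lemma cinner_diff_right: "cinner z (x - y) = cinner z x - cinner z y" for x :: "'a::complex_inner"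
  using cinner_add_right[of z x "- y"] by (simp add: cinner_minus_right)

lemma cinner_scaleR_left: "cinner (r *\<^sub>R x) y = of_real r * cinner x y"
  for x :: "'a::complex_inner"
  by (metis cinner_scaleC_left scaleC_of_real)

lemma cinner_scaleR_right: "cinner x (r *\<^sub>R y) = of_real r * cinner x y"
  for x :: "'a::complex_inner"
  by (metis cinner_scaleC_right scaleC_of_real complex_cnj_complex_of_real)

lemma cinner_self: "cinner x x = of_real ((norm x)\<^sup>2)" for x :: "'a::complex_inner"
proof (rule complex_eqI)
  show "Re (cinner x x) = Re (of_real ((norm x)\<^sup>2))"
    by (simp add: Re_cinner power2_norm_eq_inner)
  show "Im (cinner x x) = Im (of_real ((norm x)\<^sup>2))"
    using arg_cong[OF cinner_commute[of x x], of Im] by simp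
qed

lemma Im_cinner: "Im (cinner x y) = inner x (\<i> *\<^sub>C y)" for x :: "'a::complex_inner"
  by (simp add: Re_cinner[symmetric] cinner_scaleC_right)

lemma cinner_eq_iff_inner:
  fixes x y :: "'a::complex_inner" and u v :: "'b::complex_inner"
  shows "cinner x y = cinner u v \<longleftrightarrow>
    inner x y = inner u v \<and> inner x (\<i> *\<^sub>C y) = inner u (\<i> *\<^sub>C v)"
  by (simp add: complex_eq_iff Re_cinner Im_cinner)

lemma norm_scaleC [simp]: "norm (c *\<^sub>C x) = cmod c * norm x" for x :: "'a::complex_inner"
proof -
  have "of_real ((norm (c *\<^sub>C x))\<^sup>2) = complex_of_real ((cmod c * norm x)\<^sup>2)"
    using cinner_self[of "c *\<^sub>C x"] cinner_self[of x] complex_norm_square[of c]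
    by (simp add: cinner_scaleC_left cinner_scaleC_right power_mult_distrib ac_simps)
  hence "(norm (c *\<^sub>C x))\<^sup>2 = (cmod c * norm x)\<^sup>2"
    using of_real_eq_iff by blast
  thus ?thesis by (simp add: power2_eq_iff_nonneg)
qed

lemma bounded_linear_scaleC: "bounded_linear (\<lambda>x::'a::complex_inner. c *\<^sub>C x)"
proof (rule bounded_linear_intro[where K = "cmod c"])
  show "c *\<^sub>C (r *\<^sub>R x) = r *\<^sub>R (c *\<^sub>C x)" for r and x :: 'a
    by (simp add: scaleC_of_real[symmetric] scaleC_scaleC mult.commute)
qed (simp_all add: scaleC_add_right mult.commute)

lemma scaleC_scaleR: "c *\<^sub>C (r *\<^sub>R x) = r *\<^sub>R (c *\<^sub>C x)" for x :: "'a::complex_inner"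
  by (rule linear_scale[OF bounded_linear.linear[OF bounded_linear_scaleC]])

lemma cinner_ext:
  fixes x y :: "'a::complex_inner"
  assumes "\<And>u. cinner u x = cinner u y"
  shows "x = y"
proof -
  have "cinner (x - y) (x - y) = 0"
    using assms[of "x - y"] by (simp add: cinner_diff_right)
  thus ?thesis by (simp add: cinner_self)
qed

lemma csubspace_subspace: "complex_vector.subspace S \<Longrightarrow> subspace S"
  for S :: "'a::complex_inner set"
  unfolding subspace_def complex_vector.subspace_def by (metis scaleC_of_real)

text \<open>
  A minimizing sequence for the distance to \<open>x\<close> is Cauchy by the parallelogram identity, and its
  limit is the foot of the perpendicular.
\<close>

theorem orthogonal_decomposition:
  fixes M :: "'a::{real_inner,complete_space} set"
  assumes "closed M" "subspace M"
  obtains p where "p \<in> M" "\<And>m. m \<in> M \<Longrightarrow> inner (x - p) m = 0"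
proof -
  define g where "g m = (norm (x - m))\<^sup>2" for m
  define d where "d = Inf (g ` M)"
  have ne: "g ` M \<noteq> {}" using subspace_0[OF assms(2)] by blast
  have bb: "bdd_below (g ` M)" by (rule bdd_belowI[of _ 0]) (auto simp: g_def)
  have dle: "d \<le> g m" if "m \<in> M" for m
    unfolding d_def using that bb by (intro cInf_lower) auto
  have "\<exists>m\<in>M. g m < d + 1 / real (Suc n)" for n
  proof -
    have "Inf (g ` M) < d + 1 / real (Suc n)" unfolding d_def by simp
    from cInf_lessD[OF ne this] show ?thesis by blast
  qed
  then obtain m where mM: "\<And>n. m n \<in> M" and mg: "\<And>n. g (m n) < d + 1 / real (Suc n)"
    by metis
  have par: "(norm (u - v))\<^sup>2 \<le> 2 * (g u - d) + 2 * (g v - d)" if "u \<in> M" "v \<in> M" for u v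
  proof -
    define c where "c = (1/2) *\<^sub>R (u + v)"
    have "c \<in> M"
      unfolding c_def using that assms(2) by (intro subspace_scale subspace_add)
    hence "d \<le> g c" by (rule dle)
    moreover have "(norm (u - v))\<^sup>2 = 2 * g u + 2 * g v - 4 * g c"
      unfolding g_def c_def power2_norm_eq_inner
      by (simp add: inner_diff_left inner_diff_right inner_add_left inner_add_right
          inner_commute algebra_simps)
    ultimately show ?thesis by (simp add: right_diff_distrib)
  qed
  have "Cauchy m"
  proof (rule metric_CauchyI)
    fix e :: real assume "e > 0"
    then obtain N where N: "1 / real (Suc N) < e\<^sup>2 / 4"
      using nat_approx_posE[of "e\<^sup>2 / 4"] by (auto simp: zero_less_power)
    have "dist (m i) (m j) < e" if "i \<ge> N" "j \<ge> N" for i j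
    proof -
      have *: "1 / real (Suc k) \<le> 1 / real (Suc N)" if "k \<ge> N" for k
        using that by (intro divide_left_mono) auto
      have "(norm (m i - m j))\<^sup>2 \<le> 2 * (g (m i) - d) + 2 * (g (m j) - d)"
        by (rule par[OF mM mM])
      also have "\<dots> < e\<^sup>2"
        using mg[of i] mg[of j] *[OF that(1)] *[OF that(2)] N by argo
      finally have "norm (m i - m j) < e"
        using \<open>e > 0\<close> power2_less_imp_less[of "norm (m i - m j)" e] by auto
      thus ?thesis by (simp add: dist_norm)
    qed
    thus "\<exists>N. \<forall>i\<ge>N. \<forall>j\<ge>N. dist (m i) (m j) < e" by blast
  qed
  then obtain p where p: "m \<longlonglongrightarrow> p" using Cauchy_convergent convergent_def by blast
  have pM: "p \<in> M" using closed_sequentially[OF assms(1)] mM p by blast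
  have "(\<lambda>n. g (m n)) \<longlonglongrightarrow> g p" unfolding g_def by (intro tendsto_intros p)
  moreover have "(\<lambda>n. d + 1 / real (Suc n)) \<longlonglongrightarrow> d + 0"
    by (intro tendsto_intros LIMSEQ_Suc[OF lim_1_over_n])
  ultimately have "g p \<le> d" using LIMSEQ_le[of "\<lambda>n. g (m n)" "g p" "\<lambda>n. d + 1 / real (Suc n)" "d + 0"]
      mg by (auto intro: less_imp_le)
  have "inner (x - p) v = 0" if v: "v \<in> M" for v
  proof (cases "v = 0")
    case False
    \<comment> \<open>the minimizer of the distance from x to p + t v over real t\<close>
    define t where "t = inner (x - p) v / inner v v"
    have "g p \<le> g (p + t *\<^sub>R v)"
      using \<open>g p \<le> d\<close> dle[of "p + t *\<^sub>R v"] v pM assms(2)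
      by (auto simp: subspace_add subspace_scale)
    also have "g (p + t *\<^sub>R v) = g p - 2 * t * inner (x - p) v + t * t * inner v v"
      unfolding g_def power2_norm_eq_inner
      by (simp add: inner_diff_left inner_diff_right inner_add_left inner_add_right
          inner_commute algebra_simps)
    also have "\<dots> = g p - (inner (x - p) v)\<^sup>2 / inner v v"
      using False by (simp add: t_def power2_eq_square field_simps)
    finally have "(inner (x - p) v)\<^sup>2 / inner v v \<le> 0" by simp
    moreover have "inner v v > 0" using False by simp
    ultimately show ?thesis
      by (metis divide_pos_pos not_le zero_less_power2)
  qed simp
  with pM that show thesis by blast
qed

text \<open>
  A nonzero functional is determined up to a factor by its kernel, and a vector orthogonal to the
  kernel represents it.
\<close>

theorem Riesz_representation:
  fixes f :: "'a::{real_inner,complete_space} \<Rightarrow> real"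
  assumes "bounded_linear f"
  obtains u where "\<And>x. f x = inner x u"
proof (cases "\<forall>x. f x = 0")
  case True
  with that[of 0] show thesis by simp
next
  case False
  then obtain x0 where x0: "f x0 \<noteq> 0" by blast
  interpret f: bounded_linear f by fact
  have "closed {x. f x = 0}"
    by (intro closed_Collect_eq continuous_intros f.continuous_on)
  moreover have "subspace {x. f x = 0}"
    by (simp add: subspace_def f.add f.scaleR)
  ultimately obtain p where p: "f p = 0" "\<And>m. f m = 0 \<Longrightarrow> inner (x0 - p) m = 0"
    using orthogonal_decomposition[of "{x. f x = 0}" x0] by auto
  define w where "w = x0 - p"
  have fw: "f w \<noteq> 0" using x0 p by (simp add: w_def f.diff)
  hence w0: "w \<noteq> 0" by auto
  have "f x = inner x ((f w / inner w w) *\<^sub>R w)" for x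
  proof -
    have "inner w (x - (f x / f w) *\<^sub>R w) = 0"
      unfolding w_def by (rule p(2)[unfolded]) (use fw in \<open>simp add: f.diff f.scaleR w_def\<close>)
    thus ?thesis using fw w0 by (simp add: inner_diff_right inner_commute field_simps)
  qed
  with that show thesis by blast
qed

lemma bounded_clinearD:
  assumes "bounded_clinear T"
  shows "bounded_linear T" "T (c *\<^sub>C x) = c *\<^sub>C T x"
  using assms by (auto simp: bounded_clinear_def)

text \<open>
  Riesz' theorem gives the adjoint for the real inner product; complex linearity of \<open>T\<close> transfers
  the identity to the imaginary part.
\<close>

lemma cadj:
  fixes T :: "'a::complex_hilbert \<Rightarrow> 'b::complex_inner"
  assumes "bounded_clinear T"
  shows "cinner (T x) y = cinner x (cadj T y)"
proof -
  interpret T: bounded_linear T using assms by (rule bounded_clinearD)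
  have "\<exists>u. \<forall>x. inner (T x) y = inner x u" for y
  proof -
    have "bounded_linear (\<lambda>x. inner (T x) y)"
      by (rule bounded_linear_compose[OF bounded_linear_inner_left T.bounded_linear_axioms])
    from Riesz_representation[OF this] show ?thesis by metis
  qed
  then obtain S where S: "\<And>x y. inner (T x) y = inner x (S y)" by metis
  have "cinner (T x) y = cinner x (S y)" for x y
  proof -
    have im: "inner v (\<i> *\<^sub>C w) = - inner (\<i> *\<^sub>C v) w" for v w :: "'c::complex_inner"
      by (simp add: Re_cinner[symmetric] cinner_scaleC_left cinner_scaleC_right)
    show ?thesis
      unfolding cinner_eq_iff_inner im using S
      by (metis assms bounded_clinearD(2))
  qed
  hence ex: "\<forall>x y. cinner (T x) y = cinner x (S y)" by blast
  have "\<forall>x y. cinner (T x) y = cinner x (cadj T y)"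
    unfolding cadj_def
  proof (rule theI[of _ S])
    fix S' assume "\<forall>x y. cinner (T x) y = cinner x (S' y)"
    thus "S' = S" using ex by (metis cinner_ext ext)
  qed (rule ex)
  thus ?thesis by blast
qed

text \<open>
  The bound is that of \<open>T\<close>, since \<open>\<parallel>T\<^sup>*y\<parallel>\<^sup>2 = \<langle>T T\<^sup>*y, y\<rangle>\<close>.
\<close>

lemma bounded_clinear_cadj:
  fixes T :: "'a::complex_hilbert \<Rightarrow> 'b::complex_inner"
  assumes "bounded_clinear T"
  shows "bounded_clinear (cadj T)"
proof -
  note T = cadj[OF assms]
  interpret T: bounded_linear T using assms by (rule bounded_clinearD)
  obtain K where K: "\<And>x. norm (T x) \<le> norm x * K" "K \<ge> 0" using T.nonneg_bounded by blast
  have add: "cadj T (y + z) = cadj T y + cadj T z" for y z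
    by (rule cinner_ext) (simp add: T[symmetric] cinner_add_right)
  have scale: "cadj T (c *\<^sub>C y) = c *\<^sub>C cadj T y" for c y
    by (rule cinner_ext) (simp add: T[symmetric] cinner_scaleC_right)
  have "norm (cadj T y) \<le> norm y * K" for y
  proof -
    have "(norm (cadj T y))\<^sup>2 = inner (T (cadj T y)) y"
      using T[of "cadj T y" y] by (metis Re_cinner power2_norm_eq_inner)
    also have "\<dots> \<le> norm (T (cadj T y)) * norm y" by (rule norm_cauchy_schwarz)
    also have "\<dots> \<le> norm (cadj T y) * (norm y * K)"
      using mult_right_mono[OF K(1), of "norm y" "cadj T y"] by (simp add: ac_simps)
    finally show ?thesis
      by (cases "cadj T y = 0") (use K(2) in \<open>auto simp: power2_eq_square\<close>)
  qed
  hence "bounded_linear (cadj T)"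
    using add scale by (intro bounded_linear_intro[where K = K]) (auto simp: scaleC_of_real[symmetric])
  thus ?thesis using scale by (simp add: bounded_clinear_def)
qed

lemma linear_opD:
  assumes "linear_op A"
  shows "complex_vector.subspace (dom A)"
    "x \<in> dom A \<Longrightarrow> y \<in> dom A \<Longrightarrow> the (A (x + y)) = the (A x) + the (A y)"
    "x \<in> dom A \<Longrightarrow> the (A (c *\<^sub>C x)) = c *\<^sub>C the (A x)"
    "x \<in> dom A \<Longrightarrow> y \<in> dom A \<Longrightarrow> the (A (x - y)) = the (A x) - the (A y)"
    "x \<in> dom A \<Longrightarrow> the (A (r *\<^sub>R x)) = r *\<^sub>R the (A x)"
    "x \<in> dom A \<Longrightarrow> the (A (- x)) = - the (A x)"
proof -
  have sub: "complex_vector.subspace (dom A)" using assms by (simp add: linear_op_def)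
  thus "complex_vector.subspace (dom A)" .
  have add: "\<And>x y. x \<in> dom A \<Longrightarrow> y \<in> dom A \<Longrightarrow> the (A (x + y)) = the (A x) + the (A y)"
    and sc: "\<And>c x. x \<in> dom A \<Longrightarrow> the (A (c *\<^sub>C x)) = c *\<^sub>C the (A x)"
    using assms by (auto simp: linear_op_def)
  have minus: "the (A (- x)) = - the (A x)" "- x \<in> dom A" if "x \<in> dom A" for x
    using sc[OF that, of "- 1"] complex_vector.subspace_neg[OF sub that]
    by simp_all
  show "x \<in> dom A \<Longrightarrow> y \<in> dom A \<Longrightarrow> the (A (x + y)) = the (A x) + the (A y)" by (rule add)
  show "x \<in> dom A \<Longrightarrow> the (A (c *\<^sub>C x)) = c *\<^sub>C the (A x)" by (rule sc)
  show "x \<in> dom A \<Longrightarrow> the (A (- x)) = - the (A x)" by (rule minus)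
  show "x \<in> dom A \<Longrightarrow> the (A (r *\<^sub>R x)) = r *\<^sub>R the (A x)"
    using sc[of x "of_real r"] by (simp add: scaleC_of_real)
  show "x \<in> dom A \<Longrightarrow> y \<in> dom A \<Longrightarrow> the (A (x - y)) = the (A x) - the (A y)"
    using add[of x "- y"] minus[of y] by simp
qed

text \<open>
  This makes the adjoint of a densely defined operator single-valued.
\<close>

lemma cinner_ext_dense:
  fixes x y :: "'a::complex_inner"
  assumes "closure S = UNIV" "\<And>u. u \<in> S \<Longrightarrow> cinner u x = cinner u y"
  shows "x = y"
proof -
  have "closed {u. inner u (x - y) = 0}"
    by (intro closed_Collect_eq continuous_intros)
  moreover have "S \<subseteq> {u. inner u (x - y) = 0}"
    using assms(2) by (auto simp: Re_cinner[symmetric] cinner_diff_right)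
  ultimately have "x - y \<in> {u. inner u (x - y) = 0}"
    using assms(1) closure_minimal by blast
  thus ?thesis by simp
qed

lemma adj_op_eq_Some_iff:
  assumes "closure (dom A) = UNIV"
  shows "adj_op A y = Some w \<longleftrightarrow> (\<forall>x\<in>dom A. cinner (the (A x)) y = cinner x w)"
proof -
  have uniq: "w' = w" if "\<forall>x\<in>dom A. cinner (the (A x)) y = cinner x w"
    "\<forall>x\<in>dom A. cinner (the (A x)) y = cinner x w'" for w w'
    using that by (intro cinner_ext_dense[OF assms]) auto
  show ?thesis
  proof
    assume "adj_op A y = Some w"
    then have ex: "\<exists>w. \<forall>x\<in>dom A. cinner (the (A x)) y = cinner x w"
      and w: "w = (THE w. \<forall>x\<in>dom A. cinner (the (A x)) y = cinner x w)"
      by (auto simp: adj_op_def split: if_splits)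
    show "\<forall>x\<in>dom A. cinner (the (A x)) y = cinner x w"
      unfolding w by (rule theI') (use ex uniq in blast)
  next
    assume w: "\<forall>x\<in>dom A. cinner (the (A x)) y = cinner x w"
    hence "(THE w. \<forall>x\<in>dom A. cinner (the (A x)) y = cinner x w) = w"
      by (rule the_equality) (use uniq w in blast)
    with w show "adj_op A y = Some w" by (auto simp: adj_op_def)
  qed
qed

text \<open>
  The last equivalence is self-adjointness in the form in which it is applied: to show that
  \<open>y\<close> belongs to the domain it suffices to exhibit the value \<open>w\<close> weakly.
\<close>

lemma selfadjoint_opD:
  assumes "selfadjoint_op A"
  shows "linear_op A" "closure (dom A) = UNIV"
    "A y = Some w \<longleftrightarrow> (\<forall>x\<in>dom A. cinner (the (A x)) y = cinner x w)"
  using assms adj_op_eq_Some_iff[of A y w] by (auto simp: selfadjoint_op_def)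

lemma selfadjoint_op_symmetric:
  assumes "selfadjoint_op A" "x \<in> dom A" "y \<in> dom A"
  shows "cinner (the (A x)) y = cinner x (the (A y))"
  using selfadjoint_opD(3)[OF assms(1), of y "the (A y)"] assms(2,3) by auto

section \<open>Coercive operators and coercive forms\<close>

text \<open>
  Coercivity of \<open>cA + B\<close> makes its range closed, because \<open>A\<close> is closed. Its adjoint is the operator
  with \<open>c\<close> conjugated; coercivity of that one leaves only \<open>0\<close> in the orthogonal complement of
  the range. With \<open>c = 1\<close> and \<open>B = 0\<close> this inverts \<open>A\<close>, and with
  \<open>c = -\<mu>s\<close> it provides the resolvents of the generators of the damped semigroups.
\<close>

theorem coercive_range:
  fixes A :: "'x::complex_hilbert \<rightharpoonup> 'x"
  assumes A: "selfadjoint_op A" and B: "bounded_clinear B"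
    and sym: "\<And>x y. cinner (B x) y = cinner x (B y)"
    and c: "c \<noteq> 0" and l: "l > 0"
    and coer: "\<And>x. x \<in> dom A \<Longrightarrow> l * (norm x)\<^sup>2 \<le> inner (c *\<^sub>C the (A x) + B x) x"
    and coer': "\<And>x. x \<in> dom A \<Longrightarrow> l * (norm x)\<^sup>2 \<le> inner (cnj c *\<^sub>C the (A x) + B x) x"
  shows "\<exists>x\<in>dom A. c *\<^sub>C the (A x) + B x = y"
proof -
  note lin = linear_opD[OF selfadjoint_opD(1)[OF A]]
  interpret B: bounded_linear B using B by (rule bounded_clinearD)
  note sub = complex_vector.subspace_add[OF lin(1)] complex_vector.subspace_diff[OF lin(1)]
    complex_vector.subspace_scale[OF lin(1)] complex_vector.subspace_0[OF lin(1)]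
  define H where "H x = c *\<^sub>C the (A x) + B x" for x
  have Hadd: "H (x + y) = H x + H y" and Hdiff: "H (x - y) = H x - H y"
    if "x \<in> dom A" "y \<in> dom A" for x y
    using that by (simp_all add: H_def lin B.add B.diff scaleC_add_right
        complex_vector.scale_right_diff_distrib)
  have Hsc: "H (d *\<^sub>C x) = d *\<^sub>C H x" if "x \<in> dom A" for x d
    using that by (simp add: H_def lin bounded_clinearD(2)[OF B] scaleC_add_right scaleC_scaleC mult.commute)
  have H0: "H 0 = 0" using Hdiff[of 0 0] sub by simp
  have csub: "complex_vector.subspace (H ` dom A)"
    unfolding complex_vector.subspace_def
  proof (intro conjI allI ballI)
    show "0 \<in> H ` dom A" using H0 sub(4) by (auto intro!: image_eqI[of _ _ 0])
  next
    fix u v assume "u \<in> H ` dom A" "v \<in> H ` dom A"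
    then obtain x y where "x \<in> dom A" "y \<in> dom A" "u = H x" "v = H y" by blast
    thus "u + v \<in> H ` dom A" using Hadd sub(1) by (metis imageI)
  next
    fix d u assume "u \<in> H ` dom A"
    then obtain x where "x \<in> dom A" "u = H x" by blast
    thus "d *\<^sub>C u \<in> H ` dom A" using Hsc sub(3) by (metis imageI)
  qed
  have lower: "l * norm x \<le> norm (H x)" if "x \<in> dom A" for x
  proof -
    have "l * (norm x)\<^sup>2 \<le> norm (H x) * norm x"
      using coer[OF that] norm_cauchy_schwarz[of "H x" x] by (simp add: H_def)
    thus ?thesis by (cases "x = 0") (auto simp: power2_eq_square H0)
  qed
  have "closed (H ` dom A)"
  proof (unfold closed_sequential_limits, intro allI impI, elim conjE)
    fix f y assume f: "\<forall>n. f n \<in> H ` dom A" and lim: "f \<longlonglongrightarrow> y"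
    hence "\<forall>n. \<exists>x. x \<in> dom A \<and> f n = H x" by blast
    from choice[OF this] obtain u where u: "\<And>n. u n \<in> dom A" "\<And>n. f n = H (u n)" by blast
    have "Cauchy u"
    proof (rule metric_CauchyI)
      fix e :: real assume "e > 0"
      hence "l * e > 0" using l by simp
      from metric_CauchyD[OF LIMSEQ_imp_Cauchy[OF lim] this] obtain N where
        N: "\<And>i j. i \<ge> N \<Longrightarrow> j \<ge> N \<Longrightarrow> dist (f i) (f j) < l * e"
        by blast
      have "dist (u i) (u j) < e" if "i \<ge> N" "j \<ge> N" for i j
      proof -
        have "l * norm (u i - u j) \<le> norm (H (u i - u j))"
          using u sub by (intro lower) auto
        also have "\<dots> < l * e" using N[OF that] u by (simp add: Hdiff dist_norm)
        finally show ?thesis using l by (simp add: dist_norm)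
      qed
      thus "\<exists>N. \<forall>i\<ge>N. \<forall>j\<ge>N. dist (u i) (u j) < e" by blast
    qed
    then obtain v where v: "u \<longlonglongrightarrow> v" using Cauchy_convergent convergent_def by blast
    define w where "w = inverse c *\<^sub>C (y - B v)"
    have "(\<lambda>n. inverse c *\<^sub>C (f n - B (u n))) \<longlonglongrightarrow> w"
      unfolding w_def
      by (intro bounded_linear.tendsto[OF bounded_linear_scaleC] tendsto_intros lim B.tendsto v)
    moreover have "inverse c *\<^sub>C (f n - B (u n)) = the (A (u n))" for n
      using c by (simp add: u H_def scaleC_scaleC)
    ultimately have Aw: "(\<lambda>n. the (A (u n))) \<longlonglongrightarrow> w" by simp
    \<comment> \<open>closedness of A, deduced from the weak characterization of its graph\<close>
    have "A v = Some w"
      unfolding selfadjoint_opD(3)[OF A]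
    proof
      fix x assume x: "x \<in> dom A"
      have *: "cinner (the (A x)) (u n) = cinner x (the (A (u n)))" for n
        by (rule selfadjoint_op_symmetric[OF A x u(1)])
      have re: "inner (the (A x)) v = inner x w"
      proof (rule LIMSEQ_unique)
        show "(\<lambda>n. inner (the (A x)) (u n)) \<longlonglongrightarrow> inner (the (A x)) v" by (intro tendsto_intros v)
        show "(\<lambda>n. inner (the (A x)) (u n)) \<longlonglongrightarrow> inner x w"
          using * by (subst Re_cinner[symmetric]) (simp add: Re_cinner, intro tendsto_intros Aw)
      qed
      have im: "inner (the (A x)) (\<i> *\<^sub>C v) = inner x (\<i> *\<^sub>C w)"
      proof (rule LIMSEQ_unique)
        show "(\<lambda>n. inner (the (A x)) (\<i> *\<^sub>C u n)) \<longlonglongrightarrow> inner (the (A x)) (\<i> *\<^sub>C v)"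
          by (intro tendsto_intros bounded_linear.tendsto[OF bounded_linear_scaleC] v)
        have "inner (the (A x)) (\<i> *\<^sub>C u n) = inner x (\<i> *\<^sub>C the (A (u n)))" for n
          using *[of n] by (simp add: cinner_eq_iff_inner)
        thus "(\<lambda>n. inner (the (A x)) (\<i> *\<^sub>C u n)) \<longlonglongrightarrow> inner x (\<i> *\<^sub>C w)"
          by (simp, intro tendsto_intros bounded_linear.tendsto[OF bounded_linear_scaleC] Aw)
      qed
      show "cinner (the (A x)) v = cinner x w" using re im by (simp add: cinner_eq_iff_inner)
    qed
    moreover have "c *\<^sub>C w + B v = y" using c by (simp add: w_def scaleC_scaleC)
    ultimately show "y \<in> H ` dom A" by (auto simp: H_def intro!: image_eqI[of _ _ v])
  qed
  then obtain p where p: "p \<in> H ` dom A" "\<And>m. m \<in> H ` dom A \<Longrightarrow> inner (y - p) m = 0"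
    using orthogonal_decomposition[OF _ csubspace_subspace[OF csub]] by metis
  define v where "v = y - p"
  have orth: "cinner (H x) v = 0" if "x \<in> dom A" for x
  proof -
    have "inner (d *\<^sub>C H x) v = 0" for d
      using p(2)[of "d *\<^sub>C H x"] Hsc[OF that, of d] sub(3)[OF that, of d]
      unfolding v_def by (metis imageI inner_commute)
    from this[of 1] this[of \<i>] show ?thesis
      by (simp add: Re_cinner[symmetric] cinner_scaleC_left complex_eq_iff)
  qed
  \<comment> \<open>orthogonality to the range is a weak equation for A v\<close>
  have Av: "A v = Some (- cnj (inverse c) *\<^sub>C B v)"
    unfolding selfadjoint_opD(3)[OF A]
  proof
    fix x assume "x \<in> dom A"
    from orth[OF this] have "c * cinner (the (A x)) v = - cinner x (B v)"
      by (simp add: H_def cinner_add_left cinner_scaleC_left sym eq_neg_iff_add_eq_0)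
    thus "cinner (the (A x)) v = cinner x (- cnj (inverse c) *\<^sub>C B v)"
      using c by (simp add: cinner_scaleC_right cinner_minus_right field_simps)
  qed
  have "l * (norm v)\<^sup>2 \<le> 0"
    using coer'[of v] Av c by (auto simp: scaleC_scaleC)
  hence "v = 0" using l by (simp add: mult_le_0_iff)
  thus ?thesis using p(1) by (auto simp: v_def H_def)
qed


text \<open>
  Induction over a spanning set. To add \<open>b\<close>, one first subtracts from it an element \<open>u\<close> of the old
  span that the form cannot distinguish from \<open>b\<close>; the system then becomes triangular and the new
  pivot \<open>a b' b'\<close> does not vanish. Both the Galerkin projection and the steps of the implicit
  scheme are instances.
\<close>

theorem finite_dim_form_solvable:
  fixes a :: "'a::complex_inner \<Rightarrow> 'a \<Rightarrow> complex"
  assumes D: "complex_vector.subspace D" and F: "finite F" "F \<subseteq> D"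
    and al: "\<And>x y z. x \<in> D \<Longrightarrow> y \<in> D \<Longrightarrow> z \<in> D \<Longrightarrow> a (x + y) z = a x z + a y z"
    and sl: "\<And>c x z. x \<in> D \<Longrightarrow> z \<in> D \<Longrightarrow> a (c *\<^sub>C x) z = c * a x z"
    and ar: "\<And>x y z. x \<in> D \<Longrightarrow> y \<in> D \<Longrightarrow> z \<in> D \<Longrightarrow> a z (x + y) = a z x + a z y"
    and sr: "\<And>c x z. x \<in> D \<Longrightarrow> z \<in> D \<Longrightarrow> a z (c *\<^sub>C x) = cnj c * a z x"
    and nondeg: "\<And>x. x \<in> D \<Longrightarrow> x \<noteq> 0 \<Longrightarrow> a x x \<noteq> 0"
    and l_add: "\<And>x y. x \<in> D \<Longrightarrow> y \<in> D \<Longrightarrow> l (x + y) = l x + (l y :: complex)"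
    and l_scale: "\<And>c x. x \<in> D \<Longrightarrow> l (c *\<^sub>C x) = cnj c * l x"
  shows "\<exists>q\<in>complex_vector.span F. \<forall>\<phi>\<in>complex_vector.span F. a q \<phi> = l \<phi>"
  using F l_add l_scale
proof (induction F arbitrary: l rule: finite_induct)
  case empty
  have "l 0 = 0" using empty(3)[of 0 0] complex_vector.subspace_0[OF D] by simp
  moreover have "a 0 0 = 0" using sl[of 0 0 0] complex_vector.subspace_0[OF D] by simp
  ultimately show ?case by simp
next
  case (insert b F)
  let ?V = "complex_vector.span F"
  have VD: "?V \<subseteq> D" and bD: "b \<in> D"
    using insert.prems(1) complex_vector.span_minimal[OF _ D] by auto
  show ?case
  proof (cases "b \<in> ?V")
    case True
    hence "complex_vector.span (insert b F) = ?V" by (rule complex_vector.span_redundant)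
    with insert.IH[of l] insert.prems show ?thesis by auto
  next
    case False
    note subD = complex_vector.subspace_add[OF D] complex_vector.subspace_diff[OF D]
      complex_vector.subspace_scale[OF D]
    obtain u where u: "u \<in> ?V" "\<And>\<phi>. \<phi> \<in> ?V \<Longrightarrow> a u \<phi> = a b \<phi>"
      using insert.IH[of "a b"] insert.prems(1) ar[OF _ _ bD] sr[OF _ bD] by auto
    obtain q0 where q0: "q0 \<in> ?V" "\<And>\<phi>. \<phi> \<in> ?V \<Longrightarrow> a q0 \<phi> = l \<phi>"
      using insert.IH[of l] insert.prems by auto
    define b' where "b' = b + (- 1) *\<^sub>C u"
    have uD: "u \<in> D" "q0 \<in> D" using u q0 VD by auto
    have uD: "u \<in> D" "q0 \<in> D" "(- 1) *\<^sub>C u \<in> D" using uD subD(3)[OF uD(1), of "- 1"] by blast+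
    hence b'D: "b' \<in> D" using bD subD by (simp add: b'_def)
    have "b' \<noteq> 0"
    proof
      assume "b' = 0"
      hence "b = u" by (simp add: b'_def)
      with False u show False by simp
    qed
    hence nz: "a b' b' \<noteq> 0" by (rule nondeg[OF b'D])
    have orth: "a b' \<phi> = 0" if "\<phi> \<in> ?V" for \<phi>
    proof -
      have "a b' \<phi> = a b \<phi> + (- 1) * a u \<phi>"
        unfolding b'_def using that VD uD bD by (subst al) (auto simp only: sl subsetD)
      thus ?thesis using u(2)[OF that] by simp
    qed
    define c where "c = (l b' - a q0 b') / a b' b'"
    define q where "q = q0 + c *\<^sub>C b'"
    have qD: "q \<in> D" using uD b'D subD by (simp add: q_def)
    have b'span: "b' \<in> complex_vector.span (insert b F)"
      unfolding b'_def
      by (meson complex_vector.span_add complex_vector.span_scale complex_vector.span_base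
          complex_vector.span_mono insertI1 subset_insertI subsetD u(1))
    have "q \<in> complex_vector.span (insert b F)"
      unfolding q_def
      by (meson complex_vector.span_add complex_vector.span_scale b'span
          complex_vector.span_mono subset_insertI subsetD q0(1))
    moreover have "a q \<phi> = l \<phi>" if \<phi>_span: "\<phi> \<in> complex_vector.span (insert b F)" for \<phi>
    proof -
      obtain k where k: "\<phi> - k *\<^sub>C b \<in> ?V"
        using \<phi>_span unfolding complex_vector.span_insert by blast
      define v where "v = (\<phi> - k *\<^sub>C b) + k *\<^sub>C u"
      have v: "v \<in> ?V" unfolding v_def
        by (intro complex_vector.span_add complex_vector.span_scale k u)
      hence vD: "v \<in> D" using VD by blast
      have \<phi>: "\<phi> = v + k *\<^sub>C b'"
        by (simp add: v_def b'_def complex_vector.scale_right_diff_distrib)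
      have qv: "a q v = l v"
        unfolding q_def using v vD uD b'D subD orth q0 by (simp add: al sl)
      have qb: "a q b' = l b'"
        unfolding q_def using uD b'D subD nz by (simp add: al sl c_def)
      show ?thesis unfolding \<phi>
        using qD vD b'D subD qv qb insert.prems(2)[of v "k *\<^sub>C b'"] insert.prems(3)[of b' k]
        by (simp add: ar sr)
    qed
    ultimately show ?thesis by blast
  qed
qed

section \<open>The square root of a strictly positive operator\<close>

text \<open>
  The Taylor coefficients at \<open>0\<close> of the function that maps \<open>t\<close> to the square root of \<open>1 - t\<close>.
\<close>

definition sqrt_coeff :: "nat \<Rightarrow> real"
  where "sqrt_coeff n = (- 1) ^ n * ((1/2) gchoose n)"

lemma signed_gbinomial_Suc:
  "(- 1) ^ Suc n * (a gchoose Suc n) = (- 1) ^ n * (a gchoose n) * ((real n - a) / real (Suc n))"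
  for a :: real
proof -
  have "real (Suc n) * (a gchoose Suc n) = (a - real n) * (a gchoose n)"
    using gbinomial_mult_1[of a n] by (simp add: algebra_simps)
  hence *: "(a gchoose Suc n) = (a - real n) * (a gchoose n) / real (Suc n)"
    by (simp add: field_simps)
  show ?thesis unfolding * by (simp add: field_simps)
qed

lemma sqrt_coeff_0: "sqrt_coeff 0 = 1"
  by (simp add: sqrt_coeff_def)

lemma sqrt_coeff_nonpos: "sqrt_coeff (Suc n) \<le> 0"
proof (induction n)
  case 0
  show ?case by (simp add: sqrt_coeff_def)
next
  case (Suc n)
  have "sqrt_coeff (Suc (Suc n)) = sqrt_coeff (Suc n) * ((real (Suc n) - 1/2) / real (Suc (Suc n)))"
    unfolding sqrt_coeff_def by (rule signed_gbinomial_Suc)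
  also have "\<dots> \<le> 0" by (rule mult_nonpos_nonneg[OF Suc]) simp
  finally show ?case .
qed

text \<open>
  An alternating sum of binomial coefficients is again a binomial coefficient, here of \<open>-1/2\<close>,
  whose sign is known. As all coefficients but the first are nonpositive, this makes the series
  converge absolutely at the boundary point \<open>t = 1\<close>.
\<close>

lemma sqrt_coeff_partial_sum: "(\<Sum>n\<le>N. sqrt_coeff n) \<ge> 0"
proof -
  have "0 \<le> (- 1) ^ n * ((- (1/2) :: real) gchoose n)" for n
  proof (induction n)
    case (Suc n)
    show ?case unfolding signed_gbinomial_Suc by (rule mult_nonneg_nonneg[OF Suc]) simp
  qed simp
  moreover have "(\<Sum>n\<le>N. sqrt_coeff n) = (- 1) ^ N * ((- (1/2) :: real) gchoose N)"
    using gbinomial_sum_lower_neg[of "1/2::real" N] by (simp add: sqrt_coeff_def mult.commute)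
  ultimately show ?thesis by simp
qed

lemma summable_sqrt_coeff: "summable (\<lambda>n. \<bar>sqrt_coeff n\<bar>)"
proof (rule bounded_imp_summable[of _ 2])
  fix N
  have "(\<Sum>n\<le>N. \<bar>sqrt_coeff n\<bar>) = 2 * sqrt_coeff 0 - (\<Sum>n\<le>N. sqrt_coeff n)"
  proof (induction N)
    case (Suc N)
    thus ?case using sqrt_coeff_nonpos[of N] by simp
  qed (simp add: sqrt_coeff_0)
  thus "(\<Sum>n\<le>N. \<bar>sqrt_coeff n\<bar>) \<le> 2"
    using sqrt_coeff_partial_sum[of N] by (simp add: sqrt_coeff_0)
qed simp

text \<open>
  Vandermonde's identity with \<open>1/2 + 1/2 = 1\<close>: the square of the series is \<open>1 - t\<close>.
\<close>

lemma sqrt_coeff_convolution: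
  "(\<Sum>k\<le>n. sqrt_coeff k * sqrt_coeff (n - k)) = (if n = 0 then 1 else if n = 1 then - 1 else 0)"
proof -
  have "(\<Sum>k\<le>n. sqrt_coeff k * sqrt_coeff (n - k)) =
    (\<Sum>k\<le>n. (- 1) ^ n * (((1/2) gchoose k) * ((1/2) gchoose (n - k))))"
  proof (intro sum.cong refl)
    fix k assume "k \<in> {..n}"
    hence "(- 1 :: real) ^ n = (- 1) ^ k * (- 1) ^ (n - k)" by (simp flip: power_add)
    thus "sqrt_coeff k * sqrt_coeff (n - k) =
      (- 1) ^ n * (((1/2) gchoose k) * ((1/2) gchoose (n - k)))"
      by (simp add: sqrt_coeff_def)
  qed
  also have "\<dots> = (- 1) ^ n * ((1/2 + 1/2 :: real) gchoose n)"
    by (simp only: sum_distrib_left[symmetric] gbinomial_Vandermonde[symmetric] atMost_atLeast0)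
  also have "\<dots> = (- 1) ^ n * real (1 choose n)"
    using binomial_gbinomial[of 1 n, where ?'a = real] by simp
  also have "\<dots> = (if n = 0 then 1 else if n = 1 then - 1 else 0)"
    by (auto simp: binomial_eq_0)
  finally show ?thesis .
qed

text \<open>
  \<open>S\<close> is the series \<open>\<Sum> c\<^sub>n T\<^sup>n\<close> with the above coefficients \<open>c\<^sub>n\<close>, which converges absolutely for a
  contraction. All coefficients but \<open>c\<^sub>0 = 1\<close> are nonpositive and their partial sums are
  nonnegative; with \<open>\<langle>T\<^sup>n x, x\<rangle> \<le> \<parallel>x\<parallel>\<^sup>2\<close> this yields positivity.
\<close>

theorem contraction_sqrt:
  fixes T :: "'a::complex_hilbert \<Rightarrow> 'a"
  assumes T: "bounded_clinear T" and contr: "\<And>x. norm (T x) \<le> norm x"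
    and sym: "\<And>x y. cinner (T x) y = cinner x (T y)"
  obtains S where "bounded_clinear S" "\<And>x y. cinner (S x) y = cinner x (S y)"
    "\<And>x. 0 \<le> inner (S x) x" "\<And>x. S (S x) = x - T x"
proof -
  interpret T: bounded_linear T using T by (rule bounded_clinearD)
  let ?c = sqrt_coeff
  have Tn: "norm ((T ^^ n) x) \<le> norm x" for n x
    by (induction n) (auto intro: order_trans[OF contr])
  have lin: "bounded_linear (T ^^ n)" for n
  proof (induction n)
    case 0 show ?case by (simp add: id_def bounded_linear_ident)
  next
    case (Suc n) thus ?case
      using bounded_linear_compose[OF T.bounded_linear_axioms] by (simp add: o_def)
  qed
  have scC: "(T ^^ n) (c *\<^sub>C x) = c *\<^sub>C (T ^^ n) x" for n c x
    by (induction n) (simp_all add: bounded_clinearD(2)[OF T])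
  have symn: "cinner ((T ^^ n) x) y = cinner x ((T ^^ n) y)" for n x y
    by (induction n arbitrary: x y) (simp_all add: sym funpow_swap1)
  have nsum: "summable (\<lambda>n. norm (?c n *\<^sub>R (T ^^ n) x))" for x
  proof (rule summable_comparison_test_ev)
    show "\<forall>\<^sub>F n in sequentially. norm (norm (?c n *\<^sub>R (T ^^ n) x)) \<le> \<bar>?c n\<bar> * norm x"
      by (intro always_eventually allI) (simp add: mult_left_mono Tn)
    show "summable (\<lambda>n. \<bar>?c n\<bar> * norm x)" by (intro summable_mult2 summable_sqrt_coeff)
  qed
  define S where "S x = (\<Sum>n. ?c n *\<^sub>R (T ^^ n) x)" for x
  have sums: "(\<lambda>n. ?c n *\<^sub>R (T ^^ n) x) sums S x" for x
    unfolding S_def by (rule summable_sums[OF summable_norm_cancel[OF nsum]])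
  have S_add: "S (x + y) = S x + S y" for x y
  proof (rule sums_unique2[OF sums])
    show "(\<lambda>n. ?c n *\<^sub>R (T ^^ n) (x + y)) sums (S x + S y)"
      using sums_add[OF sums[of x] sums[of y]]
      by (simp add: linear_add[OF bounded_linear.linear[OF lin]] scaleR_add_right)
  qed
  have S_scale: "S (c *\<^sub>C x) = c *\<^sub>C S x" for c x
  proof (rule sums_unique2[OF sums])
    show "(\<lambda>n. ?c n *\<^sub>R (T ^^ n) (c *\<^sub>C x)) sums (c *\<^sub>C S x)"
      using bounded_linear.sums[OF bounded_linear_scaleC sums[of x]] by (simp add: scC scaleC_scaleR)
  qed
  have "norm (S x) \<le> norm x * (\<Sum>n. \<bar>?c n\<bar>)" for x
  proof -
    have "norm (S x) \<le> (\<Sum>n. norm (?c n *\<^sub>R (T ^^ n) x))"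
      unfolding S_def by (rule summable_norm[OF nsum])
    also have "\<dots> \<le> (\<Sum>n. \<bar>?c n\<bar> * norm x)"
      by (intro suminf_le nsum summable_mult2 summable_sqrt_coeff) (simp add: mult_left_mono Tn)
    also have "\<dots> = norm x * (\<Sum>n. \<bar>?c n\<bar>)"
      using suminf_mult2[OF summable_sqrt_coeff, of "norm x"] by (simp add: mult.commute)
    finally show ?thesis .
  qed
  hence S_bl: "bounded_linear S"
    by (intro bounded_linear_intro[OF S_add])
      (auto simp: scaleC_of_real[symmetric] S_scale)
  hence S_bcl: "bounded_clinear S" by (simp add: bounded_clinear_def S_scale)
  have inner_S: "(\<lambda>n. inner (?c n *\<^sub>R (T ^^ n) x) y) sums inner (S x) y" for x y
    by (rule bounded_linear.sums[OF bounded_linear_inner_left sums])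
  have S_re: "inner (S x) y = inner x (S y)" for x y
  proof (rule sums_unique2[OF inner_S])
    have "inner ((T ^^ n) x) y = inner x ((T ^^ n) y)" for n
      using symn[of n x y] by (simp add: cinner_eq_iff_inner)
    thus "(\<lambda>n. inner (?c n *\<^sub>R (T ^^ n) x) y) sums inner x (S y)"
      using inner_S[of y x] by (simp add: inner_commute)
  qed
  have S_sym: "cinner (S x) y = cinner x (S y)" for x y
    unfolding cinner_eq_iff_inner S_scale[symmetric] using S_re by blast
  have S_pos: "0 \<le> inner (S x) x" for x
  proof (rule LIMSEQ_le_const[OF inner_S[unfolded sums_def_le]], intro exI allI impI)
    fix N
    have "0 \<le> (norm x)\<^sup>2 * (\<Sum>n\<le>N. ?c n)"
      by (intro mult_nonneg_nonneg sqrt_coeff_partial_sum) simp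
    also have "\<dots> = (\<Sum>n\<le>N. ?c n * (norm x)\<^sup>2)" by (simp add: sum_distrib_right mult.commute)
    also have "\<dots> \<le> (\<Sum>n\<le>N. inner (?c n *\<^sub>R (T ^^ n) x) x)"
    proof (rule sum_mono)
      fix n
      show "?c n * (norm x)\<^sup>2 \<le> inner (?c n *\<^sub>R (T ^^ n) x) x"
      proof (cases n)
        case 0 thus ?thesis by (simp add: sqrt_coeff_0 power2_norm_eq_inner)
      next
        case (Suc m)
        have "inner ((T ^^ n) x) x \<le> norm ((T ^^ n) x) * norm x" by (rule norm_cauchy_schwarz)
        also have "\<dots> \<le> (norm x)\<^sup>2"
          using mult_right_mono[OF Tn[of n x], of "norm x"] by (simp add: power2_eq_square)
        finally show ?thesis
          using sqrt_coeff_nonpos[of m] unfolding Suc by (simp add: mult_left_mono_neg del: funpow.simps)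
      qed
    qed
    finally show "0 \<le> (\<Sum>n\<le>N. inner (?c n *\<^sub>R (T ^^ n) x) x)" .
  qed
  have S_square: "S (S x) = x - T x" for x
  proof -
    define u where "u i j = (?c i * ?c j) *\<^sub>R (T ^^ (i + j)) x" for i j
    have infS: "infsum (\<lambda>n. ?c n *\<^sub>R (T ^^ n) y) UNIV = S y" for y
      by (rule infsumI[OF norm_summable_imp_has_sum[OF nsum sums]])
    have rsum: "(\<lambda>n. \<bar>?c n\<bar>) summable_on UNIV"
      using norm_summable_imp_summable_on[of "\<lambda>n. \<bar>?c n\<bar>"] summable_sqrt_coeff by simp
    have "(\<lambda>p. norm (case p of (i, j) \<Rightarrow> ?c i * ?c j * norm x)) summable_on UNIV \<times> UNIV"
      unfolding Infinite_Sum.abs_summable_on_Sigma_iff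
    proof (intro conjI ballI)
      have eq: "norm (case (i, j) of (i, j) \<Rightarrow> ?c i * ?c j * norm x) = \<bar>?c i\<bar> * norm x * \<bar>?c j\<bar>" for i j
        by (simp add: abs_mult)
      show "(\<lambda>j. norm (case (i, j) of (i, j) \<Rightarrow> ?c i * ?c j * norm x)) summable_on UNIV" for i
        unfolding eq by (intro summable_on_cmult_right rsum)
      show "(\<lambda>i. norm (infsum (\<lambda>j. norm (case (i, j) of (i, j) \<Rightarrow> ?c i * ?c j * norm x)) UNIV)) summable_on UNIV"
        unfolding eq infsum_cmult_right' summable_on_iff_abs_summable_on_real[symmetric]
        by (intro summable_on_cmult_left rsum)
    qed
    hence "(\<lambda>p. norm (case p of (i, j) \<Rightarrow> u i j)) summable_on UNIV \<times> UNIV"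
    proof (rule Infinite_Sum.abs_summable_on_comparison_test)
      fix p show "norm (case p of (i, j) \<Rightarrow> u i j) \<le> norm (case p of (i, j) \<Rightarrow> ?c i * ?c j * norm x)"
        by (cases p) (simp add: u_def abs_mult mult_left_mono Tn)
    qed
    hence summ: "(\<lambda>(i, j). u i j) summable_on UNIV \<times> UNIV" by (rule abs_summable_summable)
    \<comment> \<open>summation along the diagonals i + j = n\<close>
    have bij: "bij_betw (\<lambda>(n, k). (k, n - k)) (SIGMA n:UNIV. {..n}) (UNIV \<times> UNIV :: (nat \<times> nat) set)"
      by (rule bij_betw_byWitness[of _ "\<lambda>(i, j). (i + j, i)"]) auto
    have summ': "(\<lambda>(n, k). u k (n - k)) summable_on (SIGMA n:UNIV. {..n})"
      using summable_on_reindex_bij_betw[OF bij, of "\<lambda>(i, j). u i j"] summ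
      by (simp add: case_prod_unfold)
    have "S (S x) = infsum (\<lambda>i. infsum (u i) UNIV) UNIV"
    proof -
      have "infsum (u i) UNIV = ?c i *\<^sub>R (T ^^ i) (S x)" for i
      proof (rule infsumI[OF norm_summable_imp_has_sum])
        have "(\<lambda>j. ?c i *\<^sub>R (T ^^ i) (?c j *\<^sub>R (T ^^ j) x)) sums (?c i *\<^sub>R (T ^^ i) (S x))"
          by (intro bounded_linear.sums[OF bounded_linear_scaleR_right] bounded_linear.sums[OF lin] sums)
        thus "u i sums (?c i *\<^sub>R (T ^^ i) (S x))"
          unfolding u_def[abs_def] by (simp add: linear_scale[OF bounded_linear.linear[OF lin]] funpow_add)
        show "summable (\<lambda>n. norm (u i n))"
        proof (rule summable_comparison_test_ev)
          show "\<forall>\<^sub>F n in sequentially. norm (norm (u i n)) \<le> \<bar>?c n\<bar> * (\<bar>?c i\<bar> * norm x)"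
          proof (intro always_eventually allI)
            fix n show "norm (norm (u i n)) \<le> \<bar>?c n\<bar> * (\<bar>?c i\<bar> * norm x)"
              using mult_left_mono[OF Tn[of "i + n" x], of "\<bar>?c i\<bar> * \<bar>?c n\<bar>"]
              by (simp add: u_def abs_mult ac_simps)
          qed
          show "summable (\<lambda>n. \<bar>?c n\<bar> * (\<bar>?c i\<bar> * norm x))"
            by (intro summable_mult2 summable_sqrt_coeff)
        qed
      qed
      thus ?thesis using infS[of "S x"] by simp
    qed
    also have "\<dots> = infsum (\<lambda>(i, j). u i j) (UNIV \<times> UNIV)"
      by (rule infsum_Sigma'_banach[OF summ])
    also have "\<dots> = infsum (\<lambda>(n, k). u k (n - k)) (SIGMA n:UNIV. {..n})"
      using infsum_reindex_bij_betw[OF bij, of "\<lambda>(i, j). u i j"] by (simp add: case_prod_unfold)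
    also have "\<dots> = infsum (\<lambda>n. infsum (\<lambda>k. u k (n - k)) {..n}) UNIV"
      by (rule infsum_Sigma'_banach[OF summ', symmetric])
    also have "\<dots> = infsum (\<lambda>n. (if n = 0 then 1 else if n = 1 then - 1 else 0) *\<^sub>R (T ^^ n) x) UNIV"
    proof (intro infsum_cong)
      fix n :: nat
      have "infsum (\<lambda>k. u k (n - k)) {..n} = (\<Sum>k\<le>n. u k (n - k))" by (rule infsum_finite) simp
      also have "\<dots> = (\<Sum>k\<le>n. ?c k * ?c (n - k)) *\<^sub>R (T ^^ n) x"
        unfolding scaleR_sum_left by (intro sum.cong) (auto simp: u_def)
      finally show "infsum (\<lambda>k. u k (n - k)) {..n} =
        (if n = 0 then 1 else if n = 1 then - 1 else 0) *\<^sub>R (T ^^ n) x"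
        unfolding sqrt_coeff_convolution .
    qed
    also have "\<dots> = infsum (\<lambda>n. (if n = 0 then 1 else if n = 1 then - 1 else 0) *\<^sub>R (T ^^ n) x) {0, 1}"
      by (rule infsum_cong_neutral) auto
    also have "\<dots> = x - T x" by (subst infsum_finite) auto
    finally show ?thesis .
  qed
  show thesis by (rule that[OF S_bcl S_sym S_pos S_square])
qed

lemma strictly_positive_opD:
  assumes "strictly_positive_op A"
  obtains m where "m > 0" "\<And>x. x \<in> dom A \<Longrightarrow> m * (norm x)\<^sup>2 \<le> inner (the (A x)) x"
  using assms by (auto simp: strictly_positive_op_def Re_cinner)

text \<open>
  The inverse \<open>R\<close> of \<open>A\<close> is bounded, and \<open>m\<parallel>Rx\<parallel>\<^sup>2 \<le> \<langle>x, Rx\<rangle>\<close> implies that \<open>I - mR\<close> is a contraction.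
  The square root of \<open>mR\<close>, rescaled, is a positive \<open>S\<close> with \<open>S\<^sup>2 = R\<close>, and the inverse of \<open>S\<close>, with
  the range of \<open>S\<close> as its domain, is a square root of \<open>A\<close>.
\<close>

theorem sqrt_op:
  fixes A :: "'a::complex_hilbert \<rightharpoonup> 'a"
  assumes A: "selfadjoint_op A" and pos: "strictly_positive_op A"
  shows "selfadjoint_op (sqrt_op A)" "positive_op (sqrt_op A)" "sqrt_op A \<circ>\<^sub>m sqrt_op A = A"
proof -
  note lin = linear_opD[OF selfadjoint_opD(1)[OF A]]
  obtain m where m: "m > 0" "\<And>x. x \<in> dom A \<Longrightarrow> m * (norm x)\<^sup>2 \<le> inner (the (A x)) x"
    using strictly_positive_opD[OF pos] by metis
  have "\<exists>x\<in>dom A. 1 *\<^sub>C the (A x) + (\<lambda>_. 0) x = y" for y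
    by (rule coercive_range[OF A, of "\<lambda>_. 0" 1 m])
      (use m in \<open>auto simp: bounded_clinear_def bounded_linear_zero\<close>)
  hence "\<forall>y. \<exists>x. x \<in> dom A \<and> the (A x) = y" by (simp) blast
  from choice[OF this] obtain R where R: "\<And>y. R y \<in> dom A" "\<And>y. the (A (R y)) = y" by blast
  have inj: "x = y" if "x \<in> dom A" "y \<in> dom A" "the (A x) = the (A y)" for x y
  proof -
    have "x - y \<in> dom A" using that lin(1) complex_vector.subspace_diff by blast
    from m(2)[OF this] have "m * (norm (x - y))\<^sup>2 \<le> 0" using that by (simp add: lin)
    thus ?thesis using m(1) by (simp add: mult_le_0_iff)
  qed
  have R_eq: "R y = x \<longleftrightarrow> A x = Some y" for x y
  proof
    assume "R y = x"
    with R[of y] show "A x = Some y" by (metis domIff option.collapse)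
  next
    assume "A x = Some y"
    thus "R y = x" by (intro inj[OF R(1)]) (auto simp: R(2))
  qed
  have R_add: "R (x + y) = R x + R y" for x y
    by (rule inj) (simp_all only: R lin(2) complex_vector.subspace_add[OF lin(1)])
  have R_sc: "R (c *\<^sub>C x) = c *\<^sub>C R x" for c x
    by (rule inj) (simp_all only: R lin(3) complex_vector.subspace_scale[OF lin(1)])
  have R_sym: "cinner (R x) y = cinner x (R y)" for x y
    using selfadjoint_op_symmetric[OF A R(1) R(1), of x y] R(2) by simp
  have R_low: "m * (norm (R x))\<^sup>2 \<le> inner x (R x)" for x
    using m(2)[OF R(1)[of x]] R(2) by simp
  have "norm (R x) \<le> norm x * (1 / m)" for x
  proof -
    have "m * (norm (R x))\<^sup>2 \<le> norm x * norm (R x)"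
      using R_low[of x] norm_cauchy_schwarz[of x "R x"] by linarith
    hence "m * norm (R x) \<le> norm x" by (cases "R x = 0") (auto simp: power2_eq_square)
    thus ?thesis using m(1) by (simp add: field_simps)
  qed
  hence R_bl: "bounded_linear R"
    by (intro bounded_linear_intro[where K = "1 / m", OF R_add]) (auto simp: scaleC_of_real[symmetric] R_sc)
  define T where "T x = x - m *\<^sub>R R x" for x
  have "bounded_clinear T"
    unfolding bounded_clinear_def T_def using R_bl
    by (auto intro!: bounded_linear_intros simp: R_sc complex_vector.scale_right_diff_distrib scaleC_scaleR)
  moreover have "norm (T x) \<le> norm x" for x
  proof -
    have "(norm (T x))\<^sup>2 = (norm x)\<^sup>2 - 2 * (m * inner x (R x)) + m * (m * (norm (R x))\<^sup>2)"
      unfolding T_def power2_norm_eq_inner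
      by (simp add: inner_diff_left inner_diff_right inner_commute algebra_simps)
    also have "\<dots> \<le> (norm x)\<^sup>2 - 2 * (m * inner x (R x)) + m * inner x (R x)"
      using R_low[of x] m(1) by simp
    also have "\<dots> \<le> (norm x)\<^sup>2"
    proof -
      have "0 \<le> inner x (R x)"
        by (rule order_trans[OF _ R_low]) (use m(1) in simp)
      thus ?thesis using m(1) by simp
    qed
    finally show ?thesis by simp
  qed
  moreover have "cinner (T x) y = cinner x (T y)" for x y
    by (simp add: T_def cinner_diff_left cinner_diff_right cinner_scaleR_left cinner_scaleR_right R_sym)
  ultimately obtain S0 where S0: "bounded_clinear S0" "\<And>x y. cinner (S0 x) y = cinner x (S0 y)"
    "\<And>x. 0 \<le> inner (S0 x) x" "\<And>x. S0 (S0 x) = x - T x"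
    using contraction_sqrt[of T] by metis
  interpret S0: bounded_linear S0 using S0(1) by (rule bounded_clinearD)
  define S where "S x = (1 / sqrt m) *\<^sub>R S0 x" for x
  have S_sym: "cinner (S x) y = cinner x (S y)" for x y
    by (simp add: S_def cinner_scaleR_left cinner_scaleR_right S0(2))
  have S_pos: "0 \<le> inner (S x) x" for x
    using S0(3)[of x] m(1) by (simp add: S_def)
  have S_add: "S (x + y) = S x + S y" for x y
    by (simp add: S_def S0.add scaleR_add_right)
  have S_sc: "S (c *\<^sub>C x) = c *\<^sub>C S x" for c x
    by (simp add: S_def bounded_clinearD(2)[OF S0(1)] scaleC_scaleR)
  have SS: "S (S x) = R x" for x
    using m(1) by (simp add: S_def S0.scaleR S0(4) T_def)
  have S_inj: "x = y" if "S x = S y" for x y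
    using SS[of x] SS[of y] that R(2) by metis
  define B where "B x = (if x \<in> range S then Some (inv S x) else None)" for x
  have B_eq: "B x = Some u \<longleftrightarrow> x = S u" for x u
    unfolding B_def using S_inj by (auto simp: inv_f_f inj_def)
  have B_S: "B (S u) = Some u" for u by (simp add: B_eq)
  have domB: "dom B = range S" by (auto simp: B_def dom_def)
  have dense: "closure (dom B) = UNIV"
  proof -
    have "dom A \<subseteq> range S"
    proof
      fix x assume "x \<in> dom A"
      then obtain y where "A x = Some y" by blast
      hence "x = R y" using R_eq by metis
      thus "x \<in> range S" using SS[of y] by (metis rangeI)
    qed
    thus ?thesis using closure_mono[of "dom A" "dom B"] selfadjoint_opD(2)[OF A] domB by auto
  qed
  have "linear_op B"
    unfolding linear_op_def complex_vector.subspace_def domB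
  proof (intro conjI allI ballI)
    show "0 \<in> range S" using S_sc[of 0 0] by (metis complex_vector.scale_zero_left rangeI)
  qed (auto simp: B_S simp flip: S_add S_sc)
  moreover have "adj_op B = B"
  proof
    fix y
    have "adj_op B y = Some w \<longleftrightarrow> B y = Some w" for w
    proof -
      have "adj_op B y = Some w \<longleftrightarrow> (\<forall>u. cinner u y = cinner u (S w))"
        unfolding adj_op_eq_Some_iff[OF dense] domB by (simp add: B_S S_sym)
      also have "\<dots> \<longleftrightarrow> B y = Some w" unfolding B_eq using cinner_ext by blast
      finally show ?thesis .
    qed
    thus "adj_op B y = B y" by (metis not_None_eq)
  qed
  moreover have "positive_op B"
    unfolding positive_op_def domB using S_pos by (auto simp: B_S Re_cinner inner_commute)
  moreover have "B \<circ>\<^sub>m B = A"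
  proof
    fix x
    have "(B \<circ>\<^sub>m B) x = Some u \<longleftrightarrow> A x = Some u" for u
      unfolding map_comp_Some_iff B_eq R_eq[symmetric] SS[symmetric] by auto
    thus "(B \<circ>\<^sub>m B) x = A x" by (metis not_None_eq)
  qed
  ultimately have "\<exists>B. selfadjoint_op B \<and> positive_op B \<and> B \<circ>\<^sub>m B = A"
    using dense unfolding selfadjoint_op_def by blast
  from someI_ex[OF this]
  show "selfadjoint_op (sqrt_op A)" "positive_op (sqrt_op A)" "sqrt_op A \<circ>\<^sub>m sqrt_op A = A"
    unfolding sqrt_op_def by blast+
qed

section \<open>Regularity of dissipative semigroups\<close>

text \<open>
  By Baire's theorem one of the closed sets on which all \<open>f n\<close> are bounded by \<open>k\<close> contains a ball.
\<close>

theorem uniform_boundedness: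
  fixes f :: "nat \<Rightarrow> 'a::banach \<Rightarrow> 'b::real_normed_vector"
  assumes lin: "\<And>n. bounded_linear (f n)" and pt: "\<And>x. Bseq (\<lambda>n. f n x)"
  obtains K where "K \<ge> 0" "\<And>n x. norm (f n x) \<le> K * norm x"
proof -
  define C where "C k = {x. \<forall>n. norm (f n x) \<le> real k}" for k
  have cl: "closed (C k)" for k
    unfolding C_def
    by (intro closed_Collect_all closed_Collect_le continuous_intros
        linear_continuous_on[OF lin])
  have cover: "\<Union>(range C) = UNIV"
  proof (intro equalityI subset_UNIV subsetI)
    fix x
    obtain K where "\<And>n. norm (f n x) \<le> K" using pt[of x] by (auto simp: Bseq_def)
    moreover obtain k :: nat where "K \<le> real k" using real_arch_simple by blast
    ultimately have "x \<in> C k" by (auto simp: C_def intro: order_trans)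
    thus "x \<in> \<Union>(range C)" by blast
  qed
  have "\<exists>k. interior (C k) \<noteq> {}"
  proof (rule ccontr)
    assume "\<not> ?thesis"
    hence "euclidean interior_of \<Union>(range C) = {}"
      using Met_TC.metric_Baire_category_alt[where 'a = 'a, of "range C"] cl complete_UNIV by auto
    thus False unfolding cover by simp
  qed
  then obtain k x0 e where e: "e > 0" "ball x0 e \<subseteq> C k"
    by (metis equals0I mem_interior)
  have "norm (f n x) \<le> (4 * real k / e) * norm x" for n x
  proof (cases "x = 0")
    case True thus ?thesis using linear_0[OF bounded_linear.linear[OF lin]] by simp
  next
    case False
    interpret bounded_linear "f n" by (rule lin)
    define r where "r = (e / 2) / norm x"
    have r: "r > 0" using e False by (simp add: r_def)
    have "x0 + r *\<^sub>R x \<in> ball x0 e" "x0 \<in> ball x0 e"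
      using e False by (auto simp: dist_norm r_def)
    hence "x0 + r *\<^sub>R x \<in> C k" "x0 \<in> C k" using e(2) by blast+
    hence "norm (f n (x0 + r *\<^sub>R x)) \<le> real k" "norm (f n x0) \<le> real k"
      by (auto simp: C_def)
    moreover have "norm (r *\<^sub>R f n x) \<le> norm (f n (x0 + r *\<^sub>R x)) + norm (f n x0)"
      using norm_triangle_ineq4[of "f n (x0 + r *\<^sub>R x)" "f n x0"] by (simp add: add scaleR)
    ultimately have "r * norm (f n x) \<le> 2 * real k" using r by simp
    hence "norm (f n x) \<le> 2 * real k / r" using r by (simp add: field_simps)
    thus ?thesis using e False by (simp add: r_def field_simps)
  qed
  thus thesis using e by (intro that[of "4 * real k / e"]) auto
qed

text \<open>
  Energy estimates are derived from this: the derivatives of trajectories are one-sided at \<open>0\<close>.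
\<close>

lemma nonincreasing_of_derivative:
  fixes f :: "real \<Rightarrow> real"
  assumes "\<And>t. t \<ge> 0 \<Longrightarrow> (f has_real_derivative f' t) (at t within {0..})"
    and "\<And>t. 0 \<le> t \<Longrightarrow> t \<le> b \<Longrightarrow> f' t \<le> 0" and ab: "0 \<le> a" "a \<le> b"
  shows "f b \<le> f a"
proof (rule DERIV_nonpos_imp_decreasing_open[OF ab(2)])
  fix t assume t: "a < t" "t < b"
  have "at t within {0..} = at t" using t ab by (intro at_within_interior) simp
  thus "\<exists>y. (f has_real_derivative y) (at t) \<and> y \<le> 0"
    using assms(1)[of t] assms(2)[of t] t ab by auto
next
  show "continuous_on {a..b} f"
  proof (rule continuous_on_subset)
    show "continuous_on {0..} f"
      using assms(1) by (meson DERIV_continuous_on atLeast_iff)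
  qed (use ab in auto)
qed

lemma has_real_derivative_norm_square:
  fixes f :: "real \<Rightarrow> 'a::real_inner"
  assumes "(f has_vector_derivative f') (at t within S)"
  shows "((\<lambda>t. (norm (f t))\<^sup>2) has_real_derivative 2 * inner f' (f t)) (at t within S)"
proof -
  have "((\<lambda>t. inner (f t) (f t)) has_derivative
      (\<lambda>h. inner (f t) (h *\<^sub>R f') + inner (h *\<^sub>R f') (f t))) (at t within S)"
    using has_derivative_inner assms unfolding has_vector_derivative_def by blast
  thus ?thesis
    unfolding has_field_derivative_def power2_norm_eq_inner
    by (rule has_derivative_eq_rhs) (simp add: inner_commute fun_eq_iff)
qed

lemma generator_eq_Some_iff:
  "generator T x = Some l \<longleftrightarrow> ((\<lambda>t. (T t x - x) /\<^sub>R t) \<longlongrightarrow> l) (at_right 0)"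
proof
  assume "generator T x = Some l"
  then have "\<exists>l. ((\<lambda>t. (T t x - x) /\<^sub>R t) \<longlongrightarrow> l) (at_right 0)"
    "l = Lim (at_right 0) (\<lambda>t. (T t x - x) /\<^sub>R t)"
    by (auto simp: generator_def split: if_splits)
  thus "((\<lambda>t. (T t x - x) /\<^sub>R t) \<longlongrightarrow> l) (at_right 0)"
    using tendsto_Lim[of "at_right (0::real)"] by auto
next
  assume "((\<lambda>t. (T t x - x) /\<^sub>R t) \<longlongrightarrow> l) (at_right 0)"
  thus "generator T x = Some l"
    using tendsto_Lim[of "at_right (0::real)"] by (auto simp: generator_def)
qed

text \<open>
  A semigroup selected by its generator comes with strong continuity at \<open>0\<close> as its only
  regularity; everything else has to be recovered from there.
\<close>

locale dissipative_semigroup =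
  fixes T :: "real \<Rightarrow> 'x::complex_hilbert \<Rightarrow> 'x" and G :: "'x \<rightharpoonup> 'x"
  assumes C0: "C0_semigroup T" and gen: "generator T = G"
    and dense: "closure (dom G) = UNIV"
    and diss: "\<And>x. x \<in> dom G \<Longrightarrow> inner (the (G x)) x \<le> 0"
begin

lemma T_bcl: "t \<ge> 0 \<Longrightarrow> bounded_clinear (T t)"
  and T_0 [simp]: "T 0 x = x"
  and T_add: "s \<ge> 0 \<Longrightarrow> t \<ge> 0 \<Longrightarrow> T (s + t) x = T s (T t x)"
  and T_right_cont: "((\<lambda>t. T t x) \<longlongrightarrow> x) (at_right 0)"
  using C0 by (auto simp: C0_semigroup_def)

lemma T_bl: "t \<ge> 0 \<Longrightarrow> bounded_linear (T t)"
  using T_bcl bounded_clinearD(1) by blast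

lemma T_diff: "t \<ge> 0 \<Longrightarrow> T t (x - y) = T t x - T t y"
  using linear_diff[OF bounded_linear.linear[OF T_bl]] .

lemma T_scaleR: "t \<ge> 0 \<Longrightarrow> T t (r *\<^sub>R x) = r *\<^sub>R T t x"
  using linear_scale[OF bounded_linear.linear[OF T_bl]] .

lemma T_scaleC: "t \<ge> 0 \<Longrightarrow> T t (c *\<^sub>C x) = c *\<^sub>C T t x"
  using bounded_clinearD(2)[OF T_bcl] .

lemma T_near_0: "e > 0 \<Longrightarrow> \<exists>d>0. \<forall>t. 0 \<le> t \<and> t < d \<longrightarrow> norm (T t x - x) < e"
  using T_right_cont[of x] unfolding tendsto_iff eventually_at_right_field dist_norm
  by (metis T_0 diff_self le_less norm_zero)

text \<open>
  Otherwise there are times tending to \<open>0\<close> at which the norms are unbounded, although the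
  semigroup converges pointwise along them; this contradicts uniform boundedness.
\<close>

lemma bounded_near_0: "\<exists>d>0. \<exists>K\<ge>1. \<forall>t x. 0 \<le> t \<and> t \<le> d \<longrightarrow> norm (T t x) \<le> K * norm x"
proof (rule ccontr)
  assume neg: "\<not> ?thesis"
  have "\<exists>t. 0 \<le> t \<and> t \<le> 1 / real (Suc n) \<and> (\<exists>x. norm (T t x) > real (Suc n) * norm x)" for n
  proof -
    have "1 / real (Suc n) > 0" "real (Suc n) \<ge> 1" by auto
    thus ?thesis using neg by (metis not_le)
  qed
  then obtain t where t: "\<And>n. 0 \<le> t n" "\<And>n. t n \<le> 1 / real (Suc n)"
    "\<And>n. \<exists>x. norm (T (t n) x) > real (Suc n) * norm x" by metis
  have t0: "t \<longlonglongrightarrow> 0"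
    by (rule tendsto_sandwich[OF _ _ tendsto_const LIMSEQ_Suc[OF lim_1_over_n]])
      (use t in auto)
  have "Bseq (\<lambda>n. T (t n) x)" for x
  proof (rule convergent_imp_Bseq[OF convergentI])
    show "(\<lambda>n. T (t n) x) \<longlonglongrightarrow> x"
    proof (rule metric_LIMSEQ_I)
      fix e :: real assume "e > 0"
      then obtain d where d: "d > 0" "\<And>t. 0 \<le> t \<Longrightarrow> t < d \<Longrightarrow> norm (T t x - x) < e"
        using T_near_0 by blast
      obtain N where "\<And>n. n \<ge> N \<Longrightarrow> norm (t n - 0) < d" using LIMSEQ_D[OF t0 d(1)] by blast
      thus "\<exists>N. \<forall>n\<ge>N. dist (T (t n) x) x < e"
        using d(2) t(1) by (auto simp: dist_norm intro!: exI[of _ N])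
    qed
  qed
  then obtain K where K: "K \<ge> 0" "\<And>n x. norm (T (t n) x) \<le> K * norm x"
    using uniform_boundedness[of "\<lambda>n. T (t n)"] T_bl t(1) by metis
  obtain n :: nat where n: "K \<le> real n" using real_arch_simple by blast
  obtain x where "norm (T (t n) x) > real (Suc n) * norm x" using t(3) by blast
  moreover have "K * norm x \<le> real (Suc n) * norm x" using n by (intro mult_right_mono) auto
  ultimately show False using K(2)[of n x] by linarith
qed

lemma locally_bounded: "\<exists>K\<ge>1. \<forall>t x. 0 \<le> t \<and> t \<le> b \<longrightarrow> norm (T t x) \<le> K * norm x"
proof -
  obtain d K where d: "d > 0" "K \<ge> 1" "\<And>t x. 0 \<le> t \<Longrightarrow> t \<le> d \<Longrightarrow> norm (T t x) \<le> K * norm x"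
    using bounded_near_0 by blast
  have *: "0 \<le> t \<Longrightarrow> t \<le> real n * d \<Longrightarrow> norm (T t x) \<le> K ^ n * norm x" for n t x
  proof (induction n arbitrary: t x)
    case (Suc n)
    show ?case
    proof (cases "t \<le> d")
      case True
      have "norm (T t x) \<le> K * norm x" by (rule d(3)[OF Suc.prems(1) True])
      also have "\<dots> \<le> K ^ Suc n * norm x"
        using d(2) by (intro mult_right_mono) (auto simp: self_le_power)
      finally show ?thesis .
    next
      case False
      have "norm (T (d + (t - d)) x) \<le> K * norm (T (t - d) x)"
        using False d by (subst T_add) (auto intro: d(3))
      also have "norm (T (t - d) x) \<le> K ^ n * norm x"
        using Suc.prems False by (intro Suc.IH) (auto simp: algebra_simps)
      finally show ?thesis using d(2) by (simp add: mult_left_mono mult.assoc)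
    qed
  qed simp
  obtain n where "b < real n * d" using reals_Archimedean3[OF d(1)] by blast
  hence "\<forall>t x. 0 \<le> t \<and> t \<le> b \<longrightarrow> norm (T t x) \<le> K ^ n * norm x" using * by force
  moreover have "K ^ n \<ge> 1" using d(2) by simp
  ultimately show ?thesis by blast
qed

lemma generator_T:
  assumes "x \<in> dom G" "t \<ge> 0"
  shows "G (T t x) = Some (T t (the (G x)))"
proof -
  have "((\<lambda>h. (T h x - x) /\<^sub>R h) \<longlongrightarrow> the (G x)) (at_right 0)"
    using assms(1) gen generator_eq_Some_iff[of T x "the (G x)"] by auto
  from bounded_linear.tendsto[OF T_bl[OF assms(2)] this]
  have "((\<lambda>h. (T h (T t x) - T t x) /\<^sub>R h) \<longlongrightarrow> T t (the (G x))) (at_right 0)"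
  proof (rule Lim_transform_eventually)
    show "\<forall>\<^sub>F h in at_right 0. T t ((T h x - x) /\<^sub>R h) = (T h (T t x) - T t x) /\<^sub>R h"
      using eventually_at_right_less[of "0::real"]
    proof eventually_elim
      case (elim h)
      thus ?case using assms(2) T_add[of t h x] T_add[of h t x]
        by (simp add: T_scaleR T_diff add.commute)
    qed
  qed
  thus ?thesis unfolding gen[symmetric] generator_eq_Some_iff .
qed

lemma T_dom: "x \<in> dom G \<Longrightarrow> t \<ge> 0 \<Longrightarrow> T t x \<in> dom G"
  using generator_T by blast

text \<open>
  The derivative from the left is the point that requires the local bound: the difference quotient
  at \<open>t\<close> over a step \<open>h\<close> to the left is \<open>T (t - h)\<close> applied to the difference quotient at \<open>0\<close>.
\<close>

lemma T_derivative:
  assumes x: "x \<in> dom G" and t: "t \<ge> 0"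
  shows "((\<lambda>t. T t x) has_vector_derivative T t (the (G x))) (at t within {0..})"
  unfolding has_vector_derivative_def has_derivative_within_alt
proof (intro conjI allI impI)
  show "bounded_linear (\<lambda>h. h *\<^sub>R T t (the (G x)))" by (rule bounded_linear_scaleR_left)
next
  fix e :: real assume e: "e > 0"
  let ?g = "the (G x)"
  obtain K where K: "K \<ge> 1" "\<And>s y. 0 \<le> s \<Longrightarrow> s \<le> t \<Longrightarrow> norm (T s y) \<le> K * norm y"
    using locally_bounded[of t] by blast
  have e': "e / (2 * K) > 0" using e K by simp
  have "((\<lambda>h. (T h x - x) /\<^sub>R h) \<longlongrightarrow> ?g) (at_right 0)"
    using x gen generator_eq_Some_iff[of T x ?g] by auto
  then obtain d1 where d1: "d1 > 0"
    "\<And>h. 0 < h \<Longrightarrow> h < d1 \<Longrightarrow> norm ((T h x - x) /\<^sub>R h - ?g) < e / (2 * K)"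
    using e' unfolding tendsto_iff eventually_at_right_field dist_norm by blast
  obtain d2 where d2: "d2 > 0" "\<And>h. 0 \<le> h \<Longrightarrow> h < d2 \<Longrightarrow> norm (T h ?g - ?g) < e / (2 * K)"
    using T_near_0[OF e', of ?g] by blast
  have first: "norm (T h x - x - h *\<^sub>R ?g) \<le> h * (e / (2 * K))" if "0 \<le> h" "h < d1" for h
  proof (cases "h = 0")
    case False
    hence "norm (T h x - x - h *\<^sub>R ?g) = h * norm ((T h x - x) /\<^sub>R h - ?g)"
      using that(1) norm_scaleR[of h "(T h x - x) /\<^sub>R h - ?g"] by (simp add: scaleR_diff_right)
    also have "\<dots> \<le> h * (e / (2 * K))"
      using d1(2)[of h] that False by (intro mult_left_mono) auto
    finally show ?thesis .
  qed simp
  show "\<exists>d>0. \<forall>y\<in>{0..}. norm (y - t) < d \<longrightarrow>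
    norm (T y x - T t x - (y - t) *\<^sub>R T t ?g) \<le> e * norm (y - t)"
  proof (intro exI[of _ "min d1 d2"] conjI ballI impI)
    fix y assume y: "y \<in> {0..}" "norm (y - t) < min d1 d2"
    show "norm (T y x - T t x - (y - t) *\<^sub>R T t ?g) \<le> e * norm (y - t)"
    proof (cases "t \<le> y")
      case True
      define h where "h = y - t"
      have h: "0 \<le> h" "h < d1" "y = t + h" and n: "norm (y - t) = h"
        using True y by (auto simp: h_def)
      have "T y x - T t x - h *\<^sub>R T t ?g = T t (T h x - x - h *\<^sub>R ?g)"
        unfolding h(3) by (simp add: T_add[OF t h(1)] T_diff[OF t] T_scaleR[OF t])
      hence "norm (T y x - T t x - h *\<^sub>R T t ?g) \<le> K * norm (T h x - x - h *\<^sub>R ?g)"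
        using K(2)[OF t] by simp
      also have "\<dots> \<le> K * (h * (e / (2 * K)))"
        using K(1) first[OF h(1,2)] by (intro mult_left_mono) auto
      also have "\<dots> = h * e / 2" using K(1) by simp
      also have "\<dots> \<le> e * norm (y - t)" using e h(1) unfolding n by simp
      finally show ?thesis by (simp add: h_def)
    next
      case False
      define h where "h = t - y"
      have h: "0 \<le> h" "h < d1" "h < d2" "t = y + h" "0 \<le> y" and n: "norm (y - t) = h"
        using False y by (auto simp: h_def)
      have "T y x - T t x + h *\<^sub>R T t ?g = T y (h *\<^sub>R (T h ?g - ?g) - (T h x - x - h *\<^sub>R ?g))"
        unfolding h(4)
        by (simp add: T_add[OF h(5,1)] T_diff[OF h(5)] T_scaleR[OF h(5)] scaleR_diff_right)
      hence "norm (T y x - T t x + h *\<^sub>R T t ?g) \<le>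
          K * norm (h *\<^sub>R (T h ?g - ?g) - (T h x - x - h *\<^sub>R ?g))"
        using K(2)[OF h(5), of "h *\<^sub>R (T h ?g - ?g) - (T h x - x - h *\<^sub>R ?g)"] False by simp
      also have "\<dots> \<le> K * (h * (e / (2 * K)) + h * (e / (2 * K)))"
      proof (rule mult_left_mono)
        have "norm (h *\<^sub>R (T h ?g - ?g)) \<le> h * (e / (2 * K))"
          using mult_left_mono[OF less_imp_le[OF d2(2)[OF h(1,3)]] h(1)] h(1) by simp
        thus "norm (h *\<^sub>R (T h ?g - ?g) - (T h x - x - h *\<^sub>R ?g))
          \<le> h * (e / (2 * K)) + h * (e / (2 * K))"
          by (rule order_trans[OF norm_triangle_ineq4 add_mono[OF _ first[OF h(1,2)]]])
      qed (use K in auto)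
      also have "\<dots> = e * norm (y - t)" using K(1) unfolding n by simp
      finally show ?thesis by (simp add: h_def algebra_simps)
    qed
  qed (use d1 d2 in auto)
qed

text \<open>
  The derivative of \<open>\<parallel>T t x\<parallel>\<^sup>2\<close> is \<open>2 Re \<langle>G T t x, T t x\<rangle> \<le> 0\<close>.
\<close>

lemma T_contraction_dom:
  assumes "x \<in> dom G" "t \<ge> 0"
  shows "norm (T t x) \<le> norm x"
proof -
  have "(norm (T t x))\<^sup>2 \<le> (norm (T 0 x))\<^sup>2"
  proof (rule nonincreasing_of_derivative[where f = "\<lambda>t. (norm (T t x))\<^sup>2" and a = 0 and b = t
        and f' = "\<lambda>t. 2 * inner (T t (the (G x))) (T t x)"])
    show "((\<lambda>t. (norm (T t x))\<^sup>2) has_real_derivative 2 * inner (T t (the (G x))) (T t x))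
        (at t within {0..})" if "t \<ge> 0" for t
      by (rule has_real_derivative_norm_square[OF T_derivative[OF assms(1) that]])
    show "2 * inner (T t (the (G x))) (T t x) \<le> 0" if "0 \<le> t" for t
      using diss[OF T_dom[OF assms(1) that]] generator_T[OF assms(1) that] by simp
  qed (use assms in auto)
  thus ?thesis by simp
qed

lemma T_contraction: "t \<ge> 0 \<Longrightarrow> norm (T t x) \<le> norm x"
proof -
  assume t: "t \<ge> 0"
  have "closed {x. norm (T t x) \<le> norm x}"
    by (intro closed_Collect_le continuous_intros linear_continuous_on[OF T_bl[OF t]])
  moreover have "dom G \<subseteq> {x. norm (T t x) \<le> norm x}" using T_contraction_dom[OF _ t] by blast
  ultimately have "closure (dom G) \<subseteq> {x. norm (T t x) \<le> norm x}" by (rule closure_minimal[rotated])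
  thus ?thesis using dense by blast
qed

end

section \<open>Generation of contraction semigroups\<close>

text \<open>
  The telescoping argument that turns a local error into a global one. As \<open>P\<close> and \<open>Q\<close> commute, the
  local error is needed only at the initial point \<open>x\<close>.
\<close>

lemma commuting_contraction_powers:
  fixes P Q :: "'a::real_normed_vector \<Rightarrow> 'a"
  assumes lin: "linear P" "linear Q" and contr: "\<And>x. norm (P x) \<le> norm x" "\<And>x. norm (Q x) \<le> norm x"
    and comm: "\<And>x. P (Q x) = Q (P x)"
  shows "norm ((P ^^ m) x - (Q ^^ m) x) \<le> real m * norm (P x - Q x)"
proof (induction m)
  case (Suc m)
  have Pm: "linear (P ^^ m)" for m
    using lin(1) by (induction m) (simp_all add: linear_id linear_compose)
  have Pc: "norm ((P ^^ m) x) \<le> norm x" for x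
    by (induction m) (auto intro: order_trans[OF contr(1)])
  have PQ: "(P ^^ m) (Q x) = Q ((P ^^ m) x)" for x
    by (induction m) (simp_all add: comm)
  have "(P ^^ Suc m) x - (Q ^^ Suc m) x = (P ^^ m) (P x - Q x) + Q ((P ^^ m) x - (Q ^^ m) x)"
    by (simp add: linear_diff[OF Pm] linear_diff[OF lin(2)] PQ funpow_swap1)
  also have "norm \<dots> \<le> norm (P x - Q x) + norm ((P ^^ m) x - (Q ^^ m) x)"
    by (rule order_trans[OF norm_triangle_ineq add_mono[OF Pc contr(2)]])
  also have "\<dots> \<le> real (Suc m) * norm (P x - Q x)"
    using Suc.IH by (simp add: algebra_simps)
  finally show ?case .
qed simp

lemma contraction_limit_dense:
  fixes f :: "'i \<Rightarrow> 'a::real_normed_vector \<Rightarrow> 'b::real_normed_vector"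
  assumes "closure S = UNIV" and "\<forall>\<^sub>F i in F. linear (f i) \<and> (\<forall>x. norm (f i x) \<le> norm x)"
    and "linear g" "\<And>x. norm (g x) \<le> norm x"
    and "\<And>x. x \<in> S \<Longrightarrow> ((\<lambda>i. f i x) \<longlongrightarrow> g x) F"
  shows "((\<lambda>i. f i x) \<longlongrightarrow> g x) F"
  unfolding tendsto_iff
proof (intro allI impI)
  fix e :: real assume e: "e > 0"
  have "x \<in> closure S" using assms(1) by simp
  then obtain y where y: "y \<in> S" "dist y x < e / 3"
    using e unfolding closure_approachable by (meson divide_pos_pos zero_less_numeral)
  have "\<forall>\<^sub>F i in F. dist (f i y) (g y) < e / 3"
    using assms(5)[OF y(1)] e unfolding tendsto_iff by (meson divide_pos_pos zero_less_numeral)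
  with assms(2) show "\<forall>\<^sub>F i in F. dist (f i x) (g x) < e"
  proof eventually_elim
    case (elim i)
    have "f i x - g x = f i (x - y) + (f i y - g y) + g (y - x)"
      using elim assms(3) by (simp add: linear_diff)
    also have "norm \<dots> \<le> norm (f i (x - y)) + norm (f i y - g y) + norm (g (y - x))"
      by (intro norm_triangle_le add_right_mono norm_triangle_ineq)
    also have "\<dots> < e"
    proof -
      have "norm (f i (x - y)) \<le> norm (x - y)" using elim by blast
      moreover have "norm (g (y - x)) \<le> norm (y - x)" by (rule assms(4))
      moreover have "norm (f i y - g y) < e / 3" using elim by (simp add: dist_norm)
      moreover have "norm (x - y) < e / 3" "norm (y - x) < e / 3"
        using y(2) by (simp_all add: dist_norm norm_minus_commute)
      ultimately show ?thesis by linarith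
    qed
    finally show ?case by (simp add: dist_norm)
  qed
qed

text \<open>
  The Lumer-Phillips situation. The semigroup is constructed as the limit of the implicit Euler
  method with \<open>2\<^sup>n\<close> steps, whose step operators \<open>J \<mu>\<close> are commuting contractions. Halving the step
  changes one step by \<open>O(\<mu>\<^sup>2)\<close> on the domain of the square of the generator, so that the
  approximations form a Cauchy sequence there, with geometric rate.
\<close>

locale m_dissipative =
  fixes G :: "'x::complex_hilbert \<rightharpoonup> 'x"
  assumes lin: "linear_op G" and dense: "closure (dom G) = UNIV"
    and diss: "\<And>x. x \<in> dom G \<Longrightarrow> inner (the (G x)) x \<le> 0"
    and range: "\<And>\<mu> y. \<mu> > 0 \<Longrightarrow> \<exists>x\<in>dom G. x - \<mu> *\<^sub>R the (G x) = y"
begin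

abbreviation g where "g x \<equiv> the (G x)"

lemmas g_simps = linear_opD[OF lin]
lemmas dom_closed = complex_vector.subspace_add[OF g_simps(1)] complex_vector.subspace_diff[OF g_simps(1)]
  complex_vector.subspace_scale[OF g_simps(1)] subspace_scale[OF csubspace_subspace[OF g_simps(1)]]

lemma resolvent_lower:
  assumes "x \<in> dom G" "\<mu> \<ge> 0"
  shows "norm x \<le> norm (x - \<mu> *\<^sub>R g x)"
proof -
  have "(norm x)\<^sup>2 \<le> inner (x - \<mu> *\<^sub>R g x) x"
    using diss[OF assms(1)] assms(2)
    by (simp add: inner_diff_left power2_norm_eq_inner mult_nonneg_nonpos)
  also have "\<dots> \<le> norm (x - \<mu> *\<^sub>R g x) * norm x" by (rule norm_cauchy_schwarz)
  finally show ?thesis by (cases "x = 0") (auto simp: power2_eq_square)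
qed

lemma resolvent_unique:
  assumes "x \<in> dom G" "y \<in> dom G" "\<mu> \<ge> 0" "x - \<mu> *\<^sub>R g x = y - \<mu> *\<^sub>R g y"
  shows "x = y"
proof -
  have "norm (x - y) \<le> norm ((x - y) - \<mu> *\<^sub>R g (x - y))"
    using assms by (intro resolvent_lower dom_closed)
  also have "(x - y) - \<mu> *\<^sub>R g (x - y) = 0"
    using assms by (simp add: g_simps scaleR_diff_right algebra_simps)
  finally show ?thesis by simp
qed

text \<open>
  The step \<open>\<mu> = 0\<close> is included with the value \<open>J 0 = id\<close>, which is not covered by the resolvent
  equation because its solutions lie in the domain of the generator.
\<close>

definition J :: "real \<Rightarrow> 'x \<Rightarrow> 'x"
  where "J \<mu> y = (if \<mu> = 0 then y else (SOME x. x \<in> dom G \<and> x - \<mu> *\<^sub>R g x = y))"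

lemma J_0 [simp]: "J 0 y = y"
  by (simp add: J_def)

lemma J:
  assumes "\<mu> > 0"
  shows "J \<mu> y \<in> dom G" "J \<mu> y - \<mu> *\<^sub>R g (J \<mu> y) = y"
  using someI_ex[of "\<lambda>x. x \<in> dom G \<and> x - \<mu> *\<^sub>R g x = y"] range[OF assms, of y] assms
  unfolding J_def by auto

lemma J_eqI: "\<mu> > 0 \<Longrightarrow> x \<in> dom G \<Longrightarrow> x - \<mu> *\<^sub>R g x = y \<Longrightarrow> J \<mu> y = x"
  using resolvent_unique[of "J \<mu> y" x \<mu>] J[of \<mu> y] by simp

lemma J_add: "\<mu> \<ge> 0 \<Longrightarrow> J \<mu> (x + y) = J \<mu> x + J \<mu> y"
proof (cases "\<mu> = 0")
  case False
  moreover assume "\<mu> \<ge> 0"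
  ultimately have \<mu>: "\<mu> > 0" by simp
  show ?thesis
  proof (rule J_eqI[OF \<mu>])
    have "J \<mu> x + J \<mu> y - \<mu> *\<^sub>R g (J \<mu> x + J \<mu> y) =
      (J \<mu> x - \<mu> *\<^sub>R g (J \<mu> x)) + (J \<mu> y - \<mu> *\<^sub>R g (J \<mu> y))"
      by (simp add: g_simps(2) J(1)[OF \<mu>] scaleR_add_right)
    thus "J \<mu> x + J \<mu> y - \<mu> *\<^sub>R g (J \<mu> x + J \<mu> y) = x + y" by (simp only: J(2)[OF \<mu>])
  qed (intro dom_closed J \<mu>)
qed simp

lemma J_scaleC: "\<mu> \<ge> 0 \<Longrightarrow> J \<mu> (c *\<^sub>C x) = c *\<^sub>C J \<mu> x"
proof (cases "\<mu> = 0")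
  case False
  moreover assume "\<mu> \<ge> 0"
  ultimately have \<mu>: "\<mu> > 0" by simp
  show ?thesis
  proof (rule J_eqI[OF \<mu>])
    have "c *\<^sub>C J \<mu> x - \<mu> *\<^sub>R g (c *\<^sub>C J \<mu> x) = c *\<^sub>C (J \<mu> x - \<mu> *\<^sub>R g (J \<mu> x))"
      by (simp add: g_simps(3) J(1)[OF \<mu>] complex_vector.scale_right_diff_distrib scaleC_scaleR)
    thus "c *\<^sub>C J \<mu> x - \<mu> *\<^sub>R g (c *\<^sub>C J \<mu> x) = c *\<^sub>C x" by (simp only: J(2)[OF \<mu>])
  qed (intro dom_closed J \<mu>)
qed simp

lemma J_linear: "\<mu> \<ge> 0 \<Longrightarrow> linear (J \<mu>)"
  by (rule linearI) (auto simp: J_add J_scaleC simp flip: scaleC_of_real)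

lemma J_contraction: "\<mu> \<ge> 0 \<Longrightarrow> norm (J \<mu> x) \<le> norm x"
  using resolvent_lower[of "J \<mu> x" \<mu>] J[of \<mu> x] by (cases "\<mu> = 0") auto

lemma g_J:
  assumes "\<mu> \<ge> 0" "x \<in> dom G"
  shows "g (J \<mu> x) = J \<mu> (g x)"
proof (cases "\<mu> = 0")
  case False
  with assms have \<mu>: "\<mu> > 0" by simp
  have "g (J \<mu> x) = (1 / \<mu>) *\<^sub>R (J \<mu> x - x)"
    using \<mu> by (subst (3) J(2)[OF \<mu>, of x, symmetric]) simp
  hence gd: "g (J \<mu> x) \<in> dom G" using J(1)[OF \<mu>] assms(2) by (simp add: dom_closed)
  have "g (J \<mu> x) - \<mu> *\<^sub>R g (g (J \<mu> x)) = g (J \<mu> x - \<mu> *\<^sub>R g (J \<mu> x))"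
    by (simp only: g_simps(4)[OF J(1)[OF \<mu>] dom_closed(4)[OF gd]] g_simps(5)[OF gd])
  hence "g (J \<mu> x) - \<mu> *\<^sub>R g (g (J \<mu> x)) = g x" by (simp only: J(2)[OF \<mu>])
  from J_eqI[OF \<mu> gd this] show ?thesis by simp
qed simp

lemma J_minus_id:
  assumes "\<mu> \<ge> 0" "x \<in> dom G"
  shows "J \<mu> x - x = \<mu> *\<^sub>R J \<mu> (g x)"
proof (cases "\<mu> = 0")
  case False
  with assms(1) have "J \<mu> x - \<mu> *\<^sub>R g (J \<mu> x) = x" using J(2)[of \<mu> x] by simp
  hence "J \<mu> x - x = \<mu> *\<^sub>R g (J \<mu> x)" by (metis diff_diff_eq2 add_diff_cancel_left' diff_add_cancel)
  thus ?thesis by (simp only: g_J[OF assms])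
qed simp

lemma J_commute:
  assumes "\<mu> \<ge> 0" "\<nu> \<ge> 0"
  shows "J \<mu> (J \<nu> y) = J \<nu> (J \<mu> y)"
proof (cases "\<mu> = 0 \<or> \<nu> = 0")
  case False
  with assms have p: "\<mu> > 0" "\<nu> > 0" by auto
  have gJ: "g (J \<nu> (J \<mu> y)) = J \<nu> (g (J \<mu> y))" by (rule g_J[OF assms(2) J(1)[OF p(1)]])
  have "J \<nu> (J \<mu> y) - \<mu> *\<^sub>R g (J \<nu> (J \<mu> y)) = J \<nu> (J \<mu> y - \<mu> *\<^sub>R g (J \<mu> y))"
    unfolding gJ using J_linear[OF assms(2)] by (simp add: linear_diff linear_scale)
  also have "\<dots> = J \<nu> y" by (simp only: J(2)[OF p(1)])
  finally show ?thesis by (rule J_eqI[OF p(1) J(1)[OF p(2)]])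
qed auto

definition dom2 :: "'x set"
  where "dom2 = {x \<in> dom G. g x \<in> dom G}"

lemma J_diff_le: "\<mu> \<ge> 0 \<Longrightarrow> x \<in> dom G \<Longrightarrow> norm (J \<mu> x - x) \<le> \<mu> * norm (g x)"
  unfolding J_minus_id by (simp add: J_contraction mult_left_mono)

lemma J_taylor_le:
  assumes "\<mu> \<ge> 0" "x \<in> dom2"
  shows "norm (J \<mu> x - x - \<mu> *\<^sub>R g x) \<le> \<mu>\<^sup>2 * norm (g (g x))"
proof -
  have x: "x \<in> dom G" "g x \<in> dom G" using assms(2) by (auto simp: dom2_def)
  have "J \<mu> x - x - \<mu> *\<^sub>R g x = \<mu> *\<^sub>R (J \<mu> (g x) - g x)"
    unfolding J_minus_id[OF assms(1) x(1)] by (simp add: scaleR_diff_right)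
  also have "norm \<dots> \<le> \<mu> * (\<mu> * norm (g (g x)))"
    using assms(1) J_diff_le[OF assms(1) x(2)] by (simp add: mult_left_mono)
  finally show ?thesis by (simp add: power2_eq_square mult.assoc)
qed

text \<open>
  Two consecutive steps of lengths \<open>a\<close> and \<open>b\<close> agree with one step of length \<open>a + b\<close> up to second
  order. The case \<open>a = b\<close> gives convergence, and the general case the semigroup law.
\<close>

lemma J_split_le:
  assumes "a \<ge> 0" "b \<ge> 0" "x \<in> dom2"
  shows "norm (J a (J b x) - J (a + b) x) \<le> 2 * (a + b)\<^sup>2 * norm (g (g x))"
proof -
  let ?n = "norm (g (g x))"
  have x: "x \<in> dom G" "g x \<in> dom G" using assms(3) by (auto simp: dom2_def)
  note linJ = J_linear[OF assms(1)]
  have "J a (J b x) - J (a + b) x =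
    J a (J b x - x - b *\<^sub>R g x) + ((J a x - x - a *\<^sub>R g x) +
      (b *\<^sub>R (J a (g x) - g x) - (J (a + b) x - x - (a + b) *\<^sub>R g x)))"
    by (simp add: linear_diff[OF linJ] linear_add[OF linJ] linear_scale[OF linJ] algebra_simps)
  also have "norm \<dots> \<le> b\<^sup>2 * ?n + (a\<^sup>2 * ?n + (b * (a * ?n) + (a + b)\<^sup>2 * ?n))"
  proof -
    have 1: "norm (J a (J b x - x - b *\<^sub>R g x)) \<le> b\<^sup>2 * ?n"
      by (rule order_trans[OF J_contraction[OF assms(1)] J_taylor_le[OF assms(2,3)]])
    have 2: "norm (J a x - x - a *\<^sub>R g x) \<le> a\<^sup>2 * ?n" by (rule J_taylor_le[OF assms(1,3)])
    have 3: "norm (b *\<^sub>R (J a (g x) - g x)) \<le> b * (a * ?n)"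
      using J_diff_le[OF assms(1) x(2)] assms(2) by (simp add: mult_left_mono)
    have 4: "norm (J (a + b) x - x - (a + b) *\<^sub>R g x) \<le> (a + b)\<^sup>2 * ?n"
      by (rule J_taylor_le) (use assms in auto)
    show ?thesis
      by (rule norm_triangle_le[OF add_mono[OF 1 norm_triangle_le[OF add_mono[OF 2
            norm_triangle_le_diff[OF add_mono[OF 3 4]]]]]])
  qed
  also have "\<dots> \<le> 2 * (a + b)\<^sup>2 * ?n"
  proof -
    have "0 \<le> a * b * ?n" using assms by simp
    thus ?thesis by (simp add: power2_eq_square algebra_simps)
  qed
  finally show ?thesis .
qed

lemma J_tendsto: "((\<lambda>\<mu>. J \<mu> y) \<longlongrightarrow> y) (at_right 0)"
proof (rule contraction_limit_dense[OF dense, where g = "\<lambda>x. x"])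
  show "\<forall>\<^sub>F \<mu> in at_right 0. linear (J \<mu>) \<and> (\<forall>x. norm (J \<mu> x) \<le> norm x)"
    using eventually_at_right_less[of "0::real"]
    by eventually_elim (simp add: J_linear J_contraction)
  fix x assume x: "x \<in> dom G"
  have "((\<lambda>\<mu>. J \<mu> x - x) \<longlongrightarrow> 0) (at_right 0)"
  proof (rule Lim_null_comparison)
    show "\<forall>\<^sub>F \<mu> in at_right 0. norm (J \<mu> x - x) \<le> \<mu> * norm (g x)"
      using eventually_at_right_less[of "0::real"]
      by eventually_elim (simp add: J_diff_le x)
    have "((\<lambda>\<mu>. \<mu> * norm (g x)) \<longlongrightarrow> 0 * norm (g x)) (at_right 0)" by (intro tendsto_intros)
    thus "((\<lambda>\<mu>. \<mu> * norm (g x)) \<longlongrightarrow> 0) (at_right 0)" by simp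
  qed
  thus "((\<lambda>\<mu>. J \<mu> x) \<longlongrightarrow> x) (at_right 0)" by (simp add: LIM_zero_iff)
qed (auto simp: linear_ident)

lemma J_dom2: "\<mu> > 0 \<Longrightarrow> x \<in> dom G \<Longrightarrow> J \<mu> x \<in> dom2"
  unfolding dom2_def using g_J[of \<mu> x] J(1)[of \<mu>] by auto

lemma dom2_dense: "closure dom2 = UNIV"
proof -
  have "dom G \<subseteq> closure dom2"
  proof
    fix x assume x: "x \<in> dom G"
    show "x \<in> closure dom2"
    proof (rule Lim_in_closed_set[OF closed_closure _ _ J_tendsto])
      show "\<forall>\<^sub>F \<mu> in at_right 0. J \<mu> x \<in> closure dom2"
        using eventually_at_right_less[of "0::real"]
        by eventually_elim (use J_dom2[OF _ x] closure_subset in blast)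
    qed simp
  qed
  thus ?thesis using closure_minimal[of "dom G" "closure dom2"] dense by auto
qed

text \<open>
  The implicit Euler approximation at time \<open>t\<close> with \<open>2\<^sup>n\<close> steps.
\<close>

definition E :: "nat \<Rightarrow> real \<Rightarrow> 'x \<Rightarrow> 'x"
  where "E n t = J (t / 2 ^ n) ^^ 2 ^ n"

lemma E_linear: "t \<ge> 0 \<Longrightarrow> linear (E n t)"
proof -
  assume "t \<ge> 0"
  have "linear (J (t / 2 ^ n) ^^ m)" for m
    using J_linear[of "t / 2 ^ n"] \<open>t \<ge> 0\<close> by (induction m) (simp_all add: linear_id linear_compose)
  thus ?thesis by (simp add: E_def)
qed

lemma E_contraction: "t \<ge> 0 \<Longrightarrow> norm (E n t x) \<le> norm x"
proof -
  assume "t \<ge> 0"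
  hence "norm ((J (t / 2 ^ n) ^^ m) x) \<le> norm x" for m
    by (induction m) (auto intro: order_trans[OF J_contraction])
  thus ?thesis by (simp add: E_def)
qed

lemma E_scaleC: "t \<ge> 0 \<Longrightarrow> E n t (c *\<^sub>C x) = c *\<^sub>C E n t x"
proof -
  assume "t \<ge> 0"
  hence "(J (t / 2 ^ n) ^^ m) (c *\<^sub>C x) = c *\<^sub>C (J (t / 2 ^ n) ^^ m) x" for m
    by (induction m) (auto simp: J_scaleC)
  thus ?thesis by (simp add: E_def)
qed

lemma E_step_le:
  assumes t: "t \<ge> 0" and x: "x \<in> dom2"
  shows "norm (E (Suc n) t x - E n t x) \<le> 2 * t\<^sup>2 * norm (g (g x)) * (1/2) ^ n"
proof -
  define h where "h = t / 2 ^ Suc n"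
  have h: "h \<ge> 0" "t / 2 ^ n = h + h" using t by (auto simp: h_def)
  have "E (Suc n) t = (J h ^^ 2) ^^ 2 ^ n"
    unfolding E_def h_def[symmetric] funpow_mult by (simp add: mult.commute)
  also have "J h ^^ 2 = (\<lambda>x. J h (J h x))" by (simp add: numeral_2_eq_2 fun_eq_iff)
  finally have "norm (E (Suc n) t x - E n t x) =
      norm (((\<lambda>x. J h (J h x)) ^^ 2 ^ n) x - (J (h + h) ^^ 2 ^ n) x)"
    by (simp add: E_def h)
  also have "\<dots> \<le> real (2 ^ n) * norm (J h (J h x) - J (h + h) x)"
  proof (rule commuting_contraction_powers)
    show "linear (\<lambda>x. J h (J h x))"
      using linear_compose[OF J_linear J_linear, OF h(1) h(1)] by (simp add: o_def)
    show "J h (J h (J (h + h) x)) = J (h + h) (J h (J h x))" for x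
      using J_commute[of h "h + h"] h by simp
    show "norm (J h (J h x)) \<le> norm x" for x
      by (rule order_trans[OF J_contraction J_contraction]) (use h in auto)
  qed (use h in \<open>auto simp: J_linear J_contraction\<close>)
  also have "\<dots> \<le> 2 ^ n * (2 * (h + h)\<^sup>2 * norm (g (g x)))"
    using J_split_le[OF h(1) h(1) x] by simp
  also have "\<dots> = 2 * t\<^sup>2 * norm (g (g x)) * (1/2) ^ n"
    unfolding h(2)[symmetric] by (simp add: power2_eq_square field_simps)
  finally show ?thesis .
qed

lemma E_convergent_dom2:
  assumes t: "t \<ge> 0" and x: "x \<in> dom2"
  shows "\<exists>l. (\<lambda>n. E n t x) \<longlonglongrightarrow> l \<and> norm (l - J t x) \<le> 4 * t\<^sup>2 * norm (g (g x))"
proof -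
  let ?d = "\<lambda>n. E (Suc n) t x - E n t x"
  let ?c = "2 * t\<^sup>2 * norm (g (g x))"
  have geo: "(\<lambda>n. ?c * (1/2) ^ n) sums (?c * 2)"
    using sums_mult[OF geometric_sums[of "1/2::real"], of ?c] by simp
  have sn: "summable (\<lambda>n. norm (?d n))"
    by (rule summable_comparison_test_ev[OF _ sums_summable[OF geo]])
      (use E_step_le[OF t x] in auto)
  hence "?d sums (\<Sum>n. ?d n)" by (rule summable_sums[OF summable_norm_cancel])
  hence "(\<lambda>n. (\<Sum>i<n. ?d i) + E 0 t x) \<longlonglongrightarrow> (\<Sum>n. ?d n) + E 0 t x"
    unfolding sums_def by (intro tendsto_intros)
  moreover have "(\<Sum>i<n. ?d i) = E n t x - E 0 t x" for n
    by (induction n) auto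
  moreover have "E 0 t x = J t x" by (simp add: E_def)
  moreover have "norm (\<Sum>n. ?d n) \<le> ?c * 2"
  proof -
    have "norm (\<Sum>n. ?d n) \<le> (\<Sum>n. norm (?d n))" by (rule summable_norm[OF sn])
    also have "\<dots> \<le> (\<Sum>n. ?c * (1/2) ^ n)"
      by (intro suminf_le E_step_le t x sn sums_summable[OF geo])
    also have "\<dots> = ?c * 2" using geo by (rule sums_unique[symmetric])
    finally show ?thesis .
  qed
  ultimately show ?thesis by (intro exI[of _ "(\<Sum>n. ?d n) + E 0 t x"]) simp
qed

lemma E_convergent: "t \<ge> 0 \<Longrightarrow> convergent (\<lambda>n. E n t x)"
proof (rule Cauchy_convergent, rule metric_CauchyI)
  fix e :: real assume t: "t \<ge> 0" and e: "e > 0"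
  have "x \<in> closure dom2" using dom2_dense by simp
  then obtain y where y: "y \<in> dom2" "dist y x < e / 3"
    using e unfolding closure_approachable by (meson divide_pos_pos zero_less_numeral)
  have "Cauchy (\<lambda>n. E n t y)" using E_convergent_dom2[OF t y(1)] LIMSEQ_imp_Cauchy by blast
  then obtain N where N: "\<And>i j. i \<ge> N \<Longrightarrow> j \<ge> N \<Longrightarrow> dist (E i t y) (E j t y) < e / 3"
    using e metric_CauchyD[of _ "e / 3"] by (metis divide_pos_pos zero_less_numeral)
  have close: "dist (E i t x) (E i t y) < e / 3" for i
    using E_contraction[OF t, of i "x - y"] y(2)
    by (simp add: linear_diff[OF E_linear[OF t]] dist_norm norm_minus_commute)
  have "dist (E i t x) (E j t x) < e" if "i \<ge> N" "j \<ge> N" for i j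
  proof -
    have "dist (E i t x) (E j t x) \<le>
      dist (E i t x) (E i t y) + (dist (E i t y) (E j t y) + dist (E j t y) (E j t x))"
      using dist_triangle[of "E i t x" "E j t x" "E i t y"]
        dist_triangle[of "E i t y" "E j t x" "E j t y"] by linarith
    thus ?thesis using close[of i] close[of j] N[OF that] by (simp add: dist_commute)
  qed
  thus "\<exists>N. \<forall>i\<ge>N. \<forall>j\<ge>N. dist (E i t x) (E j t x) < e" by blast
qed

definition U :: "real \<Rightarrow> 'x \<Rightarrow> 'x"
  where "U t x = lim (\<lambda>n. E n t x)"

lemma E_tendsto_U: "t \<ge> 0 \<Longrightarrow> (\<lambda>n. E n t x) \<longlonglongrightarrow> U t x"
  using E_convergent unfolding U_def by (simp add: convergent_LIMSEQ_iff)

lemma U_contraction: "t \<ge> 0 \<Longrightarrow> norm (U t x) \<le> norm x"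
  using LIMSEQ_le_const2[OF tendsto_norm[OF E_tendsto_U]] E_contraction by blast

lemma U_linear: "t \<ge> 0 \<Longrightarrow> linear (U t)"
proof (rule linearI)
  assume t: "t \<ge> 0"
  show "U t (x + y) = U t x + U t y" for x y
    using tendsto_add[OF E_tendsto_U[OF t, of x] E_tendsto_U[OF t, of y]] E_tendsto_U[OF t, of "x + y"]
    by (simp add: linear_add[OF E_linear[OF t]] LIMSEQ_unique)
  show "U t (r *\<^sub>R x) = r *\<^sub>R U t x" for r x
    using tendsto_scaleR[OF tendsto_const E_tendsto_U[OF t, of x]] E_tendsto_U[OF t, of "r *\<^sub>R x"]
    by (simp add: linear_scale[OF E_linear[OF t]] LIMSEQ_unique)
qed

lemma U_bounded_clinear: "t \<ge> 0 \<Longrightarrow> bounded_clinear (U t)"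
  unfolding bounded_clinear_def
proof (intro conjI allI)
  assume t: "t \<ge> 0"
  show "bounded_linear (U t)"
    using linear_add[OF U_linear[OF t]] linear_scale[OF U_linear[OF t]] U_contraction[OF t]
    by (intro bounded_linear_intro[where K = 1]) auto
  show "U t (c *\<^sub>C x) = c *\<^sub>C U t x" for c x
    using bounded_linear.tendsto[OF bounded_linear_scaleC E_tendsto_U[OF t, of x]]
      E_tendsto_U[OF t, of "c *\<^sub>C x"]
    by (simp add: E_scaleC[OF t] LIMSEQ_unique)
qed

lemma U_0: "U 0 x = x"
proof -
  have "E n 0 x = x" for n
  proof -
    have "(J 0 ^^ m) x = x" for m by (induction m) auto
    thus ?thesis by (simp add: E_def)
  qed
  thus ?thesis using E_tendsto_U[of 0 x] by (simp add: LIMSEQ_const_iff)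
qed

text \<open>
  Both sides are limits of Euler approximations whose step operators differ in second order.
\<close>

lemma U_add:
  assumes s: "s \<ge> 0" and t: "t \<ge> 0"
  shows "U (s + t) x = U s (U t x)"
proof (rule LIMSEQ_unique)
  have st: "s + t \<ge> 0" using s t by simp
  show "(\<lambda>n. E n s (E n t x)) \<longlonglongrightarrow> U s (U t x)"
  proof (rule Lim_transform[OF E_tendsto_U[OF s]])
    show "(\<lambda>n. E n s (E n t x) - E n s (U t x)) \<longlonglongrightarrow> 0"
    proof (rule Lim_null_comparison)
      show "\<forall>\<^sub>F n in sequentially. norm (E n s (E n t x) - E n s (U t x)) \<le> norm (E n t x - U t x)"
        using E_contraction[OF s] by (auto simp: linear_diff[OF E_linear[OF s], symmetric])
      show "(\<lambda>n. norm (E n t x - U t x)) \<longlonglongrightarrow> 0"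
        using E_tendsto_U[OF t, of x] by (simp add: LIM_zero tendsto_norm_zero)
    qed
  qed
  show "(\<lambda>n. E n s (E n t x)) \<longlonglongrightarrow> U (s + t) x"
  proof (rule contraction_limit_dense[OF dom2_dense,
        where f = "\<lambda>n x. E n s (E n t x)" and g = "U (s + t)"])
    show "\<forall>\<^sub>F n in sequentially. linear (\<lambda>x. E n s (E n t x)) \<and> (\<forall>x. norm (E n s (E n t x)) \<le> norm x)"
      using linear_compose[OF E_linear[OF t] E_linear[OF s]]
        order_trans[OF E_contraction[OF s] E_contraction[OF t]]
      by (auto simp: o_def)
    fix x assume x: "x \<in> dom2"
    show "(\<lambda>n. E n s (E n t x)) \<longlonglongrightarrow> U (s + t) x"
    proof (rule Lim_transform[OF E_tendsto_U[OF st]])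
      let ?c = "2 * (s + t)\<^sup>2 * norm (g (g x))"
      have le: "norm (E n (s + t) x - E n s (E n t x)) \<le> ?c * (1/2) ^ n" for n
      proof -
        define a b where "a = s / 2 ^ n" and "b = t / 2 ^ n"
        have ab: "a \<ge> 0" "b \<ge> 0" "(s + t) / 2 ^ n = a + b"
          using s t by (auto simp: a_def b_def add_divide_distrib)
        have "((\<lambda>x. J a (J b x)) ^^ m) y = (J a ^^ m) ((J b ^^ m) y)" for m y
        proof (induction m)
          case (Suc m)
          have "J b ((J a ^^ m) z) = (J a ^^ m) (J b z)" for z
            by (induction m) (simp_all add: J_commute[OF ab(2,1)])
          thus ?case using Suc by simp
        qed simp
        hence "norm (E n (s + t) x - E n s (E n t x)) =
            norm ((J (a + b) ^^ 2 ^ n) x - ((\<lambda>x. J a (J b x)) ^^ 2 ^ n) x)"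
          by (simp add: E_def ab(3) a_def b_def)
        also have "\<dots> \<le> real (2 ^ n) * norm (J (a + b) x - J a (J b x))"
        proof (rule commuting_contraction_powers)
          show "linear (\<lambda>x. J a (J b x))"
            using linear_compose[OF J_linear[OF ab(2)] J_linear[OF ab(1)]] by (simp add: o_def)
          show "J (a + b) (J a (J b x)) = J a (J b (J (a + b) x))" for x
            using J_commute[of "a + b" a] J_commute[of "a + b" b] ab by simp
          show "norm (J a (J b x)) \<le> norm x" for x
            by (rule order_trans[OF J_contraction J_contraction]) (use ab in auto)
        qed (use ab in \<open>auto simp: J_linear J_contraction\<close>)
        also have "\<dots> \<le> 2 ^ n * (2 * (a + b)\<^sup>2 * norm (g (g x)))"
          using J_split_le[OF ab(1,2) x] by (simp add: norm_minus_commute)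
        also have "\<dots> = ?c * (1/2) ^ n"
          unfolding ab(3)[symmetric] by (simp add: power2_eq_square field_simps)
        finally show ?thesis .
      qed
      have "(\<lambda>n. ?c * (1/2) ^ n) \<longlonglongrightarrow> ?c * 0"
        by (intro tendsto_intros LIMSEQ_power_zero) simp
      hence lim: "(\<lambda>n. ?c * (1/2) ^ n) \<longlonglongrightarrow> 0" by simp
      show "(\<lambda>n. E n s (E n t x) - E n (s + t) x) \<longlonglongrightarrow> 0"
      proof (rule Lim_null_comparison[OF always_eventually lim], rule allI)
        fix n show "norm (E n s (E n t x) - E n (s + t) x) \<le> ?c * (1/2) ^ n"
          unfolding norm_minus_commute[of "E n s (E n t x)"] by (rule le)
      qed
    qed
  qed (use U_linear[OF st] U_contraction[OF st] in auto)
qed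

lemma U_diff_le:
  assumes t: "t \<ge> 0" and x: "x \<in> dom G"
  shows "norm (U t x - x) \<le> t * norm (g x)"
proof (rule LIMSEQ_le_const2)
  show "(\<lambda>n. norm (E n t x - x)) \<longlonglongrightarrow> norm (U t x - x)"
    by (intro tendsto_intros E_tendsto_U t)
  have "norm (E n t x - x) \<le> t * norm (g x)" for n
  proof -
    have id: "((\<lambda>x::'x. x) ^^ m) x = x" for m by (induction m) auto
    have "norm (E n t x - x) \<le> real (2 ^ n) * norm (J (t / 2 ^ n) x - x)"
      using commuting_contraction_powers[of "J (t / 2 ^ n)" "\<lambda>x. x" "2 ^ n" x] t
      by (simp add: E_def id J_linear J_contraction linear_ident)
    also have "\<dots> \<le> 2 ^ n * ((t / 2 ^ n) * norm (g x))"
      using J_diff_le[of "t / 2 ^ n" x] t x by (intro mult_mono) auto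
    finally show ?thesis by simp
  qed
  thus "\<exists>N. \<forall>n\<ge>N. norm (E n t x - x) \<le> t * norm (g x)" by blast
qed

lemma U_taylor_le:
  assumes t: "t \<ge> 0" and x: "x \<in> dom2"
  shows "norm (U t x - x - t *\<^sub>R g x) \<le> 5 * t\<^sup>2 * norm (g (g x))"
proof -
  have "norm (U t x - J t x) \<le> 4 * t\<^sup>2 * norm (g (g x))"
    using E_convergent_dom2[OF t x] E_tendsto_U[OF t, of x] LIMSEQ_unique by blast
  moreover have "norm (J t x - x - t *\<^sub>R g x) \<le> t\<^sup>2 * norm (g (g x))" by (rule J_taylor_le[OF t x])
  moreover have eq: "U t x - x - t *\<^sub>R g x = (U t x - J t x) + (J t x - x - t *\<^sub>R g x)" by simp
  ultimately show ?thesis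
    unfolding eq using norm_triangle_ineq[of "U t x - J t x" "J t x - x - t *\<^sub>R g x"]
    by linarith
qed

lemma U_right_continuous: "((\<lambda>t. U t x) \<longlongrightarrow> x) (at_right 0)"
proof (rule contraction_limit_dense[OF dense, where g = "\<lambda>x. x"])
  show "\<forall>\<^sub>F t in at_right 0. linear (U t) \<and> (\<forall>x. norm (U t x) \<le> norm x)"
    using eventually_at_right_less[of "0::real"]
    by eventually_elim (simp add: U_linear U_contraction)
  fix x assume x: "x \<in> dom G"
  have "((\<lambda>t. U t x - x) \<longlongrightarrow> 0) (at_right 0)"
  proof (rule Lim_null_comparison)
    show "\<forall>\<^sub>F t in at_right 0. norm (U t x - x) \<le> t * norm (g x)"
      using eventually_at_right_less[of "0::real"]
      by eventually_elim (simp add: U_diff_le x)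
    have "((\<lambda>t. t * norm (g x)) \<longlongrightarrow> 0 * norm (g x)) (at_right 0)" by (intro tendsto_intros)
    thus "((\<lambda>t. t * norm (g x)) \<longlongrightarrow> 0) (at_right 0)" by simp
  qed
  thus "((\<lambda>t. U t x) \<longlongrightarrow> x) (at_right 0)" by (simp add: LIM_zero_iff)
qed (auto simp: linear_ident)

lemma U_semigroup: "C0_semigroup U"
  unfolding C0_semigroup_def
  using U_bounded_clinear U_0 U_add U_right_continuous by (auto simp: fun_eq_iff)

text \<open>
  The second-order expansion is available on the domain of \<open>G\<^sup>2\<close> only. A vector \<open>x\<close> of the domain of
  \<open>G\<close> is approximated by \<open>y = J \<mu> x\<close>, and the first-order bound on \<open>x - y\<close> costs no more than
  \<open>t \<parallel>G (x - y)\<parallel>\<close>, which is small relative to \<open>t\<close>.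
\<close>

lemma U_generates_on_dom:
  assumes x: "x \<in> dom G"
  shows "generator U x = Some (g x)"
  unfolding generator_eq_Some_iff tendsto_iff
proof (intro allI impI)
  fix e :: real assume e: "e > 0"
  have "\<forall>\<^sub>F \<mu> in at_right 0. dist (J \<mu> (g x)) (g x) < e / 4"
    using J_tendsto[of "g x"] e unfolding tendsto_iff by (meson divide_pos_pos zero_less_numeral)
  hence "\<forall>\<^sub>F \<mu> in at_right 0. 0 < \<mu> \<and> dist (J \<mu> (g x)) (g x) < e / 4"
    using eventually_at_right_less[of "0::real"] by eventually_elim simp
  then obtain \<mu> where \<mu>: "0 < \<mu>" "dist (J \<mu> (g x)) (g x) < e / 4"
    using eventually_happens'[OF trivial_limit_at_right_real] by blast
  define y where "y = J \<mu> x"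
  have y: "y \<in> dom2" "y \<in> dom G" "g y = J \<mu> (g x)"
    using J_dom2[OF \<mu>(1) x] J(1)[OF \<mu>(1)] g_J[of \<mu> x] x \<mu>(1) by (auto simp: y_def)
  define c where "c = norm (g (g y))"
  have "((\<lambda>t. 5 * t * c) \<longlongrightarrow> 5 * 0 * c) (at_right 0)" by (intro tendsto_intros)
  hence "\<forall>\<^sub>F t in at_right 0. 5 * t * c < e / 2"
    by (rule order_tendstoD) (use e in simp)
  with eventually_at_right_less[of "0::real"]
  show "\<forall>\<^sub>F t in at_right 0. dist ((U t x - x) /\<^sub>R t) (g x) < e"
  proof eventually_elim
    case (elim t)
    have xy: "x - y \<in> dom G" using x y by (intro dom_closed)
    have "norm (U t (x - y) - (x - y)) \<le> t * norm (g (x - y))"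
      using U_diff_le[OF _ xy, of t] elim by simp
    moreover have d: "norm (g (x - y)) < e / 4"
      using \<mu>(2) x y by (simp add: g_simps dist_norm norm_minus_commute)
    ultimately have 1: "norm (U t (x - y) - (x - y)) \<le> t * (e / 4)"
      using elim by (meson less_imp_le mult_left_mono order_trans)
    have 2: "norm (U t y - y - t *\<^sub>R g y) \<le> t * (5 * t * c)"
      using U_taylor_le[OF _ y(1), of t] elim by (simp add: c_def power2_eq_square ac_simps)
    have 3: "norm (t *\<^sub>R g (x - y)) \<le> t * (e / 4)"
      using d elim by simp
    have "U t x - x - t *\<^sub>R g x =
      (U t (x - y) - (x - y)) + ((U t y - y - t *\<^sub>R g y) - t *\<^sub>R g (x - y))"
      using x y elim by (simp add: g_simps linear_diff[OF U_linear] algebra_simps)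
    also have "norm \<dots> \<le> t * (e / 4) + (t * (5 * t * c) + t * (e / 4))"
      by (rule norm_triangle_le[OF add_mono[OF 1 norm_triangle_le_diff[OF add_mono[OF 2 3]]]])
    also have "\<dots> = t * (5 * t * c) + t * (e / 2)" by (simp add: algebra_simps)
    also have "\<dots> < t * (e / 2) + t * (e / 2)"
      by (rule add_strict_right_mono[OF mult_strict_left_mono]) (use elim in auto)
    also have "\<dots> = t * e" by simp
    finally have "norm (U t x - x - t *\<^sub>R g x) < t * e" .
    moreover have "(U t x - x) /\<^sub>R t - g x = (1 / t) *\<^sub>R (U t x - x - t *\<^sub>R g x)"
      using elim by (simp add: scaleR_diff_right inverse_eq_divide)
    ultimately show ?case using elim by (simp add: dist_norm divide_less_eq mult.commute)
  qed
qed

text \<open>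
  The generator of the limit semigroup extends \<open>G\<close> and is dissipative; since \<open>I - G\<close> is already
  surjective, the extension is not proper.
\<close>

theorem generation: "\<exists>T. C0_semigroup T \<and> generator T = G"
proof (intro exI conjI)
  show "C0_semigroup U" by (rule U_semigroup)
  show "generator U = G"
  proof
    fix x
    show "generator U x = G x"
    proof (cases "generator U x")
      case None
      thus ?thesis using U_generates_on_dom[of x] by (cases "G x") auto
    next
      case (Some l)
      hence l: "((\<lambda>t. (U t x - x) /\<^sub>R t) \<longlongrightarrow> l) (at_right 0)"
        by (simp add: generator_eq_Some_iff)
      obtain u where u: "u \<in> dom G" "u - 1 *\<^sub>R g u = x - l" using range[of 1 "x - l"] by auto
      have gu: "((\<lambda>t. (U t u - u) /\<^sub>R t) \<longlongrightarrow> g u) (at_right 0)"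
        using U_generates_on_dom[OF u(1)] by (simp add: generator_eq_Some_iff)
      define v where "v = x - u"
      have lim: "((\<lambda>t. inner ((U t x - x) /\<^sub>R t - (U t u - u) /\<^sub>R t) v) \<longlongrightarrow> inner (l - g u) v) (at_right 0)"
        by (intro tendsto_intros l gu)
      have "inner (l - g u) v \<le> 0"
      proof (rule tendsto_upperbound[OF lim])
        show "\<forall>\<^sub>F t in at_right 0. inner ((U t x - x) /\<^sub>R t - (U t u - u) /\<^sub>R t) v \<le> 0"
          using eventually_at_right_less[of "0::real"]
        proof eventually_elim
          case (elim t)
          have "(U t x - x) /\<^sub>R t - (U t u - u) /\<^sub>R t = (1 / t) *\<^sub>R (U t v - v)"
            using elim by (simp add: v_def linear_diff[OF U_linear] scaleR_diff_right field_simps)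
          moreover have "inner (U t v) v \<le> inner v v"
          proof -
            have "inner (U t v) v \<le> norm (U t v) * norm v" by (rule norm_cauchy_schwarz)
            also have "\<dots> \<le> norm v * norm v" using elim by (intro mult_right_mono U_contraction) auto
            finally show ?thesis by (simp add: power2_norm_eq_inner[symmetric] power2_eq_square)
          qed
          ultimately show ?case using elim by (simp add: inner_diff_left divide_nonpos_pos)
        qed
      qed simp
      moreover have "l - g u = v" using u(2) by (simp add: v_def algebra_simps)
      ultimately have "v = 0" by (metis inner_ge_zero inner_eq_zero_iff order_antisym)
      hence "x = u" by (simp add: v_def)
      with U_generates_on_dom[OF u(1)] Some u(1) show ?thesis by auto
    qed
  qed
qed

end

section \<open>The damped systems\<close>

lemma geometric_recursion_bound:
  fixes r :: "nat \<Rightarrow> real"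
  assumes rec: "\<And>n. r (Suc n) \<le> \<eta> * r n + d" and \<eta>: "0 \<le> \<eta>" "\<eta> < 1" and "0 \<le> d" "0 \<le> r 0"
  shows "r n \<le> r 0 + d / (1 - \<eta>)"
proof (induction n)
  case 0
  show ?case using assms by simp
next
  case (Suc n)
  have "r (Suc n) \<le> \<eta> * (r 0 + d / (1 - \<eta>)) + d"
    using rec[of n] mult_left_mono[OF Suc \<eta>(1)] by linarith
  also have "\<dots> = \<eta> * r 0 + d / (1 - \<eta>)"
    using \<eta> by (simp add: field_simps)
  also have "\<eta> * r 0 \<le> 1 * r 0" using assms by (intro mult_right_mono) auto
  finally show ?case by simp
qed

text \<open>
  The quantitative constants are parameters: \<open>m\<close> is the lower bound of \<open>A\<^sub>0\<close>, and \<open>b\<close> and \<open>\<beta>\<close>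
  bound \<open>C\<^sup>*C\<close> on \<open>X\<close> and on \<open>\<D>(A\<^sub>0)\<close>. All error constants below depend on
  these, on \<open>\<tau>\<close> and on \<open>\<eta>\<close> alone, so that they are visibly independent of the initial value and of
  the discretization. The undamped system is the instance \<open>C = 0\<close>.
\<close>

locale observed_system =
  fixes A0 :: "'x::complex_hilbert \<rightharpoonup> 'x" and C :: "'x \<Rightarrow> 'y::complex_hilbert" and m b \<beta> :: real
  assumes sa: "selfadjoint_op A0"
    and m: "m > 0" and coercive: "x \<in> dom A0 \<Longrightarrow> m * (norm x)\<^sup>2 \<le> inner (the (A0 x)) x"
    and C: "bounded_clinear C"
    and b: "b \<ge> 0" and norm_B_le: "norm (cadj C (C x)) \<le> b * norm x"
    and \<beta>: "\<beta> \<ge> 0" and B_dom: "x \<in> dom A0 \<Longrightarrow> cadj C (C x) \<in> dom A0"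
    and norm_aB_le: "x \<in> dom A0 \<Longrightarrow> norm (the (A0 (cadj C (C x)))) \<le> \<beta> * norm (the (A0 x))"
begin

abbreviation a where "a x \<equiv> the (A0 x)"

definition B where "B x = cadj C (C x)"

abbreviation T where "T \<equiv> observer_semigroup A0 C"

lemmas a_simps = linear_opD[OF selfadjoint_opD(1)[OF sa]]
lemmas a_dense = selfadjoint_opD(2)[OF sa]
lemmas dom_closed = complex_vector.subspace_add[OF a_simps(1)] complex_vector.subspace_diff[OF a_simps(1)]
  complex_vector.subspace_scale[OF a_simps(1)] subspace_scale[OF csubspace_subspace[OF a_simps(1)]]

lemma B_le: "norm (B x) \<le> b * norm x"
  and B_in_dom: "x \<in> dom A0 \<Longrightarrow> B x \<in> dom A0"
  and aB_le: "x \<in> dom A0 \<Longrightarrow> norm (a (B x)) \<le> \<beta> * norm (a x)"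
  unfolding B_def using norm_B_le B_dom norm_aB_le by auto

lemma B_bounded_clinear: "bounded_clinear B"
  using bounded_linear_compose[OF bounded_clinearD(1)[OF bounded_clinear_cadj[OF C]] bounded_clinearD(1)[OF C]]
    bounded_clinearD(2)[OF bounded_clinear_cadj[OF C]] bounded_clinearD(2)[OF C]
  unfolding bounded_clinear_def B_def[abs_def] by auto

lemma B_linear: "linear B"
  by (rule bounded_linear.linear[OF bounded_clinearD(1)[OF B_bounded_clinear]])

lemma B_symmetric: "cinner (B x) y = cinner x (B y)"
  unfolding B_def using cadj[OF C] by (metis cinner_commute)

lemma inner_B: "inner (B x) y = inner (C x) (C y)"
  unfolding B_def using cadj[OF C, of y "C x"] by (metis Re_cinner inner_commute)

lemma norm_le_norm_a:
  assumes "x \<in> dom A0"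
  shows "norm x \<le> norm (a x) / m"
proof -
  have "m * (norm x)\<^sup>2 \<le> norm (a x) * norm x"
    using coercive[OF assms] norm_cauchy_schwarz[of "a x" x] by linarith
  hence "m * norm x \<le> norm (a x)" by (cases "x = 0") (auto simp: power2_eq_square)
  thus ?thesis using m by (simp add: field_simps)
qed

definition dom2 where "dom2 = {x \<in> dom A0. a x \<in> dom A0}"

lemma dom2D: "x \<in> dom2 \<Longrightarrow> x \<in> dom A0" "x \<in> dom2 \<Longrightarrow> a x \<in> dom A0"
  by (auto simp: dom2_def)

lemma inner_imag_a:
  assumes "x \<in> dom A0" "Re s = 0"
  shows "inner (s *\<^sub>C a x) x = 0"
proof -
  have "Im (cinner (a x) x) = 0"
    using selfadjoint_op_symmetric[OF sa assms(1,1)] cinner_commute[of "a x" x]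
    by (metis add.inverse_neutral cnj.simps(2) equal_neg_zero)
  thus ?thesis using assms(2) by (simp add: Re_cinner[symmetric] cinner_scaleC_left)
qed

definition g :: "complex \<Rightarrow> 'x \<Rightarrow> 'x" where "g s x = s *\<^sub>C a x - B x"

lemma dom_observer_generator: "dom (observer_generator A0 C s) = dom A0"
  by (auto simp: observer_generator_def)

lemma the_observer_generator: "x \<in> dom A0 \<Longrightarrow> the (observer_generator A0 C s x) = g s x"
  by (auto simp: observer_generator_def g_def B_def)

lemma inner_g:
  assumes "x \<in> dom A0" "Re s = 0"
  shows "inner (g s x) x = - (norm (C x))\<^sup>2"
  using inner_imag_a[OF assms] by (simp add: g_def inner_diff_left inner_B power2_norm_eq_inner)

text \<open>
  \<open>sA\<^sub>0\<close> is skew and \<open>-C\<^sup>*C\<close> is dissipative. The resolvent equation is coercive with constant \<open>1\<close>,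
  for \<open>s\<close> as well as for its conjugate.
\<close>

lemma observer_generator_m_dissipative:
  assumes s: "Re s = 0" "cmod s = 1"
  shows "m_dissipative (observer_generator A0 C s)"
proof
  show "linear_op (observer_generator A0 C s)"
    unfolding linear_op_def dom_observer_generator
    using a_simps(1-3) dom_closed
    by (auto simp: the_observer_generator g_def linear_add[OF B_linear] scaleC_add_right
        bounded_clinearD(2)[OF B_bounded_clinear] scaleC_scaleC mult.commute
        complex_vector.scale_right_diff_distrib)
  show "closure (dom (observer_generator A0 C s)) = UNIV"
    unfolding dom_observer_generator by (rule a_dense)
  show "inner (the (observer_generator A0 C s x)) x \<le> 0" if "x \<in> dom (observer_generator A0 C s)" for x
    using that inner_g[OF _ s(1), of x] unfolding dom_observer_generator
    by (simp add: the_observer_generator)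
  fix \<mu> :: real and y assume \<mu>: "\<mu> > 0"
  have B': "bounded_clinear (\<lambda>x. x + \<mu> *\<^sub>R B x)"
    using B_bounded_clinear
    by (auto simp: bounded_clinear_def scaleC_add_right scaleC_scaleR intro!: bounded_linear_intros)
  have coer: "1 * (norm x)\<^sup>2 \<le> inner (c *\<^sub>C a x + (x + \<mu> *\<^sub>R B x)) x"
    if "x \<in> dom A0" "Re c = 0" for x c
    using inner_imag_a[OF that] \<mu> by (simp add: inner_add_left inner_B power2_norm_eq_inner)
  have "\<exists>x\<in>dom A0. (- of_real \<mu> * s) *\<^sub>C a x + (x + \<mu> *\<^sub>R B x) = y"
  proof (rule coercive_range[OF sa B', where l = 1])
    show "cinner (x + \<mu> *\<^sub>R B x) y = cinner x (y + \<mu> *\<^sub>R B y)" for x y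
      by (simp add: cinner_add_left cinner_add_right cinner_scaleR_left cinner_scaleR_right B_symmetric)
    show "1 * (norm x)\<^sup>2 \<le> inner ((- of_real \<mu> * s) *\<^sub>C a x + (x + \<mu> *\<^sub>R B x)) x"
      "1 * (norm x)\<^sup>2 \<le> inner (cnj (- of_real \<mu> * s) *\<^sub>C a x + (x + \<mu> *\<^sub>R B x)) x"
      if "x \<in> dom A0" for x
      by (rule coer[OF that], use s in simp)+
  qed (use s \<mu> in auto)
  moreover have "(- of_real \<mu> * s) *\<^sub>C a x + (x + \<mu> *\<^sub>R B x) =
      x - \<mu> *\<^sub>R the (observer_generator A0 C s x)" if "x \<in> dom A0" for x
  proof -
    have "(- of_real \<mu> * s) *\<^sub>C a x = - (\<mu> *\<^sub>R (s *\<^sub>C a x))"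
      by (simp add: scaleC_of_real[symmetric] scaleC_scaleC)
    thus ?thesis using that by (simp add: the_observer_generator g_def scaleR_diff_right)
  qed
  ultimately show "\<exists>x\<in>dom (observer_generator A0 C s).
      x - \<mu> *\<^sub>R the (observer_generator A0 C s x) = y"
    unfolding dom_observer_generator by metis
qed

lemma observer_semigroup:
  assumes s: "Re s = 0" "cmod s = 1"
  shows "dissipative_semigroup (T s) (observer_generator A0 C s)"
proof -
  interpret md: m_dissipative "observer_generator A0 C s"
    by (rule observer_generator_m_dissipative[OF s])
  have "C0_semigroup (T s) \<and> generator (T s) = observer_generator A0 C s"
    unfolding observer_semigroup_def generated_semigroup_def by (rule someI_ex[OF md.generation])
  thus ?thesis by unfold_locales (auto simp: md.dense md.diss)
qed

context
  fixes s :: complex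
  assumes s: "Re s = 0" "cmod s = 1"
begin

interpretation ds: dissipative_semigroup "T s" "observer_generator A0 C s"
  by (rule observer_semigroup[OF s])

lemma T_0: "T s 0 x = x" by simp

lemma T_linear: "t \<ge> 0 \<Longrightarrow> linear (T s t)"
  and T_bounded_linear: "t \<ge> 0 \<Longrightarrow> bounded_linear (T s t)"
  and T_scaleC: "t \<ge> 0 \<Longrightarrow> T s t (c *\<^sub>C x) = c *\<^sub>C T s t x"
  and T_contraction: "t \<ge> 0 \<Longrightarrow> norm (T s t x) \<le> norm x"
  using ds.T_bl bounded_linear.linear ds.T_scaleC ds.T_contraction by blast+

lemma T_dom: "x \<in> dom A0 \<Longrightarrow> t \<ge> 0 \<Longrightarrow> T s t x \<in> dom A0"
  using ds.T_dom unfolding dom_observer_generator .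

lemma g_T: "x \<in> dom A0 \<Longrightarrow> t \<ge> 0 \<Longrightarrow> g s (T s t x) = T s t (g s x)"
  using ds.generator_T[of x t] the_observer_generator[of x s]
    the_observer_generator[OF T_dom, of x t s]
  unfolding dom_observer_generator by (metis option.sel)

lemma T_derivative:
  "x \<in> dom A0 \<Longrightarrow> t \<ge> 0 \<Longrightarrow>
    ((\<lambda>t. T s t x) has_vector_derivative T s t (g s x)) (at t within {0..})"
  using ds.T_derivative[of x t] the_observer_generator[of x s]
  unfolding dom_observer_generator by simp

lemma T_Lipschitz:
  assumes x: "x \<in> dom A0" and t: "t \<ge> 0" "u \<ge> 0"
  shows "norm (T s t x - T s u x) \<le> norm (g s x) * \<bar>t - u\<bar>"
proof -
  have "norm (T s t x - T s u x) \<le> norm (g s x) * norm (t - u)"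
  proof (rule differentiable_bound[of "{0..}"])
    show "((\<lambda>t. T s t x) has_derivative (\<lambda>h. h *\<^sub>R T s t (g s x))) (at t within {0..})"
      if "t \<in> {0..}" for t
      using T_derivative[OF x] that by (simp add: has_vector_derivative_def)
    show "onorm (\<lambda>h. h *\<^sub>R T s t (g s x)) \<le> norm (g s x)" if "t \<in> {0..}" for t
      using T_contraction[of t "g s x"] that by (intro onorm_le) (simp add: mult_left_mono mult.commute)
  qed (use t in auto)
  thus ?thesis by simp
qed

lemma s_cancel: "cnj s * s = 1"
  using s complex_norm_square[of s] by (simp add: mult.commute)

lemma a_eq_g: "a x = cnj s *\<^sub>C (g s x + B x)"
  by (simp add: g_def s_cancel)

lemma norm_g_le: "x \<in> dom A0 \<Longrightarrow> norm (g s x) \<le> (1 + b / m) * norm (a x)"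
proof -
  assume x: "x \<in> dom A0"
  have "norm (g s x) \<le> norm (a x) + b * norm x"
    using norm_triangle_ineq4[of "s *\<^sub>C a x" "B x"] B_le[of x] s by (simp add: g_def)
  also have "b * norm x \<le> b * (norm (a x) / m)" by (intro mult_left_mono norm_le_norm_a x b)
  finally show ?thesis by (simp add: algebra_simps)
qed

lemma g_dom: "x \<in> dom2 \<Longrightarrow> g s x \<in> dom A0"
  unfolding g_def by (intro dom_closed B_in_dom dom2D)

lemma T_dom2:
  assumes x: "x \<in> dom2" and t: "t \<ge> 0"
  shows "T s t x \<in> dom2"
proof -
  note d = T_dom[OF dom2D(1)[OF x] t]
  have "a (T s t x) = cnj s *\<^sub>C (T s t (g s x) + B (T s t x))"
    using a_eq_g[of "T s t x"] g_T[OF dom2D(1)[OF x] t] by simp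
  also have "\<dots> \<in> dom A0" by (intro dom_closed T_dom[OF g_dom] B_in_dom d x t)
  finally show ?thesis using d by (simp add: dom2_def)
qed

text \<open>
  The commutator of \<open>A\<^sub>0\<close> with the semigroup. It is bounded although \<open>A\<^sub>0\<close> is not, because the
  semigroup commutes with \<open>sA\<^sub>0 - C\<^sup>*C\<close>; the factor \<open>cnj s\<close> is the inverse of \<open>s\<close>.
\<close>

definition defect :: "real \<Rightarrow> 'x \<Rightarrow> 'x"
  where "defect t x = cnj s *\<^sub>C (B (T s t x) - T s t (B x))"

lemma a_T:
  assumes x: "x \<in> dom A0" and t: "t \<ge> 0"
  shows "a (T s t x) = T s t (a x) + defect t x"
proof -
  have "a (T s t x) = cnj s *\<^sub>C (T s t (s *\<^sub>C a x - B x) + B (T s t x))"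
    using a_eq_g[of "T s t x"] unfolding g_T[OF x t] unfolding g_def .
  thus ?thesis
    by (simp add: defect_def linear_diff[OF T_linear[OF t]] T_scaleC[OF t] scaleC_add_right
        complex_vector.scale_right_diff_distrib s_cancel)
qed

lemma norm_defect_le:
  assumes t: "t \<ge> 0"
  shows "norm (defect t x) \<le> 2 * b * norm x"
proof -
  have "norm (defect t x) \<le> norm (B (T s t x)) + norm (T s t (B x))"
    using norm_triangle_ineq4 s by (simp add: defect_def)
  also have "norm (T s t (B x)) \<le> b * norm x" by (rule order_trans[OF T_contraction[OF t] B_le])
  also have "norm (B (T s t x)) \<le> b * norm x"
    using order_trans[OF B_le mult_left_mono[OF T_contraction[OF t] b]] .
  finally show ?thesis by simp
qed

lemma norm_a_T_le:
  assumes x: "x \<in> dom A0" and t: "t \<ge> 0"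
  shows "norm (a (T s t x)) \<le> (1 + 2 * b / m) * norm (a x)"
proof -
  have "norm (a (T s t x)) \<le> norm (a x) + 2 * b * norm x"
    unfolding a_T[OF x t]
    by (rule norm_triangle_le[OF add_mono[OF T_contraction[OF t] norm_defect_le[OF t]]])
  also have "2 * b * norm x \<le> 2 * b * (norm (a x) / m)"
    using b by (intro mult_left_mono norm_le_norm_a x) auto
  finally show ?thesis by (simp add: algebra_simps)
qed

lemma defect_dom: "x \<in> dom A0 \<Longrightarrow> t \<ge> 0 \<Longrightarrow> defect t x \<in> dom A0"
  unfolding defect_def by (intro dom_closed B_in_dom T_dom)

lemma norm_a_defect_le:
  assumes x: "x \<in> dom A0" and t: "t \<ge> 0"
  shows "norm (a (defect t x)) \<le> 2 * \<beta> * (1 + 2 * b / m) * norm (a x)"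
proof -
  let ?\<gamma> = "1 + 2 * b / m"
  have \<gamma>: "?\<gamma> \<ge> 0" using b m by simp
  note d = T_dom[OF x t] T_dom[OF B_in_dom[OF x] t] B_in_dom[OF T_dom[OF x t]]
  have "a (defect t x) = cnj s *\<^sub>C (a (B (T s t x)) - a (T s t (B x)))"
    unfolding defect_def using d by (simp only: a_simps dom_closed)
  hence "norm (a (defect t x)) \<le> norm (a (B (T s t x))) + norm (a (T s t (B x)))"
    using norm_triangle_ineq4 s by simp
  also have "norm (a (B (T s t x))) \<le> \<beta> * (?\<gamma> * norm (a x))"
    by (rule order_trans[OF aB_le[OF d(1)] mult_left_mono[OF norm_a_T_le[OF x t] \<beta>]])
  also have "norm (a (T s t (B x))) \<le> ?\<gamma> * (\<beta> * norm (a x))"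
    by (rule order_trans[OF norm_a_T_le[OF B_in_dom[OF x] t] mult_left_mono[OF aB_le[OF x] \<gamma>]])
  finally show ?thesis by (simp add: algebra_simps)
qed

end

section \<open>Regular trajectories\<close>

text \<open>
  The regularity that makes the scheme consistent of first order: \<open>\<Lambda>\<close> controls the second time
  derivative of \<open>q\<close>, as the Lipschitz constant of \<open>q'\<close>, and the \<open>A\<^sub>0\<close>-norm of \<open>q\<close> and of its
  difference quotients. It is stable under differences and time reversal, so that
  the trajectories of the observers need no separate analysis.
\<close>

definition regular_path :: "real \<Rightarrow> (real \<Rightarrow> 'x) \<Rightarrow> (real \<Rightarrow> 'x) \<Rightarrow> real \<Rightarrow> bool"
  where "regular_path \<tau> q dq \<Lambda> \<longleftrightarrow> (\<forall>t\<in>{0..\<tau>}. q t \<in> dom A0 \<and>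
    (q has_vector_derivative dq t) (at t within {0..\<tau>}) \<and> norm (a (q t)) \<le> \<Lambda> \<and>
    (\<forall>u\<in>{0..\<tau>}. norm (dq t - dq u) \<le> \<Lambda> * \<bar>t - u\<bar> \<and>
      norm (a (q t) - a (q u)) \<le> \<Lambda> * \<bar>t - u\<bar>))"

lemma regular_path_diff:
  assumes "regular_path \<tau> q dq \<Lambda>" "regular_path \<tau> p dp \<Lambda>'"
  shows "regular_path \<tau> (\<lambda>t. q t - p t) (\<lambda>t. dq t - dp t) (\<Lambda> + \<Lambda>')"
  unfolding regular_path_def
proof (intro ballI conjI)
  fix t assume t: "t \<in> {0..\<tau>}"
  note q = assms(1)[unfolded regular_path_def, rule_format] and p = assms(2)[unfolded regular_path_def, rule_format]
  have dom: "q u \<in> dom A0" "p u \<in> dom A0" if "u \<in> {0..\<tau>}" for u using q p that by blast+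
  show "q t - p t \<in> dom A0" using dom[OF t] by (rule dom_closed)
  show "((\<lambda>t. q t - p t) has_vector_derivative dq t - dp t) (at t within {0..\<tau>})"
    using q[OF t] p[OF t] by (intro has_vector_derivative_diff) auto
  show "norm (a (q t - p t)) \<le> \<Lambda> + \<Lambda>'"
    unfolding a_simps(4)[OF dom[OF t]]
    by (rule norm_triangle_le_diff[OF add_mono]) (use q[OF t] p[OF t] in auto)
  fix u assume u: "u \<in> {0..\<tau>}"
  have "(dq t - dp t) - (dq u - dp u) = (dq t - dq u) - (dp t - dp u)" by simp
  also have "norm \<dots> \<le> \<Lambda> * \<bar>t - u\<bar> + \<Lambda>' * \<bar>t - u\<bar>"
    by (rule norm_triangle_le_diff[OF add_mono]) (use q[OF t] p[OF t] u in auto)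
  finally show "norm ((dq t - dp t) - (dq u - dp u)) \<le> (\<Lambda> + \<Lambda>') * \<bar>t - u\<bar>" by (simp add: distrib_right)
  have "a (q t - p t) - a (q u - p u) = (a (q t) - a (q u)) - (a (p t) - a (p u))"
    using dom[OF t] dom[OF u] by (simp add: a_simps(4))
  also have "norm \<dots> \<le> \<Lambda> * \<bar>t - u\<bar> + \<Lambda>' * \<bar>t - u\<bar>"
    by (rule norm_triangle_le_diff[OF add_mono]) (use q[OF t] p[OF t] u in auto)
  finally show "norm (a (q t - p t) - a (q u - p u)) \<le> (\<Lambda> + \<Lambda>') * \<bar>t - u\<bar>"
    by (simp add: distrib_right)
qed

lemma regular_path_reverse:
  assumes "regular_path \<tau> q dq \<Lambda>"
  shows "regular_path \<tau> (\<lambda>t. q (\<tau> - t)) (\<lambda>t. - dq (\<tau> - t)) \<Lambda>"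
  unfolding regular_path_def
proof (intro ballI conjI)
  fix t assume t: "t \<in> {0..\<tau>}"
  hence t': "\<tau> - t \<in> {0..\<tau>}" by simp
  note q = assms(1)[unfolded regular_path_def, rule_format]
  show "q (\<tau> - t) \<in> dom A0" "norm (a (q (\<tau> - t))) \<le> \<Lambda>" using q[OF t'] by auto
  have "((q \<circ> (\<lambda>t. \<tau> - t)) has_vector_derivative (- 1) *\<^sub>R dq (\<tau> - t)) (at t within {0..\<tau>})"
  proof (rule vector_diff_chain_within)
    show "((\<lambda>t. \<tau> - t) has_vector_derivative - 1) (at t within {0..\<tau>})"
      by (auto intro!: derivative_eq_intros)
    have "(\<lambda>t. \<tau> - t) ` {0..\<tau>} = {0..\<tau>}" by (auto simp: image_iff intro!: bexI[of _ "\<tau> - _"])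
    thus "(q has_vector_derivative dq (\<tau> - t)) (at (\<tau> - t) within (\<lambda>t. \<tau> - t) ` {0..\<tau>})"
      using q[OF t'] by simp
  qed
  thus "((\<lambda>t. q (\<tau> - t)) has_vector_derivative - dq (\<tau> - t)) (at t within {0..\<tau>})"
    by (simp add: o_def)
  fix u assume u: "u \<in> {0..\<tau>}"
  hence u': "\<tau> - u \<in> {0..\<tau>}" by simp
  have "\<bar>(\<tau> - t) - (\<tau> - u)\<bar> = \<bar>t - u\<bar>" by simp
  thus "norm (- dq (\<tau> - t) - - dq (\<tau> - u)) \<le> \<Lambda> * \<bar>t - u\<bar>"
    and "norm (a (q (\<tau> - t)) - a (q (\<tau> - u))) \<le> \<Lambda> * \<bar>t - u\<bar>"
    using q[OF t'] u' by (metis minus_diff_minus norm_minus_cancel)+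
qed

definition \<kappa> :: real
  where "\<kappa> = (1 + b / m) * (1 + \<beta> / m) + (1 + b / m) * b / m + (1 + b / m) / m + b / m\<^sup>2"

lemma \<kappa>_pos: "\<kappa> > 0"
proof -
  have "1 * 1 \<le> (1 + b / m) * (1 + \<beta> / m)" using b \<beta> m by (intro mult_mono) auto
  thus ?thesis unfolding \<kappa>_def using b \<beta> m by (intro add_pos_nonneg) auto
qed

text \<open>
  For \<open>x\<close> in \<open>\<D>(A\<^sub>0\<^sup>2)\<close> the derivative \<open>T (G x)\<close> is Lipschitz with constant \<open>\<parallel>G\<^sup>2 x\<parallel>\<close>, and \<open>A\<^sub>0\<close> is expressed
  by \<open>G\<close> and \<open>C\<^sup>*C\<close>. As \<open>C\<^sup>*C\<close> is bounded on \<open>\<D>(A\<^sub>0)\<close>, the graph norm of \<open>G\<^sup>2\<close> is bounded by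
  \<open>\<parallel>A\<^sub>0\<^sup>2 x\<parallel>\<close>; \<open>\<kappa>\<close> collects the constants.
\<close>

lemma regular_path_T:
  assumes s: "Re s = 0" "cmod s = 1" and x: "x \<in> dom2"
  shows "regular_path \<tau> (\<lambda>t. T s t x) (\<lambda>t. T s t (g s x)) (\<kappa> * norm (a (a x)))"
proof -
  let ?n = "norm (a (a x))" and ?c = "1 + b / m"
  note xd = dom2D[OF x]
  have pos: "?c \<ge> 0" "b / m \<ge> 0" "1 / m \<ge> 0" "1 + \<beta> / m \<ge> 0" using b m \<beta> by auto
  have ax: "norm (a x) \<le> ?n / m" by (rule norm_le_norm_a[OF xd(2)])
  have gx: "norm (g s x) \<le> ?c * (?n / m)"
    by (rule order_trans[OF norm_g_le[OF s xd(1)] mult_left_mono[OF ax pos(1)]])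
  have xx: "norm x \<le> ?n / m\<^sup>2"
    using order_trans[OF norm_le_norm_a[OF xd(1)] divide_right_mono[OF ax]] m
    by (simp add: power2_eq_square)
  have "a (g s x) = s *\<^sub>C a (a x) - a (B x)"
    unfolding g_def using xd by (simp only: a_simps dom_closed B_in_dom)
  hence "norm (a (g s x)) \<le> ?n + \<beta> * norm (a x)"
    using norm_triangle_ineq4[of "s *\<^sub>C a (a x)" "a (B x)"] aB_le[OF xd(1)] s by simp
  also have "\<dots> \<le> ?n + \<beta> * (?n / m)" by (intro add_left_mono mult_left_mono ax \<beta>)
  finally have "norm (a (g s x)) \<le> (1 + \<beta> / m) * ?n" by (simp add: algebra_simps)
  hence ggx: "norm (g s (g s x)) \<le> ?c * (1 + \<beta> / m) * ?n"
    using order_trans[OF norm_g_le[OF s g_dom[OF s x]] mult_left_mono[OF _ pos(1)]]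
    by (simp only: mult.assoc)
  have \<kappa>1: "?c * (1 + \<beta> / m) * ?n + b * (?c * (?n / m)) \<le> \<kappa> * ?n"
    and \<kappa>2: "?c * (?n / m) + b * (?n / m\<^sup>2) \<le> \<kappa> * ?n"
    and \<kappa>3: "?c * (1 + \<beta> / m) * ?n \<le> \<kappa> * ?n"
  proof -
    have aux: "X + Y \<le> X + Y + Z + W \<and> Z + W \<le> X + Y + Z + W \<and> X \<le> X + Y + Z + W"
      if "0 \<le> X" "0 \<le> Y" "0 \<le> Z" "0 \<le> W" for X Y Z W :: real
      using that by simp
    have p: "0 \<le> ?c * (1 + \<beta> / m) * ?n" "0 \<le> ?c * b / m * ?n" "0 \<le> ?c / m * ?n" "0 \<le> b / m\<^sup>2 * ?n"
      using pos b m \<beta> by auto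
    have eq: "\<kappa> * ?n = ?c * (1 + \<beta> / m) * ?n + ?c * b / m * ?n + ?c / m * ?n + b / m\<^sup>2 * ?n"
      by (simp only: \<kappa>_def distrib_right)
    have r: "b * (?c * (?n / m)) = ?c * b / m * ?n" "?c * (?n / m) = ?c / m * ?n"
      "b * (?n / m\<^sup>2) = b / m\<^sup>2 * ?n" by simp_all
    show "?c * (1 + \<beta> / m) * ?n + b * (?c * (?n / m)) \<le> \<kappa> * ?n"
      unfolding eq r(1) using aux[OF p] by blast
    show "?c * (?n / m) + b * (?n / m\<^sup>2) \<le> \<kappa> * ?n"
      unfolding eq r(2,3) using aux[OF p] by blast
    show "?c * (1 + \<beta> / m) * ?n \<le> \<kappa> * ?n"
      unfolding eq using aux[OF p] by blast
  qed
  show ?thesis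
    unfolding regular_path_def
  proof (intro ballI conjI)
    fix t assume "t \<in> {0..\<tau>}"
    hence t: "t \<ge> 0" by simp
    show "T s t x \<in> dom A0" by (rule T_dom[OF s xd(1) t])
    show "((\<lambda>t. T s t x) has_vector_derivative T s t (g s x)) (at t within {0..\<tau>})"
      using T_derivative[OF s xd(1) t] by (rule has_vector_derivative_within_subset) auto
    have aT: "a (T s u x) = cnj s *\<^sub>C (T s u (g s x) + B (T s u x))" if "u \<ge> 0" for u
      using a_eq_g[OF s, of "T s u x"] g_T[OF s xd(1) that] by simp
    have "norm (a (T s t x)) \<le> norm (T s t (g s x)) + norm (B (T s t x))"
      unfolding aT[OF t] using norm_triangle_ineq s by simp
    also have "\<dots> \<le> ?c * (?n / m) + b * (?n / m\<^sup>2)"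
      using order_trans[OF T_contraction[OF s t] gx]
        order_trans[OF B_le mult_left_mono[OF order_trans[OF T_contraction[OF s t] xx] b]]
      by (rule add_mono)
    finally show "norm (a (T s t x)) \<le> \<kappa> * ?n" using \<kappa>2 by linarith
    fix u assume "u \<in> {0..\<tau>}"
    hence u: "u \<ge> 0" by simp
    have l2: "norm (T s t (g s x) - T s u (g s x)) \<le> ?c * (1 + \<beta> / m) * ?n * \<bar>t - u\<bar>"
      by (rule order_trans[OF T_Lipschitz[OF s g_dom[OF s x] t u] mult_right_mono[OF ggx]]) simp
    thus "norm (T s t (g s x) - T s u (g s x)) \<le> \<kappa> * ?n * \<bar>t - u\<bar>"
      using mult_right_mono[OF \<kappa>3, of "\<bar>t - u\<bar>"] by simp
    have l1: "norm (B (T s t x) - B (T s u x)) \<le> b * (?c * (?n / m) * \<bar>t - u\<bar>)"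
      unfolding linear_diff[OF B_linear, symmetric]
      by (rule order_trans[OF B_le mult_left_mono[OF order_trans[OF T_Lipschitz[OF s xd(1) t u]
            mult_right_mono[OF gx]] b]]) simp
    have "a (T s t x) - a (T s u x) =
      cnj s *\<^sub>C ((T s t (g s x) - T s u (g s x)) + (B (T s t x) - B (T s u x)))"
      unfolding aT[OF t] aT[OF u] by (simp flip: complex_vector.scale_right_diff_distrib)
    hence "norm (a (T s t x) - a (T s u x)) \<le>
        norm (T s t (g s x) - T s u (g s x)) + norm (B (T s t x) - B (T s u x))"
      using norm_triangle_ineq s by simp
    also have "\<dots> \<le> ?c * (1 + \<beta> / m) * ?n * \<bar>t - u\<bar> + b * (?c * (?n / m) * \<bar>t - u\<bar>)"
      by (rule add_mono[OF l2 l1])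
    also have "\<dots> = (?c * (1 + \<beta> / m) * ?n + b * (?c * (?n / m))) * \<bar>t - u\<bar>"
      by (simp only: distrib_right mult.assoc)
    also have "\<dots> \<le> \<kappa> * ?n * \<bar>t - u\<bar>" by (intro mult_right_mono \<kappa>1) simp
    finally show "norm (a (T s t x) - a (T s u x)) \<le> \<kappa> * ?n * \<bar>t - u\<bar>" .
  qed
qed

section \<open>Powers of the back-and-forth operator\<close>

context
  fixes \<tau> :: real
  assumes \<tau>: "\<tau> > 0"
begin

abbreviation L where "L \<equiv> back_and_forth A0 C \<tau>"

lemma imag: "Re \<i> = 0" "cmod \<i> = 1" "Re (- \<i>) = 0" "cmod (- \<i>) = 1"
  by simp_all

lemma \<tau>0: "0 \<le> \<tau>" using \<tau> by simp

lemma L_eq: "L x = T (- \<i>) \<tau> (T \<i> \<tau> x)"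
  by (simp add: back_and_forth_def)

lemma L_bounded_linear: "bounded_linear L"
  unfolding back_and_forth_def o_def
  by (rule bounded_linear_compose[OF T_bounded_linear[OF imag(3,4) \<tau>0] T_bounded_linear[OF imag(1,2) \<tau>0]])

lemma L_dom: "x \<in> dom A0 \<Longrightarrow> L x \<in> dom A0"
  and L_dom2: "x \<in> dom2 \<Longrightarrow> L x \<in> dom2"
  unfolding L_eq using T_dom[OF imag(3,4)] T_dom[OF imag(1,2)] T_dom2[OF imag(3,4)] T_dom2[OF imag(1,2)] \<tau>0
  by blast+

text \<open>
  The commutators of the two factors of \<open>L\<close> add up to the commutator \<open>K\<close> of \<open>A\<^sub>0\<close> with \<open>L\<close>.
\<close>

lemma commutator:
  obtains K where "\<And>x. x \<in> dom A0 \<Longrightarrow> a (L x) = L (a x) + K x" "\<And>x. norm (K x) \<le> 4 * b * norm x"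
    "\<And>x. x \<in> dom A0 \<Longrightarrow> K x \<in> dom A0"
    "\<And>x. x \<in> dom A0 \<Longrightarrow> norm (a (K x)) \<le> 4 * \<beta> * (1 + 2 * b / m)\<^sup>2 * norm (a x)"
proof -
  note p = imag(1,2) and n = imag(3,4)
  define K where "K x = T (- \<i>) \<tau> (defect \<i> \<tau> x) + defect (- \<i>) \<tau> (T \<i> \<tau> x)" for x
  let ?\<gamma> = "1 + 2 * b / m"
  have \<gamma>: "?\<gamma> \<ge> 0" using b m by simp
  show thesis
  proof (rule that[of K])
    fix x
    have "norm (K x) \<le> 2 * b * norm x + 2 * b * norm x"
      unfolding K_def
    proof (rule norm_triangle_le[OF add_mono])
      show "norm (T (- \<i>) \<tau> (defect \<i> \<tau> x)) \<le> 2 * b * norm x"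
        by (rule order_trans[OF T_contraction[OF n \<tau>0] norm_defect_le[OF p \<tau>0]])
      show "norm (defect (- \<i>) \<tau> (T \<i> \<tau> x)) \<le> 2 * b * norm x"
        by (rule order_trans[OF norm_defect_le[OF n \<tau>0] mult_left_mono[OF T_contraction[OF p \<tau>0]]])
          (use b in simp)
    qed
    thus "norm (K x) \<le> 4 * b * norm x" by simp
    assume x: "x \<in> dom A0"
    note Tx = T_dom[OF p x \<tau>0]
    show "a (L x) = L (a x) + K x"
      unfolding L_eq a_T[OF n Tx \<tau>0] a_T[OF p x \<tau>0]
      by (simp add: K_def linear_add[OF T_linear[OF n \<tau>0]])
    have d: "T (- \<i>) \<tau> (defect \<i> \<tau> x) \<in> dom A0" "defect (- \<i>) \<tau> (T \<i> \<tau> x) \<in> dom A0"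
      by (intro T_dom[OF n] defect_dom[OF p] defect_dom[OF n] x Tx \<tau>0)+
    thus "K x \<in> dom A0" unfolding K_def by (rule dom_closed)
    have "norm (a (K x)) \<le> ?\<gamma> * (2 * \<beta> * ?\<gamma> * norm (a x)) + 2 * \<beta> * ?\<gamma> * (?\<gamma> * norm (a x))"
      unfolding K_def a_simps(2)[OF d]
    proof (rule norm_triangle_le[OF add_mono])
      show "norm (a (T (- \<i>) \<tau> (defect \<i> \<tau> x))) \<le> ?\<gamma> * (2 * \<beta> * ?\<gamma> * norm (a x))"
        by (rule order_trans[OF norm_a_T_le[OF n defect_dom[OF p x \<tau>0] \<tau>0]
              mult_left_mono[OF norm_a_defect_le[OF p x \<tau>0] \<gamma>]])
      show "norm (a (defect (- \<i>) \<tau> (T \<i> \<tau> x))) \<le> 2 * \<beta> * ?\<gamma> * (?\<gamma> * norm (a x))"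
        by (rule order_trans[OF norm_a_defect_le[OF n Tx \<tau>0] mult_left_mono[OF norm_a_T_le[OF p x \<tau>0]]])
          (use \<beta> \<gamma> in simp)
    qed
    also have "\<dots> = 4 * \<beta> * ?\<gamma>\<^sup>2 * norm (a x)" by (simp add: power2_eq_square)
    finally show "norm (a (K x)) \<le> 4 * \<beta> * ?\<gamma>\<^sup>2 * norm (a x)" .
  qed
qed

lemma L_pow_le:
  assumes "0 \<le> \<eta>" "\<And>x. norm (L x) \<le> \<eta> * norm x"
  shows "norm ((L ^^ n) x) \<le> \<eta> ^ n * norm x"
proof (induction n)
  case (Suc n)
  have "norm (L ((L ^^ n) x)) \<le> \<eta> * (\<eta> ^ n * norm x)"
    by (rule order_trans[OF assms(2) mult_left_mono[OF Suc assms(1)]])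
  thus ?case by (simp add: mult.assoc)
qed simp

lemma L_pow_dom: "x \<in> dom A0 \<Longrightarrow> (L ^^ n) x \<in> dom A0"
  and L_pow_dom2: "x \<in> dom2 \<Longrightarrow> (L ^^ n) x \<in> dom2"
  by (induction n) (auto simp: L_dom L_dom2)

text \<open>
  The identity \<open>A\<^sub>0 L = L A\<^sub>0 + K\<close> gives \<open>\<parallel>L\<^sup>n\<^sup>+\<^sup>1 x\<parallel>\<^sub>1 \<le> \<eta> \<parallel>L\<^sup>n x\<parallel>\<^sub>1 + 4b \<parallel>L\<^sup>n x\<parallel>\<close>, a recursion with contraction
  factor \<open>\<eta>\<close> and bounded inhomogeneity. Applying \<open>A\<^sub>0\<close> once more leads to the same kind of recursion
  for \<open>\<parallel>L\<^sup>n x\<parallel>\<^sub>2\<close>, where the inhomogeneity is controlled by the first one.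
\<close>

theorem powers_bounded_dom2:
  assumes \<eta>: "0 \<le> \<eta>" "\<eta> < 1" "\<And>x. norm (L x) \<le> \<eta> * norm x"
  obtains c where "c > 0" "\<And>n x. x \<in> dom2 \<Longrightarrow> norm (a (a ((L ^^ n) x))) \<le> c * norm (a (a x))"
proof -
  obtain K where K: "\<And>x. x \<in> dom A0 \<Longrightarrow> a (L x) = L (a x) + K x" "\<And>x. norm (K x) \<le> 4 * b * norm x"
    "\<And>x. x \<in> dom A0 \<Longrightarrow> K x \<in> dom A0"
    "\<And>x. x \<in> dom A0 \<Longrightarrow> norm (a (K x)) \<le> 4 * \<beta> * (1 + 2 * b / m)\<^sup>2 * norm (a x)"
    using commutator by blast
  define c1 where "c1 = 1 + 4 * b / m / (1 - \<eta>)"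
  define d where "d = 4 * b + 4 * \<beta> * (1 + 2 * b / m)\<^sup>2"
  have d: "d \<ge> 0" using b \<beta> by (simp add: d_def)
  have c1: "c1 \<ge> 0" using b m \<eta> by (simp add: c1_def)
  have first: "norm (a ((L ^^ n) x)) \<le> c1 * norm (a x)" if x: "x \<in> dom A0" for n x
  proof -
    have "norm (a ((L ^^ n) x)) \<le> norm (a ((L ^^ 0) x)) + (4 * b / m * norm (a x)) / (1 - \<eta>)"
    proof (rule geometric_recursion_bound)
      fix n
      have "norm (a ((L ^^ Suc n) x)) \<le> norm (L (a ((L ^^ n) x))) + norm (K ((L ^^ n) x))"
        using K(1)[OF L_pow_dom[OF x, of n]] norm_triangle_ineq by simp
      also have "norm (K ((L ^^ n) x)) \<le> 4 * b * norm ((L ^^ n) x)" by (rule K(2))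
      also have "norm ((L ^^ n) x) \<le> \<eta> ^ n * norm x" by (rule L_pow_le[OF \<eta>(1,3)])
      also have "\<eta> ^ n * norm x \<le> 1 * norm x" using \<eta> by (intro mult_right_mono power_le_one) auto
      also have "norm x \<le> norm (a x) / m" by (rule norm_le_norm_a[OF x])
      finally show "norm (a ((L ^^ Suc n) x)) \<le> \<eta> * norm (a ((L ^^ n) x)) + 4 * b / m * norm (a x)"
        using b \<eta>(3)[of "a ((L ^^ n) x)"] by (simp add: mult_left_mono)
    qed (use \<eta> b m in auto)
    thus ?thesis by (simp add: c1_def algebra_simps)
  qed
  define c where "c = 1 + d * c1 / m / (1 - \<eta>)"
  have c: "c > 0" unfolding c_def using d c1 m \<eta> by (intro add_pos_nonneg) auto
  have "norm (a (a ((L ^^ n) x))) \<le> c * norm (a (a x))" if x: "x \<in> dom2" for n x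
  proof -
    have ax: "norm (a x) \<le> norm (a (a x)) / m" by (rule norm_le_norm_a[OF dom2D(2)[OF x]])
    have "norm (a (a ((L ^^ n) x))) \<le>
        norm (a (a ((L ^^ 0) x))) + (d * c1 / m * norm (a (a x))) / (1 - \<eta>)"
    proof (rule geometric_recursion_bound)
      fix n
      let ?y = "(L ^^ n) x"
      note y = dom2D[OF L_pow_dom2[OF x, of n]]
      have "a (a (L ?y)) = L (a (a ?y)) + K (a ?y) + a (K ?y)"
        by (simp only: K(1)[OF y(1)] K(1)[OF y(2)] a_simps(2)[OF L_dom[OF y(2)] K(3)[OF y(1)]])
      hence "norm (a (a (L ?y))) \<le> norm (L (a (a ?y))) + norm (K (a ?y)) + norm (a (K ?y))"
        by (simp only:) (rule norm_triangle_le[OF add_right_mono[OF norm_triangle_ineq]])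
      also have "\<dots> \<le> \<eta> * norm (a (a ?y)) + 4 * b * norm (a ?y) +
          4 * \<beta> * (1 + 2 * b / m)\<^sup>2 * norm (a ?y)"
        by (intro add_mono \<eta>(3) K(2) K(4) y)
      also have "\<dots> = \<eta> * norm (a (a ?y)) + d * norm (a ?y)"
        by (simp add: d_def algebra_simps)
      also have "d * norm (a ?y) \<le> d * (c1 * (norm (a (a x)) / m))"
        using order_trans[OF first[OF dom2D(1)[OF x]] mult_left_mono[OF ax c1]] d
        by (rule mult_left_mono)
      finally show "norm (a (a ((L ^^ Suc n) x))) \<le> \<eta> * norm (a (a ?y)) + d * c1 / m * norm (a (a x))"
        by simp
    qed (use \<eta> d c1 m in auto)
    thus ?thesis by (simp add: c_def algebra_simps)
  qed
  with c that show thesis by blast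
qed

end

end

section \<open>Observability and energy decay\<close>

context observed_system
begin

lemma norm_aa_T_le:
  assumes s: "Re s = 0" "cmod s = 1" and x: "x \<in> dom2" and t: "t \<ge> 0"
  shows "norm (a (a (T s t x))) \<le> (1 + 2 * b / m) * (1 + 2 * \<beta> / m) * norm (a (a x))"
proof -
  let ?\<gamma> = "1 + 2 * b / m"
  have \<gamma>: "?\<gamma> \<ge> 0" using b m by simp
  note xd = dom2D[OF x]
  have "norm (a (a (T s t x))) \<le> ?\<gamma> * norm (a (a x)) + 2 * \<beta> * ?\<gamma> * (norm (a (a x)) / m)"
    unfolding a_T[OF s xd(1) t] a_simps(2)[OF T_dom[OF s xd(2) t] defect_dom[OF s xd(1) t]]
  proof (rule norm_triangle_le[OF add_mono])
    show "norm (a (T s t (a x))) \<le> ?\<gamma> * norm (a (a x))" by (rule norm_a_T_le[OF s xd(2) t])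
    show "norm (a (defect s t x)) \<le> 2 * \<beta> * ?\<gamma> * (norm (a (a x)) / m)"
      by (rule order_trans[OF norm_a_defect_le[OF s xd(1) t] mult_left_mono[OF norm_le_norm_a[OF xd(2)]]])
        (use \<beta> \<gamma> in simp)
  qed
  thus ?thesis by (simp add: algebra_simps)
qed

lemma solution_unique:
  assumes z: "is_solution A0 x z" "is_solution A0 x z'" and t: "t \<ge> 0"
  shows "z t = z' t"
proof -
  let ?d = "\<lambda>t. z t - z' t"
  have dom: "z u \<in> dom A0" "z' u \<in> dom A0" if "u \<ge> 0" for u
    using z that by (auto simp: is_solution_def)
  have "(norm (?d t))\<^sup>2 \<le> (norm (?d 0))\<^sup>2"
  proof (rule nonincreasing_of_derivative[where f = "\<lambda>t. (norm (?d t))\<^sup>2" and a = 0 and b = t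
        and f' = "\<lambda>t. 2 * inner (\<i> *\<^sub>C a (?d t)) (?d t)"])
    fix u :: real assume u: "u \<ge> 0"
    have "(?d has_vector_derivative \<i> *\<^sub>C a (z u) - \<i> *\<^sub>C a (z' u)) (at u within {0..})"
      using z u by (intro has_vector_derivative_diff) (auto simp: is_solution_def)
    hence "(?d has_vector_derivative \<i> *\<^sub>C a (?d u)) (at u within {0..})"
      using dom[OF u] by (simp add: a_simps(4) complex_vector.scale_right_diff_distrib)
    thus "((\<lambda>t. (norm (?d t))\<^sup>2) has_real_derivative 2 * inner (\<i> *\<^sub>C a (?d u)) (?d u)) (at u within {0..})"
      by (rule has_real_derivative_norm_square)
    show "2 * inner (\<i> *\<^sub>C a (?d u)) (?d u) \<le> 0"
      using inner_imag_a[OF dom_closed(2)[OF dom[OF u]], of \<i>] by simp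
  qed (use t in auto)
  thus ?thesis using z by (simp add: is_solution_def)
qed

lemma free_system: "observed_system A0 (\<lambda>_. 0 :: 'y) m 0 0"
proof -
  have bc: "bounded_clinear (\<lambda>_ :: 'x. 0 :: 'y)"
    by (simp add: bounded_clinear_def bounded_linear_zero)
  have "cadj (\<lambda>_ :: 'x. 0 :: 'y) 0 = 0"
    by (rule cinner_ext) (simp add: cadj[OF bc, symmetric])
  thus ?thesis
    using sa m coercive bc complex_vector.subspace_0[OF a_simps(1)] linear_opD(4)[OF selfadjoint_opD(1)[OF sa], of 0 0]
    by unfold_locales auto
qed

text \<open>
  The undamped trajectory is the orbit of the semigroup that belongs to \<open>C = 0\<close>.
\<close>

lemma free_solution:
  defines "S \<equiv> observer_semigroup A0 (\<lambda>_. 0 :: 'y) \<i>"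
  assumes x: "x \<in> dom A0"
  shows "is_solution A0 x (\<lambda>t. S t x)"
proof -
  interpret free: observed_system A0 "\<lambda>_. 0 :: 'y" m 0 0 by (rule free_system)
  have B0: "free.B x = 0" for x using free.B_le[of x] by simp
  have i: "Re \<i> = 0" "cmod \<i> = 1" by simp_all
  show ?thesis
    unfolding is_solution_def S_def
  proof (intro conjI allI impI)
    fix t :: real assume t: "0 \<le> t"
    show "free.T \<i> t x \<in> dom A0" by (rule free.T_dom[OF i x t])
    have "free.T \<i> t (free.g \<i> x) = \<i> *\<^sub>C a (free.T \<i> t x)"
      using free.g_T[OF i x t] by (simp add: free.g_def B0)
    thus "((\<lambda>t. free.T \<i> t x) has_vector_derivative \<i> *\<^sub>C a (free.T \<i> t x)) (at t within {0..})"
      using free.T_derivative[OF i x t] by simp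
  qed (rule free.T_0[OF i])
qed

lemma regular_path_solution:
  assumes z: "is_solution A0 x z" and x: "x \<in> dom2"
  shows "regular_path \<tau> z (\<lambda>t. \<i> *\<^sub>C a (z t)) (observed_system.\<kappa> m 0 0 * norm (a (a x)))"
proof -
  interpret free: observed_system A0 "\<lambda>_. 0 :: 'y" m 0 0 by (rule free_system)
  have B0: "free.B x = 0" for x using free.B_le[of x] by simp
  have i: "Re \<i> = 0" "cmod \<i> = 1" by simp_all
  have eq: "z t = free.T \<i> t x" if "t \<ge> 0" for t
    by (rule solution_unique[OF z free_solution[OF dom2D(1)[OF x]] that])
  have dq: "free.T \<i> t (free.g \<i> x) = \<i> *\<^sub>C a (z t)" if "t \<ge> 0" for t
    using free.g_T[OF i dom2D(1)[OF x] that] by (simp add: free.g_def B0 eq that)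
  have "regular_path \<tau> (\<lambda>t. free.T \<i> t x) (\<lambda>t. free.T \<i> t (free.g \<i> x)) (free.\<kappa> * norm (a (a x)))"
    by (rule free.regular_path_T[OF i x])
  note r = this[unfolded regular_path_def, rule_format]
  show ?thesis
    unfolding regular_path_def
  proof (intro ballI)
    fix t assume t: "t \<in> {0..\<tau>}"
    have "(z has_vector_derivative \<i> *\<^sub>C a (z t)) (at t within {0..})"
      using z t by (auto simp: is_solution_def)
    hence "(z has_vector_derivative \<i> *\<^sub>C a (z t)) (at t within {0..\<tau>})"
      by (rule has_vector_derivative_within_subset) auto
    thus "z t \<in> dom A0 \<and> (z has_vector_derivative \<i> *\<^sub>C a (z t)) (at t within {0..\<tau>}) \<and>
      norm (a (z t)) \<le> free.\<kappa> * norm (a (a x)) \<and>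
      (\<forall>u\<in>{0..\<tau>}. norm (\<i> *\<^sub>C a (z t) - \<i> *\<^sub>C a (z u)) \<le> free.\<kappa> * norm (a (a x)) * \<bar>t - u\<bar> \<and>
        norm (a (z t) - a (z u)) \<le> free.\<kappa> * norm (a (a x)) * \<bar>t - u\<bar>)"
      using r[OF t] t by (simp add: dq eq)
  qed
qed

lemma norm_C_square_le: "(norm (C x))\<^sup>2 \<le> b * (norm x)\<^sup>2"
proof -
  have "(norm (C x))\<^sup>2 = inner (B x) x" by (simp add: inner_B power2_norm_eq_inner)
  also have "\<dots> \<le> norm (B x) * norm x" by (rule norm_cauchy_schwarz)
  also have "\<dots> \<le> b * norm x * norm x" by (intro mult_right_mono B_le) simp
  finally show ?thesis by (simp add: power2_eq_square mult.assoc)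
qed

text \<open>
  In contrast to \<open>B_le\<close> this estimates \<open>C\<^sup>*C x\<close> by the observation \<open>C x\<close>, as needed to
  dominate the source term by the dissipated energy.
\<close>

lemma norm_B_square_le: "(norm (B x))\<^sup>2 \<le> b * (norm (C x))\<^sup>2"
proof -
  have "(norm (B x))\<^sup>2 = inner (C x) (C (B x))" by (simp add: inner_B[symmetric] power2_norm_eq_inner)
  also have "\<dots> \<le> norm (C x) * norm (C (B x))" by (rule norm_cauchy_schwarz)
  finally have "((norm (B x))\<^sup>2)\<^sup>2 \<le> (norm (C x) * norm (C (B x)))\<^sup>2"
    by (intro power_mono) auto
  also have "\<dots> \<le> (norm (C x))\<^sup>2 * (b * (norm (B x))\<^sup>2)"
    unfolding power_mult_distrib by (intro mult_left_mono norm_C_square_le) simp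
  finally have le: "(norm (B x))\<^sup>2 * (norm (B x))\<^sup>2 \<le> (b * (norm (C x))\<^sup>2) * (norm (B x))\<^sup>2"
    by (simp add: power2_eq_square ac_simps)
  show ?thesis
  proof (cases "B x = 0")
    case False
    hence "0 < (norm (B x))\<^sup>2" by simp
    thus ?thesis by (rule mult_right_le_imp_le[OF le])
  qed (use b in simp)
qed

text \<open>
  Let \<open>w\<close> be the damped and \<open>z\<close> the undamped trajectory from \<open>x\<close>. The energy loss \<open>D\<close> of \<open>w\<close> on
  \<open>[0, \<tau>]\<close> is twice the integral of \<open>\<parallel>C w\<parallel>\<^sup>2\<close>. The difference \<open>e = w - z\<close> is driven by \<open>-C\<^sup>*C w\<close>, so it is
  controlled by \<open>D\<close> as well, and then so is the integral of \<open>\<parallel>C z\<parallel>\<^sup>2\<close>, which by observability is at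
  least \<open>k\<^sup>2 \<parallel>x\<parallel>\<^sup>2\<close>.
\<close>

theorem damped_energy_decay:
  assumes \<tau>: "\<tau> > 0" and obs: "exactly_observable A0 C \<tau>"
  obtains \<rho> where "0 \<le> \<rho>" "\<rho> < 1" "\<And>x. (norm (T \<i> \<tau> x))\<^sup>2 \<le> \<rho> * (norm x)\<^sup>2"
proof -
  have i: "Re \<i> = 0" "cmod \<i> = 1" by simp_all
  obtain k where k: "k > 0" "\<And>x z. x \<in> dom A0 \<Longrightarrow> is_solution A0 x z \<Longrightarrow>
      k\<^sup>2 * (norm x)\<^sup>2 \<le> integral {0..\<tau>} (\<lambda>t. (norm (C (z t)))\<^sup>2)"
    using obs unfolding exactly_observable_def by blast
  define M where "M = 1 + \<tau> * (b\<^sup>2 * exp \<tau>)"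
  have M: "M \<ge> 1" using \<tau> by (simp add: M_def)
  interpret C: bounded_linear C using C by (rule bounded_clinearD)
  have key: "k\<^sup>2 * (norm x)\<^sup>2 \<le> M * ((norm x)\<^sup>2 - (norm (T \<i> \<tau> x))\<^sup>2)" if x: "x \<in> dom A0" for x
  proof -
    define w where "w t = T \<i> t x" for t
    define z where "z t = observer_semigroup A0 (\<lambda>_. 0 :: 'y) \<i> t x" for t
    define e where "e t = w t - z t" for t
    define D where "D = (norm x)\<^sup>2 - (norm (w \<tau>))\<^sup>2"
    have sol: "is_solution A0 x z" unfolding z_def by (rule free_solution[OF x])
    have wd: "w t \<in> dom A0" and zd: "z t \<in> dom A0" if "t \<ge> 0" for t
      using T_dom[OF i x that] sol that by (auto simp: w_def is_solution_def)
    have w': "(w has_vector_derivative g \<i> (w t)) (at t within {0..})" if "t \<ge> 0" for t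
      using T_derivative[OF i x that] g_T[OF i x that] by (simp add: w_def[abs_def])
    have z': "(z has_vector_derivative \<i> *\<^sub>C a (z t)) (at t within {0..})" if "t \<ge> 0" for t
      using sol that by (auto simp: is_solution_def)
    have e': "(e has_vector_derivative \<i> *\<^sub>C a (e t) - B (w t)) (at t within {0..})" if "t \<ge> 0" for t
    proof -
      have "(e has_vector_derivative g \<i> (w t) - \<i> *\<^sub>C a (z t)) (at t within {0..})"
        unfolding e_def[abs_def] by (intro has_vector_derivative_diff w' z' that)
      moreover have "g \<i> (w t) - \<i> *\<^sub>C a (z t) = \<i> *\<^sub>C a (e t) - B (w t)"
        using wd[OF that] zd[OF that]
        by (simp add: g_def e_def a_simps(4) complex_vector.scale_right_diff_distrib)
      ultimately show ?thesis by simp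
    qed
    have n2w: "((\<lambda>t. (norm (w t))\<^sup>2) has_real_derivative - 2 * (norm (C (w t)))\<^sup>2) (at t within {0..})"
      if "t \<ge> 0" for t
      using has_real_derivative_norm_square[OF w'[OF that]] inner_g[OF wd[OF that], of \<i>] by simp
    have mono: "(norm (w \<tau>))\<^sup>2 \<le> (norm (w t))\<^sup>2" if "0 \<le> t" "t \<le> \<tau>" for t
      by (rule nonincreasing_of_derivative[where f = "\<lambda>t. (norm (w t))\<^sup>2", OF n2w _ that]) auto
    \<comment> \<open>Gronwall's inequality in the form of a Lyapunov function: the decay of the second summand
        pays for the growth of the first one caused by the source.\<close>
    define f where "f t = exp (- t) * (norm (e t))\<^sup>2 + b / 2 * (norm (w t))\<^sup>2" for t
    have e_le: "(norm (e t))\<^sup>2 \<le> exp \<tau> * (b / 2 * D)" if t: "0 \<le> t" "t \<le> \<tau>" for t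
    proof -
      have "f t \<le> f 0"
      proof (rule nonincreasing_of_derivative[where f = f and a = 0 and b = t
            and f' = "\<lambda>t. - exp (- t) * (norm (e t))\<^sup>2 + 2 * inner (\<i> *\<^sub>C a (e t) - B (w t)) (e t) * exp (- t)
              + b / 2 * (- 2 * (norm (C (w t)))\<^sup>2)"])
        fix u :: real assume u: "u \<ge> 0"
        have ex: "((\<lambda>t. exp (- t)) has_real_derivative - exp (- u)) (at u within {0..})"
          by (auto intro!: derivative_eq_intros)
        show "(f has_real_derivative - exp (- u) * (norm (e u))\<^sup>2 +
            2 * inner (\<i> *\<^sub>C a (e u) - B (w u)) (e u) * exp (- u)
            + b / 2 * (- 2 * (norm (C (w u)))\<^sup>2)) (at u within {0..})"
          unfolding f_def[abs_def]
          by (intro DERIV_add DERIV_mult ex has_real_derivative_norm_square[OF e'[OF u]] DERIV_cmult n2w u)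
        have ed: "e u \<in> dom A0" unfolding e_def by (intro dom_closed wd zd u)
        have "2 * inner (\<i> *\<^sub>C a (e u) - B (w u)) (e u) = 2 * inner (- B (w u)) (e u)"
          using inner_imag_a[OF ed, of \<i>] by (simp add: inner_diff_left)
        also have "\<dots> \<le> 2 * (norm (B (w u)) * norm (e u))"
          using norm_cauchy_schwarz[of "- B (w u)" "e u"] unfolding norm_minus_cancel
          by (rule mult_left_mono) simp
        also have "\<dots> \<le> (norm (B (w u)))\<^sup>2 + (norm (e u))\<^sup>2"
          using sum_squares_bound[of "norm (B (w u))" "norm (e u)"] by simp
        also have "\<dots> \<le> b * (norm (C (w u)))\<^sup>2 + (norm (e u))\<^sup>2" using norm_B_square_le by simp
        finally have "2 * inner (\<i> *\<^sub>C a (e u) - B (w u)) (e u) * exp (- u) \<le>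
            (b * (norm (C (w u)))\<^sup>2 + (norm (e u))\<^sup>2) * exp (- u)" by (rule mult_right_mono) simp
        moreover have "b * (norm (C (w u)))\<^sup>2 * exp (- u) \<le> b * (norm (C (w u)))\<^sup>2 * 1"
          using u b by (intro mult_left_mono) auto
        ultimately show "- exp (- u) * (norm (e u))\<^sup>2 + 2 * inner (\<i> *\<^sub>C a (e u) - B (w u)) (e u) * exp (- u)
            + b / 2 * (- 2 * (norm (C (w u)))\<^sup>2) \<le> 0"
          by (simp add: algebra_simps)
      qed (use t in auto)
      moreover have "e 0 = 0" "w 0 = x"
        using sol by (auto simp: e_def w_def is_solution_def T_0[OF i])
      ultimately have "exp (- t) * (norm (e t))\<^sup>2 \<le> b / 2 * ((norm x)\<^sup>2 - (norm (w t))\<^sup>2)"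
        by (simp add: f_def right_diff_distrib)
      also have "\<dots> \<le> b / 2 * D" unfolding D_def using b mono[OF t] by (intro mult_left_mono) auto
      finally have *: "exp (- t) * (norm (e t))\<^sup>2 \<le> b / 2 * D" .
      have "0 \<le> exp (- t) * (norm (e t))\<^sup>2" by simp
      with * have D0: "0 \<le> b / 2 * D" by linarith
      have "(norm (e t))\<^sup>2 = exp t * (exp (- t) * (norm (e t))\<^sup>2)"
        by (simp add: mult.assoc[symmetric] exp_minus_inverse)
      also have "\<dots> \<le> exp t * (b / 2 * D)" by (intro mult_left_mono *) simp
      also have "\<dots> \<le> exp \<tau> * (b / 2 * D)" using t D0 by (intro mult_right_mono) auto
      finally show ?thesis .
    qed
    have Cz_le: "(norm (C (z t)))\<^sup>2 \<le> 2 * (norm (C (w t)))\<^sup>2 + b\<^sup>2 * exp \<tau> * D"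
      if t: "0 \<le> t" "t \<le> \<tau>" for t
    proof -
      have "C (z t) = C (w t) - C (e t)" by (simp add: e_def C.diff)
      hence "norm (C (z t)) \<le> norm (C (w t)) + norm (C (e t))"
        using norm_triangle_ineq4 by simp
      hence "(norm (C (z t)))\<^sup>2 \<le> (norm (C (w t)) + norm (C (e t)))\<^sup>2" by (intro power_mono) auto
      also have "\<dots> \<le> 2 * (norm (C (w t)))\<^sup>2 + 2 * (norm (C (e t)))\<^sup>2"
        using sum_squares_bound[of "norm (C (w t))" "norm (C (e t))"]
        by (simp add: power2_sum)
      also have "2 * (norm (C (e t)))\<^sup>2 \<le> 2 * (b * (exp \<tau> * (b / 2 * D)))"
        by (intro mult_left_mono order_trans[OF norm_C_square_le mult_left_mono[OF e_le[OF t] b]]) simp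
      also have "\<dots> = b\<^sup>2 * exp \<tau> * D" by (simp add: power2_eq_square)
      finally show ?thesis by simp
    qed
    have "((\<lambda>t. 2 * (norm (C (w t)))\<^sup>2) has_integral (- (norm (w \<tau>))\<^sup>2 - - (norm (w 0))\<^sup>2)) {0..\<tau>}"
    proof (rule fundamental_theorem_of_calculus)
      fix t assume t: "t \<in> {0..\<tau>}"
      hence "((\<lambda>t. - (norm (w t))\<^sup>2) has_real_derivative - (- 2 * (norm (C (w t)))\<^sup>2)) (at t within {0..})"
        by (intro DERIV_minus n2w) auto
      hence "((\<lambda>t. - (norm (w t))\<^sup>2) has_vector_derivative 2 * (norm (C (w t)))\<^sup>2) (at t within {0..})"
        by (simp add: has_real_derivative_iff_has_vector_derivative)
      thus "((\<lambda>t. - (norm (w t))\<^sup>2) has_vector_derivative 2 * (norm (C (w t)))\<^sup>2) (at t within {0..\<tau>})"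
        by (rule has_vector_derivative_within_subset) auto
    qed (use \<tau> in simp)
    hence "((\<lambda>t. 2 * (norm (C (w t)))\<^sup>2) has_integral D) {0..\<tau>}"
      by (simp add: D_def w_def T_0[OF i])
    moreover have "((\<lambda>t. b\<^sup>2 * exp \<tau> * D) has_integral (\<tau> - 0) *\<^sub>R (b\<^sup>2 * exp \<tau> * D)) {0..\<tau>}"
      using has_integral_const_real[of "b\<^sup>2 * exp \<tau> * D" 0 \<tau>] \<tau> by simp
    ultimately have int: "((\<lambda>t. 2 * (norm (C (w t)))\<^sup>2 + b\<^sup>2 * exp \<tau> * D) has_integral
        (D + (\<tau> - 0) *\<^sub>R (b\<^sup>2 * exp \<tau> * D))) {0..\<tau>}" by (rule has_integral_add)
    have "continuous_on {0..} z"
      using z' by (meson atLeast_iff continuous_on_eq_continuous_within has_vector_derivative_continuous)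
    hence "continuous_on {0..\<tau>} z" by (rule continuous_on_subset) auto
    hence "(\<lambda>t. (norm (C (z t)))\<^sup>2) integrable_on {0..\<tau>}"
      by (intro integrable_continuous_real continuous_intros C.continuous_on)
    hence "integral {0..\<tau>} (\<lambda>t. (norm (C (z t)))\<^sup>2) \<le> D + (\<tau> - 0) *\<^sub>R (b\<^sup>2 * exp \<tau> * D)"
      by (intro has_integral_le[OF integrable_integral int] Cz_le) auto
    also have "\<dots> = M * D" by (simp add: M_def algebra_simps)
    finally show ?thesis using k(2)[OF x sol] by (simp add: D_def w_def)
  qed
  define \<rho> where "\<rho> = max 0 (1 - k\<^sup>2 / M)"
  have \<rho>: "0 \<le> \<rho>" "\<rho> < 1" using k(1) M by (auto simp: \<rho>_def)
  have "(norm (T \<i> \<tau> x))\<^sup>2 \<le> \<rho> * (norm x)\<^sup>2" if x: "x \<in> dom A0" for x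
  proof -
    have "(norm (T \<i> \<tau> x))\<^sup>2 \<le> (1 - k\<^sup>2 / M) * (norm x)\<^sup>2"
      using key[OF x] M by (simp add: field_simps)
    also have "\<dots> \<le> \<rho> * (norm x)\<^sup>2" by (intro mult_right_mono) (auto simp: \<rho>_def)
    finally show ?thesis .
  qed
  moreover have "closed {x. (norm (T \<i> \<tau> x))\<^sup>2 \<le> \<rho> * (norm x)\<^sup>2}"
    using \<tau> by (intro closed_Collect_le continuous_intros linear_continuous_on T_bounded_linear[OF i]) auto
  ultimately have "closure (dom A0) \<subseteq> {x. (norm (T \<i> \<tau> x))\<^sup>2 \<le> \<rho> * (norm x)\<^sup>2}"
    by (intro closure_minimal) auto
  hence "(norm (T \<i> \<tau> x))\<^sup>2 \<le> \<rho> * (norm x)\<^sup>2" for x using a_dense by auto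
  with \<rho> that show thesis by blast
qed

text \<open>
  The backward semigroup is a contraction, and the forward one loses a fixed portion of the energy.
\<close>

theorem onorm_back_and_forth_less_1:
  assumes \<tau>: "\<tau> > 0" and obs: "exactly_observable A0 C \<tau>"
  shows "onorm (back_and_forth A0 C \<tau>) < 1"
proof -
  obtain \<rho> where \<rho>: "0 \<le> \<rho>" "\<rho> < 1" "\<And>x. (norm (T \<i> \<tau> x))\<^sup>2 \<le> \<rho> * (norm x)\<^sup>2"
    using damped_energy_decay[OF assms] by blast
  have "norm (back_and_forth A0 C \<tau> x) \<le> sqrt \<rho> * norm x" for x
  proof -
    have "norm (back_and_forth A0 C \<tau> x) \<le> norm (T \<i> \<tau> x)"
      unfolding L_eq[OF \<tau>] using \<tau> by (intro T_contraction) auto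
    also have "\<dots> \<le> sqrt (\<rho> * (norm x)\<^sup>2)" using \<rho>(3) by (rule real_le_rsqrt)
    finally show ?thesis by (simp add: real_sqrt_mult)
  qed
  hence "onorm (back_and_forth A0 C \<tau>) \<le> sqrt \<rho>" using \<rho> by (intro onorm_bound) auto
  also have "\<dots> < 1" using \<rho> by simp
  finally show ?thesis .
qed

end

section \<open>The fractional domain and the Galerkin scheme\<close>

context observed_system
begin

abbreviation j where "j x \<equiv> the (sqrt_op A0 x)"
abbreviation dom_half where "dom_half \<equiv> dom (sqrt_op A0)"

lemma strictly_positive: "strictly_positive_op A0"
  unfolding strictly_positive_op_def using m coercive by (auto simp: Re_cinner)

lemmas sqrt_facts = sqrt_op[OF sa strictly_positive]

lemmas j_simps = linear_opD[OF selfadjoint_opD(1)[OF sqrt_facts(1)]]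
lemmas dom_half_closed = complex_vector.subspace_add[OF j_simps(1)]
  complex_vector.subspace_diff[OF j_simps(1)] complex_vector.subspace_scale[OF j_simps(1)]
  subspace_scale[OF csubspace_subspace[OF j_simps(1)]]

lemma dom_imp_half:
  assumes "x \<in> dom A0"
  shows "x \<in> dom_half" "j x \<in> dom_half" "j (j x) = a x"
proof -
  have "(sqrt_op A0 \<circ>\<^sub>m sqrt_op A0) x = Some (a x)"
    using assms unfolding sqrt_facts(3) by auto
  thus "x \<in> dom_half" "j x \<in> dom_half" "j (j x) = a x" by (auto simp: map_comp_Some_iff)
qed

text \<open>
  The passage from the weak form of the scheme to the equation: on \<open>\<D>(A\<^sub>0)\<close> the form
  \<open>\<langle>\<cdot>,\<cdot>\<rangle>\<^sub>1\<^sub>/\<^sub>2\<close> is given by \<open>A\<^sub>0\<close>.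
\<close>

lemma half_inner_dom:
  assumes "x \<in> dom A0" "y \<in> dom_half"
  shows "half_inner A0 x y = cinner (a x) y"
  unfolding half_inner_def
  using selfadjoint_op_symmetric[OF sqrt_facts(1) dom_imp_half(2)[OF assms(1)] assms(2)]
  by (simp add: dom_imp_half(3)[OF assms(1)])

lemma half_inner_simps:
  assumes "x \<in> dom_half" "y \<in> dom_half" "z \<in> dom_half"
  shows "half_inner A0 (x + y) z = half_inner A0 x z + half_inner A0 y z"
    "half_inner A0 (x - y) z = half_inner A0 x z - half_inner A0 y z"
    "half_inner A0 (c *\<^sub>C x) z = c * half_inner A0 x z"
    "half_inner A0 (r *\<^sub>R x) z = of_real r * half_inner A0 x z"
    "half_inner A0 z (x + y) = half_inner A0 z x + half_inner A0 z y"
    "half_inner A0 z (c *\<^sub>C x) = cnj c * half_inner A0 z x"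
  using assms
  by (simp_all add: half_inner_def j_simps cinner_add_left cinner_add_right cinner_diff_left
      cinner_scaleC_left cinner_scaleC_right cinner_scaleR_left)

lemma half_inner_self: "half_inner A0 x x = of_real ((norm (j x))\<^sup>2)"
  by (simp add: half_inner_def cinner_self)

lemma j_eq_0:
  assumes "x \<in> dom_half" "j x = 0"
  shows "x = 0"
proof -
  have "sqrt_op A0 0 = Some 0"
    using j_simps(4)[of 0 0] complex_vector.subspace_0[OF j_simps(1)] by auto
  moreover have "sqrt_op A0 x = Some 0" using assms by auto
  ultimately have "(sqrt_op A0 \<circ>\<^sub>m sqrt_op A0) x = Some 0" by simp
  hence "A0 x = Some 0" unfolding sqrt_facts(3) .
  thus ?thesis using norm_le_norm_a[of x] by (auto simp: dom_def)
qed

lemma norm_j_le: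
  assumes x: "x \<in> dom A0"
  shows "norm (j x) \<le> norm (a x) / sqrt m"
proof -
  have "(norm (j x))\<^sup>2 = inner (a x) x"
    using half_inner_dom[OF x dom_imp_half(1)[OF x]] half_inner_self[of x]
    by (metis Re_cinner Re_complex_of_real)
  also have "\<dots> \<le> norm (a x) * norm x" by (rule norm_cauchy_schwarz)
  also have "\<dots> \<le> norm (a x) * (norm (a x) / m)" by (intro mult_left_mono norm_le_norm_a x) simp
  also have "\<dots> = (norm (a x) / sqrt m)\<^sup>2" using m by (simp add: power_divide power2_eq_square)
  finally show ?thesis using m by (simp add: power2_le_iff_abs_le)
qed

end

text \<open>
  A fixed finite-dimensional space \<open>V\<close>, a fixed time step, and the accuracy \<open>\<epsilon>\<close> of the projection,
  which stands for \<open>M h\<^sup>\<theta>\<close>.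
\<close>

locale galerkin = observed_system A0 C m b \<beta>
  for A0 :: "'x::complex_hilbert \<rightharpoonup> 'x" and C :: "'x \<Rightarrow> 'y::complex_hilbert" and m b \<beta> +
  fixes V :: "'x set" and \<epsilon> dt :: real
  assumes V: "finite_dim_csubspace V" "V \<subseteq> dom (sqrt_op A0)"
    and \<epsilon>: "\<epsilon> \<ge> 0" and dt: "dt > 0"
    and approx: "\<phi> \<in> dom (sqrt_op A0) \<Longrightarrow>
      norm (galerkin_proj A0 V \<phi> - \<phi>) \<le> \<epsilon> * norm (the (sqrt_op A0 \<phi>))"
begin

abbreviation \<pi> where "\<pi> \<equiv> galerkin_proj A0 V"

lemma V_basis: obtains F where "finite F" "F \<subseteq> dom_half" "complex_vector.span F = V"
proof -
  obtain F where "finite F" "complex_vector.span F = V"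
    using V(1) by (auto simp: finite_dim_csubspace_def)
  moreover have "F \<subseteq> dom_half" using \<open>complex_vector.span F = V\<close> V(2) complex_vector.span_superset by blast
  ultimately show thesis using that by blast
qed

lemma V_subspace: "complex_vector.subspace V"
  using V(1) by (simp add: finite_dim_csubspace_def)

lemmas V_closed = complex_vector.subspace_diff[OF V_subspace]
  subspace_scale[OF csubspace_subspace[OF V_subspace]]

lemma V_half: "v \<in> V \<Longrightarrow> v \<in> dom_half" using V(2) by blast

lemma \<pi>_eqI:
  assumes \<phi>: "\<phi> \<in> dom_half" and p: "p \<in> V" "\<And>\<psi>. \<psi> \<in> V \<Longrightarrow> half_inner A0 (\<phi> - p) \<psi> = 0"
  shows "\<pi> \<phi> = p"
  unfolding galerkin_proj_def
proof (rule the_equality)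
  show "p \<in> V \<and> (\<forall>\<psi>\<in>V. half_inner A0 (\<phi> - p) \<psi> = 0)" using p by blast
  fix p' assume p': "p' \<in> V \<and> (\<forall>\<psi>\<in>V. half_inner A0 (\<phi> - p') \<psi> = 0)"
  hence d: "p' - p \<in> V" using p V_closed by blast
  have "half_inner A0 (p' - p) (p' - p) = half_inner A0 (\<phi> - p) (p' - p) - half_inner A0 (\<phi> - p') (p' - p)"
    using half_inner_simps(2)[of "\<phi> - p" "\<phi> - p'" "p' - p"] p p' d \<phi>
    by (simp add: V_half dom_half_closed)
  also have "\<dots> = 0" using p(2)[OF d] p' d by simp
  finally have "j (p' - p) = 0" by (simp add: half_inner_self)
  thus "p' = p" using j_eq_0[OF V_half[OF d]] by simp
qed

lemma \<pi>:
  assumes \<phi>: "\<phi> \<in> dom_half"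
  shows "\<pi> \<phi> \<in> V" "\<psi> \<in> V \<Longrightarrow> half_inner A0 (\<pi> \<phi>) \<psi> = half_inner A0 \<phi> \<psi>"
proof -
  obtain F where F: "finite F" "F \<subseteq> dom_half" "complex_vector.span F = V" by (rule V_basis)
  have "\<exists>q\<in>complex_vector.span F. \<forall>\<psi>\<in>complex_vector.span F. half_inner A0 q \<psi> = half_inner A0 \<phi> \<psi>"
  proof (rule finite_dim_form_solvable[OF j_simps(1) F(1,2)])
    show "half_inner A0 x x \<noteq> 0" if "x \<in> dom_half" "x \<noteq> 0" for x
      using that j_eq_0[of x] by (auto simp: half_inner_self)
  qed (use \<phi> in \<open>simp_all add: half_inner_simps\<close>)
  then obtain q where q: "q \<in> V" "\<And>\<psi>. \<psi> \<in> V \<Longrightarrow> half_inner A0 q \<psi> = half_inner A0 \<phi> \<psi>"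
    unfolding F(3) by blast
  have "\<pi> \<phi> = q"
    using \<phi> q V_half by (intro \<pi>_eqI) (auto simp: half_inner_simps)
  thus "\<pi> \<phi> \<in> V" "\<psi> \<in> V \<Longrightarrow> half_inner A0 (\<pi> \<phi>) \<psi> = half_inner A0 \<phi> \<psi>" using q by auto
qed

lemma \<pi>_V:
  assumes v: "v \<in> V"
  shows "\<pi> v = v"
proof (rule \<pi>_eqI[OF V_half[OF v] v])
  fix \<psi> assume "\<psi> \<in> V"
  thus "half_inner A0 (v - v) \<psi> = 0"
    by (simp only: half_inner_simps(2)[OF V_half[OF v] V_half[OF v] V_half]) simp
qed

lemma \<pi>_diff: "x \<in> dom_half \<Longrightarrow> y \<in> dom_half \<Longrightarrow> \<pi> (x - y) = \<pi> x - \<pi> y"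
  by (intro \<pi>_eqI V_closed dom_half_closed)
    (simp_all add: half_inner_simps dom_half_closed \<pi> V_half)

lemma \<pi>_scaleR: "x \<in> dom_half \<Longrightarrow> \<pi> (r *\<^sub>R x) = r *\<^sub>R \<pi> x"
  by (intro \<pi>_eqI V_closed dom_half_closed)
    (simp_all add: half_inner_simps dom_half_closed \<pi> V_half)

lemma approx_dom:
  assumes "x \<in> dom A0"
  shows "norm (\<pi> x - x) \<le> \<epsilon> * (norm (a x) / sqrt m)"
  by (rule order_trans[OF approx[OF dom_imp_half(1)[OF assms]] mult_left_mono[OF norm_j_le[OF assms] \<epsilon>]])

lemma Re_imag_half_inner_self:
  assumes "Re s = 0"
  shows "Re (s * half_inner A0 x x) = 0"
  using assms by (simp add: half_inner_self)

text \<open>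
  The imaginary multiple of the form drops out of the real part, so the left-hand side is coercive
  in the norm of \<open>X\<close> for every step size.
\<close>

lemma scheme_step_solvable:
  assumes s: "Re s = 0"
  shows "\<exists>q\<in>V. \<forall>\<phi>\<in>V. cinner ((q - p) /\<^sub>R dt) \<phi> =
    s * half_inner A0 q \<phi> - cinner (cadj C (C q)) \<phi> + cinner F \<phi>"
proof -
  obtain X where X: "finite X" "X \<subseteq> dom_half" "complex_vector.span X = V" by (rule V_basis)
  define form where "form q \<phi> = cinner (q /\<^sub>R dt) \<phi> - s * half_inner A0 q \<phi> + cinner (B q) \<phi>" for q \<phi>
  have "\<exists>q\<in>complex_vector.span X. \<forall>\<phi>\<in>complex_vector.span X. form q \<phi> = cinner (p /\<^sub>R dt + F) \<phi>"
  proof (rule finite_dim_form_solvable[OF j_simps(1) X(1,2)])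
    fix x y z :: 'x and c :: complex
    assume x: "x \<in> dom_half"
    show "cinner (p /\<^sub>R dt + F) (c *\<^sub>C x) = cnj c * cinner (p /\<^sub>R dt + F) x"
      by (rule cinner_scaleC_right)
    show "cinner (p /\<^sub>R dt + F) (x + y) = cinner (p /\<^sub>R dt + F) x + cinner (p /\<^sub>R dt + F) y"
      by (rule cinner_add_right)
    { assume "x \<noteq> 0"
      have "Re (form x x) = inner (x /\<^sub>R dt) x - Re (s * half_inner A0 x x) + inner (B x) x"
        by (simp only: form_def plus_complex.simps minus_complex.simps Re_cinner)
      also have "\<dots> = (norm x)\<^sup>2 / dt + (norm (C x))\<^sup>2"
        unfolding Re_imag_half_inner_self[OF s]
        by (simp add: inner_B power2_norm_eq_inner divide_inverse mult.commute)
      also have "\<dots> > 0" using \<open>x \<noteq> 0\<close> dt by (intro add_pos_nonneg) auto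
      finally show "form x x \<noteq> 0" by auto }
    assume z: "z \<in> dom_half"
    show "form (c *\<^sub>C x) z = c * form x z"
      using x z by (simp add: form_def half_inner_simps cinner_scaleC_left cinner_scaleR_left
          bounded_clinearD(2)[OF B_bounded_clinear] algebra_simps)
    show "form z (c *\<^sub>C x) = cnj c * form z x"
      using x z by (simp add: form_def half_inner_simps cinner_scaleC_right algebra_simps)
    assume y: "y \<in> dom_half"
    show "form (x + y) z = form x z + form y z"
      using x y z by (simp add: form_def half_inner_simps cinner_add_left cinner_scaleR_left
          linear_add[OF B_linear] algebra_simps)
    show "form z (x + y) = form z x + form z y"
      using x y z by (simp add: form_def half_inner_simps cinner_add_right algebra_simps)
  qed
  then obtain q where q: "q \<in> V" "\<And>\<phi>. \<phi> \<in> V \<Longrightarrow> form q \<phi> = cinner (p /\<^sub>R dt + F) \<phi>"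
    unfolding X(3) by blast
  show ?thesis
  proof (intro bexI[OF _ q(1)] ballI)
    fix \<phi> assume "\<phi> \<in> V"
    from q(2)[OF this] show "cinner ((q - p) /\<^sub>R dt) \<phi> =
      s * half_inner A0 q \<phi> - cinner (cadj C (C q)) \<phi> + cinner F \<phi>"
      unfolding form_def B_def scaleR_diff_right cinner_diff_left cinner_add_left
      by (simp add: algebra_simps)
  qed
qed

abbreviation sol where "sol \<equiv> scheme_solution A0 C V"
abbreviation val where "val \<equiv> scheme_value A0 C V"

text \<open>
  Testing the scheme with the solution itself. As it is linear, this bounds the difference of two
  solutions and thereby also gives uniqueness.
\<close>

lemma scheme_stable:
  assumes s: "Re s = 0" and sol: "sol s dt e0 r K e" and k: "k \<le> K"
  shows "norm (e k) \<le> norm e0 + dt * (\<Sum>i=1..k. norm (r i))"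
  using k
proof (induction k)
  case 0
  thus ?case using sol by (simp add: scheme_solution_def)
next
  case (Suc k)
  let ?e = "e (Suc k)"
  have "cinner ((?e - e k) /\<^sub>R dt) ?e = s * half_inner A0 ?e ?e - cinner (B ?e) ?e + cinner (r (Suc k)) ?e"
    using sol Suc.prems unfolding scheme_solution_def B_def by force
  hence "inner ((?e - e k) /\<^sub>R dt) ?e = - (norm (C ?e))\<^sup>2 + inner (r (Suc k)) ?e"
    using Re_imag_half_inner_self[OF s, of ?e]
    by (metis (no_types, opaque_lifting) Re_cinner add_0 diff_0 inner_B minus_complex.simps(1)
        plus_complex.simps(1) power2_norm_eq_inner)
  also have "\<dots> \<le> inner (r (Suc k)) ?e" by simp
  also have "inner ((?e - e k) /\<^sub>R dt) ?e = (inner ?e ?e - inner (e k) ?e) / dt"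
    by (simp add: scaleR_diff_right inner_diff_left divide_inverse right_diff_distrib mult.commute)
  finally have "inner ?e ?e \<le> inner (e k) ?e + dt * inner (r (Suc k)) ?e"
    using dt by (simp add: field_simps)
  also have "\<dots> \<le> norm (e k) * norm ?e + dt * (norm (r (Suc k)) * norm ?e)"
    using dt by (intro add_mono mult_left_mono norm_cauchy_schwarz) auto
  finally have "norm ?e * norm ?e \<le> (norm (e k) + dt * norm (r (Suc k))) * norm ?e"
    by (simp add: power2_norm_eq_inner[symmetric] power2_eq_square algebra_simps)
  hence "norm ?e \<le> norm (e k) + dt * norm (r (Suc k))"
    using dt by (cases "?e = 0") auto
  thus ?case using Suc by (simp add: algebra_simps)
qed

lemma scheme_diff:
  assumes "sol s dt p F K q" "sol s dt p' F' K q'"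
  shows "sol s dt (p - p') (\<lambda>k. F k - F' k) K (\<lambda>k. q k - q' k)"
  unfolding scheme_solution_def
proof (intro conjI allI impI ballI)
  show "q 0 - q' 0 = p - p'" "\<And>k. k \<le> K \<Longrightarrow> q k - q' k \<in> V"
    using assms V_closed by (auto simp: scheme_solution_def)
  fix k \<phi> assume k: "k \<in> {1..K}" and \<phi>: "\<phi> \<in> V"
  have half: "q k \<in> dom_half" "q' k \<in> dom_half" "\<phi> \<in> dom_half"
    using assms k \<phi> V_half by (auto simp: scheme_solution_def)
  have 1: "cinner ((q k - q (k - 1)) /\<^sub>R dt) \<phi> =
      s * half_inner A0 (q k) \<phi> - cinner (B (q k)) \<phi> + cinner (F k) \<phi>"
    using assms(1) k \<phi> unfolding scheme_solution_def B_def by blast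
  have 2: "cinner ((q' k - q' (k - 1)) /\<^sub>R dt) \<phi> =
      s * half_inner A0 (q' k) \<phi> - cinner (B (q' k)) \<phi> + cinner (F' k) \<phi>"
    using assms(2) k \<phi> unfolding scheme_solution_def B_def by blast
  have "cinner ((q k - q' k - (q (k - 1) - q' (k - 1))) /\<^sub>R dt) \<phi> =
      cinner ((q k - q (k - 1)) /\<^sub>R dt) \<phi> - cinner ((q' k - q' (k - 1)) /\<^sub>R dt) \<phi>"
    unfolding cinner_diff_left[symmetric] by (simp add: algebra_simps)
  also have "\<dots> = s * half_inner A0 (q k - q' k) \<phi> - cinner (B (q k - q' k)) \<phi> + cinner (F k - F' k) \<phi>"
    unfolding 1 2 using half
    by (simp add: half_inner_simps cinner_diff_left linear_diff[OF B_linear] algebra_simps)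
  finally show "cinner ((q k - q' k - (q (k - 1) - q' (k - 1))) /\<^sub>R dt) \<phi> =
      s * half_inner A0 (q k - q' k) \<phi> - cinner (cadj C (C (q k - q' k))) \<phi> + cinner (F k - F' k) \<phi>"
    by (simp add: B_def)
qed

text \<open>
  The single steps are chained by recursion; stability identifies the result with the value that
  the description selects.
\<close>

lemma scheme_value_solution:
  assumes s: "Re s = 0" and p: "p \<in> V"
  shows "sol s dt p F K (val s dt p F)"
proof -
  have "\<forall>x y. \<exists>q. q \<in> V \<and> (\<forall>\<phi>\<in>V. cinner ((q - x) /\<^sub>R dt) \<phi> =
    s * half_inner A0 q \<phi> - cinner (cadj C (C q)) \<phi> + cinner y \<phi>)"
    using scheme_step_solvable[OF s] by blast
  then obtain step where step: "\<And>x y. step x y \<in> V" "\<And>x y \<phi>. \<phi> \<in> V \<Longrightarrow>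
      cinner ((step x y - x) /\<^sub>R dt) \<phi> =
      s * half_inner A0 (step x y) \<phi> - cinner (cadj C (C (step x y))) \<phi> + cinner y \<phi>"
    by metis
  define q where "q = rec_nat p (\<lambda>k x. step x (F (Suc k)))"
  have q: "q 0 = p" "\<And>k. q (Suc k) = step (q k) (F (Suc k))" by (simp_all add: q_def)
  have qV: "q k \<in> V" for k by (cases k) (simp_all add: q p step)
  have sol: "sol s dt p F K q" for K
    unfolding scheme_solution_def
  proof (intro conjI allI impI ballI)
    fix k \<phi> assume "k \<in> {1..K}" and \<phi>: "\<phi> \<in> V"
    then obtain i where "k = Suc i" by (cases k) auto
    thus "cinner ((q k - q (k - 1)) /\<^sub>R dt) \<phi> =
      s * half_inner A0 (q k) \<phi> - cinner (cadj C (C (q k))) \<phi> + cinner (F k) \<phi>"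
      using step(2)[OF \<phi>, of "q i" "F k"] by (simp add: q(2))
  qed (simp_all add: q(1) qV)
  have "val s dt p F k = q k" for k
    unfolding scheme_value_def
  proof (rule the_equality)
    show "\<exists>q'. sol s dt p F k q' \<and> q k = q' k" using sol by blast
    fix x assume "\<exists>q'. sol s dt p F k q' \<and> x = q' k"
    then obtain q' where q': "sol s dt p F k q'" "x = q' k" by blast
    have "norm (q' k - q k) \<le> norm (p - p) + dt * (\<Sum>i=1..k. norm (F i - F i))"
      by (rule scheme_stable[OF s scheme_diff[OF q'(1) sol[of k]]]) simp
    thus "x = q k" by (simp add: q')
  qed
  hence "val s dt p F = q" by blast
  thus ?thesis using sol by simp
qed

lemma scheme_value_V: "Re s = 0 \<Longrightarrow> p \<in> V \<Longrightarrow> val s dt p F k \<in> V"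
  using scheme_value_solution[of s p F k] by (auto simp: scheme_solution_def)

definition \<rho> where "\<rho> = 1 + (1 + b) / sqrt m"

lemma \<rho>_ge_1: "\<rho> \<ge> 1" using b m by (simp add: \<rho>_def)

text \<open>
  The projected trajectory solves the scheme up to a residual \<open>r\<close>, in which the form
  \<open>\<langle>\<cdot>,\<cdot>\<rangle>\<^sub>1\<^sub>/\<^sub>2\<close> does not appear because the projection is orthogonal for it.
\<close>

lemma scheme_consistent:
  assumes path: "regular_path \<tau> q dq \<Lambda>" and \<tau>: "\<tau> = real K * dt" and \<Lambda>: "\<Lambda> \<ge> 0"
    and eq: "\<And>t. t \<in> {0..\<tau>} \<Longrightarrow> dq t = s *\<^sub>C a (q t) - B (q t) + F t"
  obtains r where "sol s dt (\<pi> (q 0)) (\<lambda>k. F (real k * dt) + r k) K (\<lambda>k. \<pi> (q (real k * dt)))"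
    "\<And>k. k \<in> {1..K} \<Longrightarrow> norm (r k) \<le> \<rho> * (\<epsilon> + dt) * \<Lambda>"
proof -
  define t where "t k = real k * dt" for k
  define D where "D k = (q (t k) - q (t (k - 1))) /\<^sub>R dt" for k
  define r where "r k = (\<pi> (D k) - D k) + ((D k - dq (t k)) + B (\<pi> (q (t k)) - q (t k)))" for k
  note path' = path[unfolded regular_path_def, rule_format]
  have t: "t k \<in> {0..\<tau>}" if "k \<le> K" for k
    unfolding t_def \<tau> using that dt by (auto intro!: mult_right_mono)
  have qd: "q (t k) \<in> dom A0" if "k \<le> K" for k using path'[OF t[OF that]] by blast
  have tk: "t k - t (k - 1) = dt" if "k \<in> {1..K}" for k
  proof -
    have "real (k - 1) = real k - 1" using that by auto
    thus ?thesis by (simp add: t_def algebra_simps)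
  qed
  have Dd: "D k \<in> dom A0" if "k \<in> {1..K}" for k
    unfolding D_def using that by (intro dom_closed qd) auto
  show thesis
  proof (rule that[of r])
    show "sol s dt (\<pi> (q 0)) (\<lambda>k. F (real k * dt) + r k) K (\<lambda>k. \<pi> (q (real k * dt)))"
      unfolding scheme_solution_def t_def[symmetric]
    proof (intro conjI allI impI ballI)
      show "\<pi> (q (t 0)) = \<pi> (q 0)" by (simp add: t_def)
      show "\<pi> (q (t k)) \<in> V" if "k \<le> K" for k by (rule \<pi>(1)[OF dom_imp_half(1)[OF qd[OF that]]])
      fix k \<phi> assume k: "k \<in> {1..K}" and \<phi>: "\<phi> \<in> V"
      have k': "k \<le> K" "k - 1 \<le> K" using k by auto
      note h = dom_imp_half(1)[OF qd[OF k'(1)]] dom_imp_half(1)[OF qd[OF k'(2)]]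
      have "(\<pi> (q (t k)) - \<pi> (q (t (k - 1)))) /\<^sub>R dt = \<pi> (D k)"
        unfolding D_def \<pi>_scaleR[OF dom_half_closed(2)[OF h]] \<pi>_diff[OF h] ..
      moreover have "\<pi> (D k) = s *\<^sub>C a (q (t k)) - B (\<pi> (q (t k))) + (F (t k) + r k)"
        unfolding r_def eq[OF t[OF k'(1)]] by (simp add: linear_diff[OF B_linear])
      moreover have "cinner (s *\<^sub>C a (q (t k))) \<phi> = s * half_inner A0 (\<pi> (q (t k))) \<phi>"
        using \<pi>(2)[OF h(1) \<phi>] half_inner_dom[OF qd[OF k'(1)] V_half[OF \<phi>]]
        by (simp add: cinner_scaleC_left)
      ultimately show "cinner ((\<pi> (q (t k)) - \<pi> (q (t (k - 1)))) /\<^sub>R dt) \<phi> =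
          s * half_inner A0 (\<pi> (q (t k))) \<phi> - cinner (cadj C (C (\<pi> (q (t k))))) \<phi> +
          cinner (F (t k) + r k) \<phi>"
        by (simp add: cinner_add_left cinner_diff_left B_def)
    qed
    fix k assume k: "k \<in> {1..K}"
    have k': "k \<le> K" "k - 1 \<le> K" using k by auto
    note tt = t[OF k'(1)] t[OF k'(2)]
    have "norm (\<pi> (D k) - D k) \<le> \<epsilon> * (\<Lambda> / sqrt m)"
    proof -
      have "norm (a (D k)) = norm (a (q (t k)) - a (q (t (k - 1)))) / dt"
        unfolding D_def using dt qd[OF k'(1)] qd[OF k'(2)]
        by (simp add: a_simps(4,5) dom_closed divide_inverse mult.commute)
      also have "\<dots> \<le> \<Lambda> * \<bar>t k - t (k - 1)\<bar> / dt"
        using path'[OF tt(1)] tt(2) dt by (intro divide_right_mono) auto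
      also have "\<dots> = \<Lambda>" using tk[OF k] dt by simp
      finally have "\<epsilon> * (norm (a (D k)) / sqrt m) \<le> \<epsilon> * (\<Lambda> / sqrt m)"
        using m \<epsilon> by (intro mult_left_mono divide_right_mono) auto
      with approx_dom[OF Dd[OF k]] show ?thesis by linarith
    qed
    \<comment> \<open>implicit Euler: the difference quotient is compared with the derivative at the right end\<close>
    moreover have "norm (D k - dq (t k)) \<le> \<Lambda> * dt"
    proof -
      have "norm (q (t k) - q (t (k - 1)) - (t k - t (k - 1)) *\<^sub>R dq (t k)) \<le>
          norm (t k - t (k - 1)) * (\<Lambda> * dt)"
      proof (rule vector_differentiable_bound_linearization[where S = "{t (k - 1)..t k}"])
        fix u assume u: "u \<in> {t (k - 1)..t k}"
        hence u': "u \<in> {0..\<tau>}" using tt by auto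
        show "(q has_vector_derivative dq u) (at u within {t (k - 1)..t k})"
          using path'[OF u'] tt by (auto intro: has_vector_derivative_within_subset)
        have "norm (dq u - dq (t k)) \<le> \<Lambda> * \<bar>u - t k\<bar>" using path'[OF u'] tt by auto
        also have "\<dots> \<le> \<Lambda> * dt" using u tk[OF k] \<Lambda> by (intro mult_left_mono) auto
        finally show "norm (dq u - dq (t k)) \<le> \<Lambda> * dt" .
      next
        have "t (k - 1) \<le> t k" using tk[OF k] dt by linarith
        thus "closed_segment (t (k - 1)) (t k) \<subseteq> {t (k - 1)..t k}" "t k \<in> {t (k - 1)..t k}"
          by (auto simp: closed_segment_eq_real_ivl)
      qed
      hence "norm (q (t k) - q (t (k - 1)) - dt *\<^sub>R dq (t k)) \<le> dt * (\<Lambda> * dt)"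
        using dt unfolding tk[OF k] by simp
      moreover have "q (t k) - q (t (k - 1)) - dt *\<^sub>R dq (t k) = dt *\<^sub>R (D k - dq (t k))"
        using dt by (simp add: D_def scaleR_diff_right)
      ultimately show ?thesis using dt by simp
    qed
    moreover have "norm (B (\<pi> (q (t k)) - q (t k))) \<le> b * (\<epsilon> * (\<Lambda> / sqrt m))"
    proof -
      have "\<epsilon> * (norm (a (q (t k))) / sqrt m) \<le> \<epsilon> * (\<Lambda> / sqrt m)"
        using m \<epsilon> path'[OF tt(1)] by (intro mult_left_mono divide_right_mono) auto
      with approx_dom[OF qd[OF k'(1)]] have "norm (\<pi> (q (t k)) - q (t k)) \<le> \<epsilon> * (\<Lambda> / sqrt m)"
        by linarith
      thus ?thesis using order_trans[OF B_le mult_left_mono[OF _ b]] by blast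
    qed
    ultimately have "norm (r k) \<le> \<epsilon> * (\<Lambda> / sqrt m) + (\<Lambda> * dt + b * (\<epsilon> * (\<Lambda> / sqrt m)))"
      unfolding r_def by (intro norm_triangle_mono)
    also have "\<dots> = (1 + b) / sqrt m * (\<epsilon> * \<Lambda>) + 1 * (dt * \<Lambda>)"
      using m by (simp add: field_simps)
    also have "\<dots> \<le> \<rho> * (\<epsilon> * \<Lambda>) + \<rho> * (dt * \<Lambda>)"
      using \<rho>_ge_1 \<epsilon> \<Lambda> dt by (intro add_mono mult_right_mono) (auto simp: \<rho>_def)
    also have "\<dots> = \<rho> * (\<epsilon> + dt) * \<Lambda>" by (simp add: algebra_simps)
    finally show "norm (r k) \<le> \<rho> * (\<epsilon> + dt) * \<Lambda>" .
  qed
qed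

theorem scheme_error:
  assumes s: "Re s = 0" and p: "p \<in> V"
    and path: "regular_path \<tau> q dq \<Lambda>" and \<tau>: "\<tau> = real K * dt" and \<Lambda>: "\<Lambda> \<ge> 0"
    and eq: "\<And>t. t \<in> {0..\<tau>} \<Longrightarrow> dq t = s *\<^sub>C a (q t) - B (q t) + F t"
  shows "norm (\<pi> (q \<tau>) - val s dt p Fh K) \<le>
    norm (\<pi> (q 0) - p) + \<tau> * \<rho> * (\<epsilon> + dt) * \<Lambda> + dt * (\<Sum>k=1..K. norm (F (real k * dt) - Fh k))"
proof -
  obtain r where r: "sol s dt (\<pi> (q 0)) (\<lambda>k. F (real k * dt) + r k) K (\<lambda>k. \<pi> (q (real k * dt)))"
    "\<And>k. k \<in> {1..K} \<Longrightarrow> norm (r k) \<le> \<rho> * (\<epsilon> + dt) * \<Lambda>"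
    using scheme_consistent[OF path \<tau> \<Lambda> eq] by blast
  have "norm (\<pi> (q (real K * dt)) - val s dt p Fh K) \<le>
      norm (\<pi> (q 0) - p) + dt * (\<Sum>k=1..K. norm (F (real k * dt) + r k - Fh k))"
    by (rule scheme_stable[OF s scheme_diff[OF r(1) scheme_value_solution[OF s p]]]) simp
  also have "(\<Sum>k=1..K. norm (F (real k * dt) + r k - Fh k)) \<le>
      (\<Sum>k=1..K. norm (F (real k * dt) - Fh k) + \<rho> * (\<epsilon> + dt) * \<Lambda>)"
  proof (rule sum_mono)
    fix k assume "k \<in> {1..K}"
    have eq: "F (real k * dt) + r k - Fh k = (F (real k * dt) - Fh k) + r k" by simp
    show "norm (F (real k * dt) + r k - Fh k) \<le> norm (F (real k * dt) - Fh k) + \<rho> * (\<epsilon> + dt) * \<Lambda>"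
      unfolding eq by (rule norm_triangle_mono[OF order_refl r(2)[OF \<open>k \<in> {1..K}\<close>]])
  qed
  also have "\<dots> = (\<Sum>k=1..K. norm (F (real k * dt) - Fh k)) + real K * (\<rho> * (\<epsilon> + dt) * \<Lambda>)"
    by (simp add: sum.distrib)
  finally show ?thesis using dt unfolding \<tau> by (simp add: algebra_simps)
qed

end

section \<open>Error of the reconstruction\<close>

context galerkin
begin

definition \<gamma> where "\<gamma> = (1 + 2 * b / m) * (1 + 2 * \<beta> / m)"

lemma \<gamma>_nonneg: "\<gamma> \<ge> 0" unfolding \<gamma>_def using b m \<beta> by simp

context
  fixes K :: nat and \<tau> :: real
  assumes K: "K \<ge> 1" and \<tau>: "\<tau> = real K * dt"
begin

lemma \<tau>_pos: "\<tau> > 0" using K dt by (simp add: \<tau>)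

text \<open>
  The initial value \<open>v\<close> of the discrete evolution need not be the projection of \<open>x\<close>, so that the
  estimate can be iterated.
\<close>

lemma semigroup_error:
  assumes s: "Re s = 0" "cmod s = 1" and x: "x \<in> dom2" and v: "v \<in> V"
  shows "norm (\<pi> (T s \<tau> x) - discrete_semigroup A0 C V s dt K v) \<le>
    norm (\<pi> x - v) + \<tau> * \<rho> * (\<epsilon> + dt) * (\<kappa> * norm (a (a x)))"
proof -
  have "norm (\<pi> (T s \<tau> x) - val s dt v (\<lambda>_. 0) K) \<le> norm (\<pi> (T s 0 x) - v) +
      \<tau> * \<rho> * (\<epsilon> + dt) * (\<kappa> * norm (a (a x))) + dt * (\<Sum>k=1..K. norm ((\<lambda>_. 0 :: 'x) (real k * dt) - 0))"
  proof (rule scheme_error[OF s(1) v regular_path_T[OF s x] \<tau>])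
    fix t assume "t \<in> {0..\<tau>}"
    hence "t \<ge> 0" by simp
    from g_T[OF s dom2D(1)[OF x] this, symmetric]
    show "T s t (g s x) = s *\<^sub>C a (T s t x) - B (T s t x) + 0" by (simp add: g_def)
  qed (use \<kappa>_pos in simp)
  thus ?thesis by (simp add: discrete_semigroup_def \<pi>_V[OF v] T_0[OF s])
qed

lemma discrete_semigroup_V: "Re s = 0 \<Longrightarrow> v \<in> V \<Longrightarrow> discrete_semigroup A0 C V s dt K v \<in> V"
  unfolding discrete_semigroup_def by (simp add: \<pi>_V scheme_value_V)

abbreviation Lh where "Lh \<equiv> discrete_back_and_forth A0 C V dt K"

lemma Lh_V: "v \<in> V \<Longrightarrow> Lh v \<in> V"
  by (simp add: discrete_back_and_forth_def discrete_semigroup_V)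

text \<open>
  The initial error is passed on with factor \<open>1\<close>. This is what prevents exponential growth when
  sweeps are repeated.
\<close>

lemma back_and_forth_error:
  assumes x: "x \<in> dom2" and v: "v \<in> V"
  shows "norm (\<pi> (L \<tau> x) - Lh v) \<le>
    norm (\<pi> x - v) + \<tau> * \<rho> * \<kappa> * (1 + \<gamma>) * (\<epsilon> + dt) * norm (a (a x))"
proof -
  let ?e = "\<tau> * \<rho> * (\<epsilon> + dt)"
  have p: "Re \<i> = 0" "cmod \<i> = 1" and n: "Re (- \<i>) = 0" "cmod (- \<i>) = 1" by simp_all
  have \<tau>0: "\<tau> \<ge> 0" using \<tau>_pos by simp
  define y vh where "y = T \<i> \<tau> x" and "vh = discrete_semigroup A0 C V \<i> dt K v"
  have y: "y \<in> dom2" "norm (a (a y)) \<le> \<gamma> * norm (a (a x))"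
    unfolding y_def \<gamma>_def by (rule T_dom2[OF p x \<tau>0], rule norm_aa_T_le[OF p x \<tau>0])
  have vh: "vh \<in> V" unfolding vh_def by (rule discrete_semigroup_V[OF p(1) v])
  have e0: "0 \<le> ?e" using \<tau>0 \<rho>_ge_1 \<epsilon> dt by simp
  have "norm (\<pi> (T (- \<i>) \<tau> y) - discrete_semigroup A0 C V (- \<i>) dt K vh) \<le>
      norm (\<pi> y - vh) + ?e * (\<kappa> * norm (a (a y)))"
    by (rule semigroup_error[OF n y(1) vh])
  also have "norm (\<pi> y - vh) \<le> norm (\<pi> x - v) + ?e * (\<kappa> * norm (a (a x)))"
    unfolding y_def vh_def by (rule semigroup_error[OF p x v])
  also have "?e * (\<kappa> * norm (a (a y))) \<le> ?e * (\<kappa> * (\<gamma> * norm (a (a x))))"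
    using e0 \<kappa>_pos y(2) by (intro mult_left_mono) auto
  finally show ?thesis
    by (simp add: L_eq[OF \<tau>_pos] y_def vh_def discrete_back_and_forth_def algebra_simps)
qed

text \<open>
  The continuous forward observer is \<open>z(t) - T\<^sup>+\<^sub>t z\<^sub>0\<close>. At time \<open>\<tau>\<close> it equals \<open>z(\<tau>) - y\<close> with
  \<open>y = T\<^sup>+\<^sub>\<tau> z\<^sub>0\<close>, so the backward observer in reversed time is \<open>z(\<tau> - t) - T\<^sup>-\<^sub>t y\<close>, which
  ends at \<open>z\<^sub>0 - L z\<^sub>0\<close>. Both are regular trajectories, and the data errors enter as differences of
  sources, once per direction.
\<close>

lemma observer_error:
  assumes z: "is_solution A0 z0 z" and z0: "z0 \<in> dom2"
  defines "\<kappa>\<^sub>0 \<equiv> observed_system.\<kappa> m 0 0"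
  shows "backward_observer A0 C V dt K yh 0 \<in> V"
    and "norm (\<pi> (z0 - L \<tau> z0) - backward_observer A0 C V dt K yh 0) \<le>
      \<tau> * \<rho> * (2 * \<kappa>\<^sub>0 + \<kappa> + \<kappa> * \<gamma>) * (\<epsilon> + dt) * norm (a (a z0)) +
      2 * (dt * (\<Sum>l=0..K. norm (cadj C (C (z (real l * dt)) - yh l))))"
proof -
  let ?W = "norm (a (a z0))" and ?S = "\<Sum>l=0..K. norm (cadj C (C (z (real l * dt)) - yh l))"
  let ?e = "\<tau> * \<rho> * (\<epsilon> + dt)"
  have p: "Re \<i> = 0" "cmod \<i> = 1" and n: "Re (- \<i>) = 0" "cmod (- \<i>) = 1" by simp_all
  have \<tau>0: "\<tau> \<ge> 0" using \<tau>_pos by simp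
  have \<kappa>0: "\<kappa>\<^sub>0 \<ge> 0"
    unfolding \<kappa>\<^sub>0_def by (rule less_imp_le[OF observed_system.\<kappa>_pos[OF free_system]])
  have e0: "0 \<le> ?e" using \<tau>0 \<rho>_ge_1 \<epsilon> dt by simp
  have zpath: "regular_path \<tau> z (\<lambda>t. \<i> *\<^sub>C a (z t)) (\<kappa>\<^sub>0 * ?W)"
    unfolding \<kappa>\<^sub>0_def by (rule regular_path_solution[OF z z0])
  have zd: "z t \<in> dom A0" if "t \<ge> 0" for t using z that by (simp add: is_solution_def)
  have z_0: "z 0 = z0" using z by (simp add: is_solution_def)
  have adj_diff: "cadj C (u - v) = cadj C u - cadj C v" for u v
    by (rule linear_diff[OF bounded_linear.linear[OF bounded_clinearD(1)[OF bounded_clinear_cadj[OF C]]]])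
  have V0: "0 \<in> V" by (rule complex_vector.subspace_0[OF V_subspace])
  define y where "y = T \<i> \<tau> z0"
  have y: "y \<in> dom2" "norm (a (a y)) \<le> \<gamma> * ?W"
    unfolding y_def \<gamma>_def by (rule T_dom2[OF p z0 \<tau>0], rule norm_aa_T_le[OF p z0 \<tau>0])
  define fwd where "fwd = forward_observer A0 C V dt yh K"
  have fwdV: "fwd \<in> V"
    unfolding fwd_def forward_observer_def by (rule scheme_value_V[OF p(1) V0])
  show "backward_observer A0 C V dt K yh 0 \<in> V"
    unfolding backward_observer_def fwd_def[symmetric] by (rule scheme_value_V[OF n(1) fwdV])
  have forward: "norm (\<pi> (z \<tau> - y) - fwd) \<le> ?e * (\<kappa>\<^sub>0 * ?W + \<kappa> * ?W) + dt * ?S"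
  proof -
    have "norm (\<pi> (z \<tau> - T \<i> \<tau> z0) - val \<i> dt 0 (\<lambda>j. cadj C (yh j)) K) \<le>
        norm (\<pi> (z 0 - T \<i> 0 z0) - 0) + ?e * (\<kappa>\<^sub>0 * ?W + \<kappa> * ?W) +
        dt * (\<Sum>k=1..K. norm (B (z (real k * dt)) - cadj C (yh k)))"
    proof (rule scheme_error[OF p(1) V0 regular_path_diff[OF zpath regular_path_T[OF p z0]] \<tau>])
      fix t assume "t \<in> {0..\<tau>}"
      hence t: "t \<ge> 0" by simp
      have "T \<i> t (g \<i> z0) = \<i> *\<^sub>C a (T \<i> t z0) - B (T \<i> t z0)"
        using g_T[OF p dom2D(1)[OF z0] t] by (simp add: g_def)
      thus "\<i> *\<^sub>C a (z t) - T \<i> t (g \<i> z0) =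
          \<i> *\<^sub>C a (z t - T \<i> t z0) - B (z t - T \<i> t z0) + B (z t)"
        using zd[OF t] T_dom[OF p dom2D(1)[OF z0] t]
        by (simp add: a_simps(4) linear_diff[OF B_linear] complex_vector.scale_right_diff_distrib)
    qed (use \<kappa>0 \<kappa>_pos in simp)
    moreover have "\<pi> (z 0 - T \<i> 0 z0) = 0" by (simp add: z_0 T_0[OF p] \<pi>_V[OF V0])
    moreover have "(\<Sum>k=1..K. norm (B (z (real k * dt)) - cadj C (yh k))) \<le> ?S"
      unfolding B_def adj_diff by (rule sum_mono2) auto
    hence "dt * (\<Sum>k=1..K. norm (B (z (real k * dt)) - cadj C (yh k))) \<le> dt * ?S"
      using dt by (intro mult_left_mono) auto
    ultimately show ?thesis unfolding y_def fwd_def forward_observer_def by simp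
  qed
  have "norm (\<pi> (z (\<tau> - \<tau>) - T (- \<i>) \<tau> y) - val (- \<i>) dt fwd (\<lambda>j. cadj C (yh (K - j))) K) \<le>
      norm (\<pi> (z (\<tau> - 0) - T (- \<i>) 0 y) - fwd) + ?e * (\<kappa>\<^sub>0 * ?W + \<kappa> * norm (a (a y))) +
      dt * (\<Sum>k=1..K. norm (B (z (\<tau> - real k * dt)) - cadj C (yh (K - k))))"
  proof (rule scheme_error[OF n(1) fwdV
        regular_path_diff[OF regular_path_reverse[OF zpath] regular_path_T[OF n y(1)]] \<tau>])
    fix t assume "t \<in> {0..\<tau>}"
    hence t: "t \<ge> 0" "\<tau> - t \<ge> 0" by auto
    have "T (- \<i>) t (g (- \<i>) y) = (- \<i>) *\<^sub>C a (T (- \<i>) t y) - B (T (- \<i>) t y)"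
      using g_T[OF n dom2D(1)[OF y(1)] t(1)] by (simp add: g_def)
    thus "- (\<i> *\<^sub>C a (z (\<tau> - t))) - T (- \<i>) t (g (- \<i>) y) =
        (- \<i>) *\<^sub>C a (z (\<tau> - t) - T (- \<i>) t y) - B (z (\<tau> - t) - T (- \<i>) t y) + B (z (\<tau> - t))"
      using zd[OF t(2)] T_dom[OF n dom2D(1)[OF y(1)] t(1)]
      by (simp add: a_simps(4) linear_diff[OF B_linear] complex_vector.scale_right_diff_distrib)
  qed (use \<kappa>0 \<kappa>_pos in simp)
  also have "z (\<tau> - 0) - T (- \<i>) 0 y = z \<tau> - y" by (simp add: T_0[OF n])
  also have "z (\<tau> - \<tau>) - T (- \<i>) \<tau> y = z0 - L \<tau> z0" by (simp add: z_0 L_eq[OF \<tau>_pos] y_def)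
  also have "val (- \<i>) dt fwd (\<lambda>j. cadj C (yh (K - j))) K = backward_observer A0 C V dt K yh 0"
    by (simp add: backward_observer_def fwd_def)
  also have "(\<Sum>k=1..K. norm (B (z (\<tau> - real k * dt)) - cadj C (yh (K - k)))) =
      (\<Sum>k=1..K. norm (cadj C (C (z (real (K - k) * dt)) - yh (K - k))))"
  proof (rule sum.cong[OF refl])
    fix k assume "k \<in> {1..K}"
    hence "\<tau> - real k * dt = real (K - k) * dt" by (simp add: \<tau> of_nat_diff algebra_simps)
    thus "norm (B (z (\<tau> - real k * dt)) - cadj C (yh (K - k))) =
        norm (cadj C (C (z (real (K - k) * dt)) - yh (K - k)))" by (simp add: B_def adj_diff)
  qed
  also have "\<dots> = (\<Sum>l<K. norm (cadj C (C (z (real l * dt)) - yh l)))"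
    by (rule sum.reindex_bij_witness[of _ "\<lambda>l. K - l" "\<lambda>k. K - k"]) auto
  also have "norm (\<pi> (z \<tau> - y) - fwd) \<le> ?e * (\<kappa>\<^sub>0 * ?W + \<kappa> * ?W) + dt * ?S" by (rule forward)
  also have "(\<Sum>l<K. norm (cadj C (C (z (real l * dt)) - yh l))) \<le> ?S"
    by (rule sum_mono2) auto
  also have "?e * (\<kappa>\<^sub>0 * ?W + \<kappa> * norm (a (a y))) \<le> ?e * (\<kappa>\<^sub>0 * ?W + \<kappa> * (\<gamma> * ?W))"
    using y(2) e0 \<kappa>_pos by (intro mult_left_mono add_left_mono) auto
  finally show "norm (\<pi> (z0 - L \<tau> z0) - backward_observer A0 C V dt K yh 0) \<le>
      \<tau> * \<rho> * (2 * \<kappa>\<^sub>0 + \<kappa> + \<kappa> * \<gamma>) * (\<epsilon> + dt) * ?W + 2 * (dt * ?S)"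
    using dt by (simp add: algebra_simps)
qed

text \<open>
  Here \<open>p\<close> is the number of terms of the truncated Neumann series. The summands on the right are,
  in this order, the truncation error, the projection error of the terms \<open>w\<^sub>n\<close>, the error of the
  observers, and the accumulated errors of the sweeps.
\<close>

theorem reconstruction_error:
  fixes yh :: "nat \<Rightarrow> 'y"
  assumes \<eta>: "0 \<le> \<eta>" "\<And>x. norm (L \<tau> x) \<le> \<eta> * norm x"
    and c: "c > 0" "\<And>n x. x \<in> dom2 \<Longrightarrow> norm (a (a ((L \<tau> ^^ n) x))) \<le> c * norm (a (a x))"
    and z: "is_solution A0 z0 z" and z0: "z0 \<in> dom2"
    and p: "{n. real n \<le> N} = {..<p}"
  defines "\<kappa>\<^sub>0 \<equiv> observed_system.\<kappa> m 0 0" and "W \<equiv> norm (a (a z0))"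
    and "S \<equiv> dt * (\<Sum>l=0..K. norm (cadj C (C (z (real l * dt)) - yh l)))"
  shows "norm (z0 - reconstruction A0 C V dt K yh N) \<le>
    \<eta> ^ p * (W / m\<^sup>2) + real p * (\<epsilon> * (2 * c * W / (m * sqrt m)) +
      (\<tau> * \<rho> * (2 * \<kappa>\<^sub>0 + \<kappa> + \<kappa> * \<gamma>) * (\<epsilon> + dt) * W + 2 * S +
       real p * (\<tau> * \<rho> * \<kappa> * (1 + \<gamma>) * (\<epsilon> + dt) * (2 * c * W))))"
proof -
  let ?v0 = "backward_observer A0 C V dt K yh 0"
  let ?A = "\<tau> * \<rho> * (2 * \<kappa>\<^sub>0 + \<kappa> + \<kappa> * \<gamma>) * (\<epsilon> + dt) * W + 2 * S"
  let ?E = "\<tau> * \<rho> * \<kappa> * (1 + \<gamma>) * (\<epsilon> + dt)"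
  have \<tau>0: "\<tau> \<ge> 0" using \<tau>_pos by simp
  note Ldom2 = L_pow_dom2[OF \<tau>_pos]
  interpret bl: bounded_linear "L \<tau>" by (rule L_bounded_linear[OF \<tau>_pos])
  define w where "w n = (L \<tau> ^^ n) (z0 - L \<tau> z0)" for n
  define v where "v n = (Lh ^^ n) ?v0" for n
  have w_eq: "w n = (L \<tau> ^^ n) z0 - (L \<tau> ^^ Suc n) z0" for n
    unfolding w_def by (induction n) (simp_all add: bl.diff)
  note zn = Ldom2[OF z0]
  have w: "w n \<in> dom2" and aw: "norm (a (a (w n))) \<le> 2 * c * W" for n
  proof -
    note d = dom2D[OF zn[of n]] dom2D[OF zn[of "Suc n"]]
    have aw: "a (w n) = a ((L \<tau> ^^ n) z0) - a ((L \<tau> ^^ Suc n) z0)"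
      unfolding w_eq by (rule a_simps(4)[OF d(1,3)])
    show "w n \<in> dom2"
      unfolding dom2_def using aw d dom_closed(2) by (simp add: w_eq)
    have "a (a (w n)) = a (a ((L \<tau> ^^ n) z0)) - a (a ((L \<tau> ^^ Suc n) z0))"
      unfolding aw by (rule a_simps(4)[OF d(2,4)])
    hence "norm (a (a (w n))) \<le> c * W + c * W"
      unfolding W_def using norm_triangle_le_diff[OF add_mono[OF c(2)[OF z0] c(2)[OF z0]]] by metis
    thus "norm (a (a (w n))) \<le> 2 * c * W" by (simp only: mult_2 distrib_right)
  qed
  have E0: "?E \<ge> 0" using \<tau>0 \<rho>_ge_1 \<kappa>_pos \<gamma>_nonneg \<epsilon> dt by simp
  have W0: "W \<ge> 0" by (simp add: W_def)
  have vV: "v n \<in> V" and err: "norm (\<pi> (w n) - v n) \<le> ?A + real n * (?E * (2 * c * W))" for n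
  proof (induction n)
    case 0
    show "v 0 \<in> V" unfolding v_def using observer_error(1)[OF z z0] by simp
    show "norm (\<pi> (w 0) - v 0) \<le> ?A + real 0 * (?E * (2 * c * W))"
      unfolding v_def w_def S_def W_def \<kappa>\<^sub>0_def using observer_error(2)[OF z z0] by simp
  next
    case (Suc n)
    show "v (Suc n) \<in> V" using Lh_V[OF Suc(1)] by (simp add: v_def)
    have "norm (\<pi> (L \<tau> (w n)) - Lh (v n)) \<le> norm (\<pi> (w n) - v n) + ?E * norm (a (a (w n)))"
      by (rule back_and_forth_error[OF w Suc(1)])
    also have "\<dots> \<le> (?A + real n * (?E * (2 * c * W))) + ?E * (2 * c * W)"
      by (intro add_mono Suc(2) mult_left_mono aw E0)
    also have "\<dots> = ?A + real (Suc n) * (?E * (2 * c * W))"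
      by (simp only: of_nat_Suc distrib_right add.assoc mult_1 add.commute[of 1])
    finally show "norm (\<pi> (w (Suc n)) - v (Suc n)) \<le> ?A + real (Suc n) * (?E * (2 * c * W))"
      by (simp add: w_def v_def)
  qed
  have term_le: "norm (w n - v n) \<le> \<epsilon> * (2 * c * W / (m * sqrt m)) + (?A + real p * (?E * (2 * c * W)))"
    if "n < p" for n
  proof -
    have "norm (\<pi> (w n) - w n) \<le> \<epsilon> * (norm (a (w n)) / sqrt m)"
      by (rule approx_dom[OF dom2D(1)[OF w]])
    also have "\<dots> \<le> \<epsilon> * ((2 * c * W / m) / sqrt m)"
    proof (intro mult_left_mono divide_right_mono)
      show "norm (a (w n)) \<le> 2 * c * W / m"
        by (rule order_trans[OF norm_le_norm_a[OF dom2D(2)[OF w]] divide_right_mono[OF aw]]) (use m in simp)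
    qed (use \<epsilon> m in auto)
    finally have 1: "norm (\<pi> (w n) - w n) \<le> \<epsilon> * (2 * c * W / (m * sqrt m))" by simp
    have "real n * (?E * (2 * c * W)) \<le> real p * (?E * (2 * c * W))"
    proof (rule mult_right_mono)
      show "0 \<le> ?E * (2 * c * W)" by (rule mult_nonneg_nonneg[OF E0]) (use c(1) W0 in simp)
    qed (use that in simp)
    with err[of n] have 2: "norm (\<pi> (w n) - v n) \<le> ?A + real p * (?E * (2 * c * W))" by linarith
    have eq: "w n - v n = (\<pi> (w n) - v n) - (\<pi> (w n) - w n)" by simp
    show ?thesis
      unfolding eq using norm_triangle_le_diff[OF add_mono[OF 2 1]] by (simp only: add.commute)
  qed
  have "(\<Sum>n<p. w n) = z0 - (L \<tau> ^^ p) z0"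
    unfolding w_eq by (induction p) auto
  hence "z0 - reconstruction A0 C V dt K yh N = (L \<tau> ^^ p) z0 + (\<Sum>n<p. w n - v n)"
    unfolding reconstruction_def p v_def sum_subtractf by simp
  also have "norm \<dots> \<le> \<eta> ^ p * (W / m\<^sup>2) +
      real p * (\<epsilon> * (2 * c * W / (m * sqrt m)) + (?A + real p * (?E * (2 * c * W))))"
  proof (rule norm_triangle_le[OF add_mono])
    have "norm z0 \<le> W / m / m"
      unfolding W_def by (rule order_trans[OF norm_le_norm_a[OF dom2D(1)[OF z0]]
            divide_right_mono[OF norm_le_norm_a[OF dom2D(2)[OF z0]]]]) (use m in simp)
    hence "norm z0 \<le> W / m\<^sup>2" by (simp add: power2_eq_square)
    thus "norm ((L \<tau> ^^ p) z0) \<le> \<eta> ^ p * (W / m\<^sup>2)"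
      by (rule order_trans[OF L_pow_le[OF \<tau>_pos \<eta>] mult_left_mono]) (use \<eta>(1) in simp)
    have "norm (\<Sum>n<p. w n - v n) \<le> (\<Sum>n<p. \<epsilon> * (2 * c * W / (m * sqrt m)) +
        (?A + real p * (?E * (2 * c * W))))"
      by (intro order_trans[OF norm_sum] sum_mono term_le) simp
    thus "norm (\<Sum>n<p. w n - v n) \<le>
      real p * (\<epsilon> * (2 * c * W / (m * sqrt m)) + (?A + real p * (?E * (2 * c * W))))" by simp
  qed
  finally show ?thesis .
qed

end

end

lemma observed_system_constants:
  fixes A0 :: "'x::complex_hilbert \<rightharpoonup> 'x" and C :: "'x \<Rightarrow> 'y::complex_hilbert"
  assumes "selfadjoint_op A0" "strictly_positive_op A0" "bounded_clinear C"
    "bounded_on_dom A0 (cadj C \<circ> C)"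
  obtains m b \<beta> where "observed_system A0 C m b \<beta>"
proof -
  obtain m where m: "m > 0" "\<And>x. x \<in> dom A0 \<Longrightarrow> m * (norm x)\<^sup>2 \<le> inner (the (A0 x)) x"
    using strictly_positive_opD[OF assms(2)] by metis
  have "bounded_linear (\<lambda>x. cadj C (C x))"
    by (rule bounded_linear_compose[OF bounded_clinearD(1)[OF bounded_clinear_cadj[OF assms(3)]]
          bounded_clinearD(1)[OF assms(3)]])
  then obtain b where b: "b \<ge> 0" "\<And>x. norm (cadj C (C x)) \<le> norm x * b"
    using bounded_linear.nonneg_bounded by blast
  obtain c where c: "\<And>x. x \<in> dom A0 \<Longrightarrow> cadj C (C x) \<in> dom A0"
    "\<And>x. x \<in> dom A0 \<Longrightarrow> norm (the (A0 (cadj C (C x)))) \<le> c * norm (the (A0 x))"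
    using assms(4) by (auto simp: bounded_on_dom_def dom_norm_def)
  have "norm (the (A0 (cadj C (C x)))) \<le> max 0 c * norm (the (A0 x))" if "x \<in> dom A0" for x
    by (rule order_trans[OF c(2)[OF that] mult_right_mono]) auto
  hence "observed_system A0 C m b (max 0 c)"
    using assms m b c(1) by unfold_locales (auto simp: mult.commute)
  thus thesis by (rule that)
qed

text \<open>
  For \<open>\<eta> = 0\<close> the convention \<open>ln 0 = 0\<close> makes the truncation index \<open>0\<close>, so a single term is
  summed, and this is exact since \<open>L = 0\<close>. The bound \<open>\<delta> \<le> exp (- 1)\<close> ensures \<open>\<bar>ln \<delta>\<bar> \<ge> 1\<close>, which absorbs the
  rounding of the index.
\<close>

lemma number_of_terms:
  fixes \<eta> \<delta> :: real
  assumes \<eta>: "0 \<le> \<eta>" "\<eta> < 1" and \<delta>: "0 < \<delta>" "\<delta> \<le> exp (- 1)"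
  defines "N \<equiv> ln \<delta> / ln \<eta>"
  obtains p where "{n. real n \<le> N} = {..<p}" "\<eta> ^ p \<le> \<delta>"
    "real p \<le> (1 + 1 / \<bar>ln \<eta>\<bar>) * \<bar>ln \<delta>\<bar>" "1 \<le> \<bar>ln \<delta>\<bar>"
proof -
  have "ln \<delta> \<le> ln (exp (- 1))" using \<delta> by (subst ln_le_cancel_iff) auto
  hence l: "\<bar>ln \<delta>\<bar> = - ln \<delta>" "1 \<le> \<bar>ln \<delta>\<bar>" by auto
  have ln\<eta>: "ln \<eta> \<le> 0" using \<eta> by (cases "\<eta> = 0") auto
  have N: "N = \<bar>ln \<delta>\<bar> * (1 / \<bar>ln \<eta>\<bar>)" "N \<ge> 0"
    using l ln\<eta> by (auto simp: N_def divide_nonpos_nonpos)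
  define p where "p = nat \<lfloor>N\<rfloor> + 1"
  have p: "real p \<le> N + 1" "N \<le> real p" using N(2) unfolding p_def by linarith+
  show thesis
  proof (rule that[of p])
    show "{n. real n \<le> N} = {..<p}"
    proof (intro set_eqI)
      fix n
      have "real n \<le> N \<longleftrightarrow> int n \<le> \<lfloor>N\<rfloor>" by (simp add: le_floor_iff)
      thus "n \<in> {n. real n \<le> N} \<longleftrightarrow> n \<in> {..<p}" using N(2) by (auto simp: p_def)
    qed
    show "\<eta> ^ p \<le> \<delta>"
    proof (cases "\<eta> = 0")
      case True
      thus ?thesis using \<delta> by (simp add: p_def)
    next
      case False
      hence "\<eta> > 0" "ln \<eta> < 0" using \<eta> by auto
      hence "\<eta> ^ p = \<eta> powr real p" by (simp add: powr_realpow)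
      also have "\<dots> \<le> \<eta> powr N" using \<open>\<eta> > 0\<close> \<eta> p(2) by (intro powr_mono') auto
      also have "\<dots> = \<delta>" using \<open>\<eta> > 0\<close> \<open>ln \<eta> < 0\<close> \<delta> by (simp add: powr_def N_def)
      finally show ?thesis .
    qed
    show "real p \<le> (1 + 1 / \<bar>ln \<eta>\<bar>) * \<bar>ln \<delta>\<bar>"
      using p(1) l(2) unfolding N(1) distrib_right by (simp only: mult.commute)
  qed (rule l)
qed

theorem corollary2p6:
  fixes A0 :: "'x::complex_hilbert \<rightharpoonup> 'x"
    and C :: "'x \<Rightarrow> 'y::complex_hilbert"
    and Xh :: "real \<Rightarrow> 'x set"
    and \<theta> \<tau> \<eta> :: real
  assumes "selfadjoint_op A0" and "strictly_positive_op A0"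
    and "bounded_clinear C"
    and "bounded_on_dom (A0 \<circ>\<^sub>m A0) (cadj C \<circ> C)" and "bounded_on_dom A0 (cadj C \<circ> C)"
    and "\<tau> > 0" and "exactly_observable A0 C \<tau>"
    and "\<eta> = onorm (back_and_forth A0 C \<tau>)"
    and "\<And>h. h > 0 \<Longrightarrow> finite_dim_csubspace (Xh h) \<and> Xh h \<subseteq> dom (sqrt_op A0)"
    and "\<theta> > 0" and "approximation_property A0 Xh \<theta>"
  shows "\<exists>M>0. \<exists>hs>0. \<exists>dts>0.
    \<forall>z0\<in>dom (A0 \<circ>\<^sub>m A0). \<forall>z. is_solution A0 z0 z \<longrightarrow>
    (\<forall>h\<in>{0<..<hs}. \<forall>dt\<in>{0<..<dts}. \<forall>K\<ge>1. \<tau> = real K * dt \<longrightarrow> (\<forall>yh.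
      norm (z0 - reconstruction A0 C (Xh h) dt K yh (ln (h powr \<theta> + dt) / ln \<eta>))
      \<le> M * ((h powr \<theta> + dt) * (ln (h powr \<theta> + dt))\<^sup>2 * dom_norm (A0 \<circ>\<^sub>m A0) z0
             + \<bar>ln (h powr \<theta> + dt)\<bar> * dt *
               (\<Sum>l=0..K. norm (cadj C (C (z (real l * dt)) - yh l))))))"
proof -
  obtain m b \<beta> where sys: "observed_system A0 C m b \<beta>"
    using observed_system_constants[OF assms(1-3,5)] by blast
  interpret observed_system A0 C m b \<beta> by (rule sys)
  let ?L = "back_and_forth A0 C \<tau>"
  have L: "bounded_linear ?L" by (rule L_bounded_linear[OF assms(6)])
  have \<eta>: "0 \<le> \<eta>" "\<eta> < 1" "\<And>x. norm (?L x) \<le> \<eta> * norm x"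
    unfolding assms(8)
    using onorm_pos_le[OF L] onorm_back_and_forth_less_1[OF assms(6,7)] onorm[OF L] by auto
  obtain c where c: "c > 0" "\<And>n x. x \<in> dom2 \<Longrightarrow> norm (a (a ((?L ^^ n) x))) \<le> c * norm (a (a x))"
    using powers_bounded_dom2[OF assms(6) \<eta>] by blast
  obtain Ma ha where Ma: "Ma > 0" and ha: "ha > 0" and approx: "\<And>\<phi> h. \<phi> \<in> dom_half \<Longrightarrow> h \<in> {0<..<ha} \<Longrightarrow>
      norm (galerkin_proj A0 (Xh h) \<phi> - \<phi>) \<le> Ma * h powr \<theta> * norm (j \<phi>)"
    using assms(11) unfolding approximation_property_def dom_norm_def by blast
  define \<rho> where "\<rho> = 1 + (1 + b) / sqrt m"
  define \<gamma> where "\<gamma> = (1 + 2 * b / m) * (1 + 2 * \<beta> / m)"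
  define \<kappa>\<^sub>0 where "\<kappa>\<^sub>0 = observed_system.\<kappa> m 0 0"
  \<comment> \<open>the constants of reconstruction_error: Ma h^\<theta> + dt is at most \<mu> (h^\<theta> + dt), and the number
      of terms is at most q times the logarithm\<close>
  define \<mu> where "\<mu> = max 1 Ma"
  define q where "q = 1 + 1 / \<bar>ln \<eta>\<bar>"
  define c1 where "c1 = 2 * c / (m * sqrt m)"
  define c2 where "c2 = \<tau> * \<rho> * (2 * \<kappa>\<^sub>0 + \<kappa> + \<kappa> * \<gamma>)"
  define c3 where "c3 = \<tau> * \<rho> * \<kappa> * (1 + \<gamma>) * (2 * c)"
  have \<kappa>0: "\<kappa>\<^sub>0 \<ge> 0"
    unfolding \<kappa>\<^sub>0_def by (rule less_imp_le[OF observed_system.\<kappa>_pos[OF free_system]])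
  have nn: "\<rho> \<ge> 0" "\<gamma> \<ge> 0" "\<mu> \<ge> 1" "q \<ge> 1" "c1 \<ge> 0" "c2 \<ge> 0" "c3 \<ge> 0"
  proof -
    show 1: "\<rho> \<ge> 0" "\<gamma> \<ge> 0" unfolding \<rho>_def \<gamma>_def using b m \<beta> by auto
    show "\<mu> \<ge> 1" "q \<ge> 1" "c1 \<ge> 0" unfolding \<mu>_def q_def c1_def using c m by auto
    show "c2 \<ge> 0" "c3 \<ge> 0" unfolding c2_def c3_def using 1 \<kappa>0 \<kappa>_pos c assms(6) by auto
  qed
  define M where "M = 1 / m\<^sup>2 + q * (c1 * \<mu> + c2 * \<mu>) + q\<^sup>2 * (c3 * \<mu>) + 2 * q"
  have Mpos: "M > 0" unfolding M_def using nn m by (intro add_nonneg_pos add_nonneg_nonneg mult_nonneg_nonneg) auto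
  \<comment> \<open>with this bound on h, and half of exp (- 1) as bound on dt, the sum h^\<theta> + dt is at most exp (- 1)\<close>
  define hs where "hs = min ha ((exp (- 1) / 2) powr (1 / \<theta>))"
  have hs: "hs > 0" unfolding hs_def using ha by simp
  show ?thesis
  proof (rule exI[of _ M], rule conjI[OF Mpos], rule exI[of _ hs], rule conjI[OF hs],
      rule exI[of _ "exp (- 1) / 2"], intro conjI ballI allI impI)
    fix z0 z h dt K yh
    assume z0: "z0 \<in> dom (A0 \<circ>\<^sub>m A0)" and z: "is_solution A0 z0 z" and h: "h \<in> {0<..<hs}"
      and dt: "dt \<in> {0<..<exp (- 1) / 2}" and K: "K \<ge> (1::nat)" and \<tau>: "\<tau> = real K * dt"
    have z0': "z0 \<in> dom2"
      using z0 by (auto simp: dom2_def map_comp_def dom_def split: option.splits)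
    have W: "dom_norm (A0 \<circ>\<^sub>m A0) z0 = norm (a (a z0))"
      using dom2D[OF z0'] by (auto simp: dom_norm_def)
    define \<delta> where "\<delta> = h powr \<theta> + dt"
    have "h powr \<theta> \<le> ((exp (- 1) / 2) powr (1 / \<theta>)) powr \<theta>"
      using h assms(10) by (intro powr_mono2) (auto simp: hs_def)
    also have "\<dots> = exp (- 1) / 2" using assms(10) by (simp add: powr_powr)
    finally have \<delta>: "0 < \<delta>" "\<delta> \<le> exp (- 1)" using dt unfolding \<delta>_def by (auto intro: add_nonneg_pos)
    define \<epsilon> where "\<epsilon> = Ma * h powr \<theta>"
    have \<epsilon>0: "\<epsilon> \<ge> 0" using Ma by (simp add: \<epsilon>_def)
    have \<epsilon>\<delta>: "\<epsilon> + dt \<le> \<mu> * \<delta>"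
      unfolding \<epsilon>_def \<delta>_def distrib_left using dt by (intro add_mono mult_right_mono) (auto simp: \<mu>_def mult_le_cancel_right1)
    have \<epsilon>\<delta>': "\<epsilon> \<le> \<mu> * \<delta>" using \<epsilon>\<delta> dt by auto
    interpret gal: galerkin A0 C m b \<beta> "Xh h" \<epsilon> dt
    proof
      show "finite_dim_csubspace (Xh h)" "Xh h \<subseteq> dom_half" using assms(9) h by auto
      show "norm (galerkin_proj A0 (Xh h) \<phi> - \<phi>) \<le> \<epsilon> * norm (j \<phi>)" if "\<phi> \<in> dom_half" for \<phi>
        using approx[OF that, of h] h by (simp add: \<epsilon>_def hs_def)
    qed (use \<epsilon>0 dt in auto)
    obtain p where p: "{n. real n \<le> ln \<delta> / ln \<eta>} = {..<p}" "\<eta> ^ p \<le> \<delta>"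
      "real p \<le> q * \<bar>ln \<delta>\<bar>" "1 \<le> \<bar>ln \<delta>\<bar>"
      using number_of_terms[OF \<eta>(1,2) \<delta>] unfolding q_def by metis
    define W' where "W' = norm (a (a z0))"
    define S where "S = dt * (\<Sum>l=0..K. norm (cadj C (C (z (real l * dt)) - yh l)))"
    define l where "l = \<bar>ln \<delta>\<bar>"
    have W0: "W' \<ge> 0" and S0: "S \<ge> 0" using dt by (auto simp: W'_def S_def intro!: mult_nonneg_nonneg sum_nonneg)
    have l: "1 \<le> l" "l \<le> l\<^sup>2" "1 \<le> l\<^sup>2" "l\<^sup>2 = (ln \<delta>)\<^sup>2"
      using p(4) self_le_power[of l 2] by (auto simp: l_def)
    have pl: "real p \<le> q * l" using p(3) by (simp add: l_def)
    have "norm (z0 - reconstruction A0 C (Xh h) dt K yh (ln \<delta> / ln \<eta>)) \<le>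
      \<eta> ^ p * (W' / m\<^sup>2) + real p * (\<epsilon> * (c1 * W') + (c2 * (\<epsilon> + dt) * W' + 2 * S + real p * (c3 * (\<epsilon> + dt) * W')))"
      using gal.reconstruction_error[OF K \<tau> \<eta>(1,3) c z z0' p(1)]
      unfolding W'_def S_def c1_def c2_def c3_def \<rho>_def gal.\<rho>_def \<gamma>_def gal.\<gamma>_def \<kappa>\<^sub>0_def
      by (simp only: times_divide_eq_left times_divide_eq_right ac_simps)
    also have "\<dots> \<le> \<delta> * (W' / m\<^sup>2) + (q * l) * (\<mu> * \<delta> * (c1 * W') + (c2 * (\<mu> * \<delta>) * W' + 2 * S + (q * l) * (c3 * (\<mu> * \<delta>) * W')))"
      using p(2) pl \<epsilon>\<delta> \<epsilon>\<delta>' nn W0 S0 l(1) \<delta>(1) m dt \<epsilon>0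
      by (intro add_mono mult_mono mult_nonneg_nonneg add_nonneg_nonneg mult_left_mono order_refl) auto
    also have "\<dots> = (1 / m\<^sup>2) * (\<delta> * W') + (q * (c1 * \<mu> + c2 * \<mu>)) * (l * (\<delta> * W')) +
        (q\<^sup>2 * (c3 * \<mu>)) * (l\<^sup>2 * (\<delta> * W')) + 2 * q * (l * S)"
      by (simp add: algebra_simps power2_eq_square)
    also have "\<dots> \<le> (1 / m\<^sup>2) * (l\<^sup>2 * (\<delta> * W')) + (q * (c1 * \<mu> + c2 * \<mu>)) * (l\<^sup>2 * (\<delta> * W')) +
        (q\<^sup>2 * (c3 * \<mu>)) * (l\<^sup>2 * (\<delta> * W')) + 2 * q * (l * S)"
    proof (intro add_mono order_refl mult_left_mono)
      have d: "0 \<le> \<delta> * W'" using \<delta> W0 by simp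
      show "\<delta> * W' \<le> l\<^sup>2 * (\<delta> * W')" using mult_right_mono[OF l(3) d] by simp
      show "l * (\<delta> * W') \<le> l\<^sup>2 * (\<delta> * W')" by (rule mult_right_mono[OF l(2) d])
    qed (use nn in auto)
    also have "\<dots> \<le> M * (l\<^sup>2 * (\<delta> * W')) + M * (l * S)"
    proof -
      have "2 * q * (l * S) \<le> M * (l * S)"
        using nn l S0 m unfolding M_def by (intro mult_right_mono) (auto intro!: add_nonneg_nonneg)
      moreover have "(1 / m\<^sup>2 + q * (c1 * \<mu> + c2 * \<mu>) + q\<^sup>2 * (c3 * \<mu>)) * (l\<^sup>2 * (\<delta> * W')) \<le> M * (l\<^sup>2 * (\<delta> * W'))"
        using nn \<delta> W0 unfolding M_def by (intro mult_right_mono) auto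
      ultimately show ?thesis by (simp only: distrib_right)
    qed
    also have "\<dots> = M * (\<delta> * (ln \<delta>)\<^sup>2 * W' + \<bar>ln \<delta>\<bar> * S)"
      by (simp add: l_def algebra_simps)
    finally show "norm (z0 - reconstruction A0 C (Xh h) dt K yh (ln (h powr \<theta> + dt) / ln \<eta>))
      \<le> M * ((h powr \<theta> + dt) * (ln (h powr \<theta> + dt))\<^sup>2 * dom_norm (A0 \<circ>\<^sub>m A0) z0
             + \<bar>ln (h powr \<theta> + dt)\<bar> * dt *
               (\<Sum>l=0..K. norm (cadj C (C (z (real l * dt)) - yh l))))"
      unfolding W \<delta>_def W'_def S_def by (simp only: mult.assoc)
  qed simp
qed

end
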